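(* Let $(M,\Lambda)$ be an oriented Nambu-Poisson manifold of order $n$, with $n\geq 3$, and let $\nu$ be a volume form on $M$. Then $$\delta_\nu(\mathcal{V}^k_t(M,\Lambda))\subseteq\mathcal{V}^{k-1}_t(M,\Lambda)$$ for all $k\in\{1,\dots,n\}$.
   Context: All manifolds are smooth and connected. $\Omega^k(M)$ denotes the space of $k$-forms and $\mathcal{V}^k(M)$ the space of $k$-vector fields on $M$. A Nambu-Poisson manifold of order $n$ (with $n\le m=\dim M$) is a pair $(M,\Lambda)$ where $\Lambda\in\mathcal{V}^n(M)$ is such that the bracket $\{f_1,\dots,f_n\}=\Lambda(df_1,\dots,df_n)$ satisfies the fundamental identity $\{f_1,\dots,f_{n-1},\{g_1,\dots,g_n\}\}=\sum_{i=1}^n\{g_1,\dots,\{f_1,\dots,f_{n-1},g_i\},\dots,g_n\}$ for all smooth functions. It is oriented if $M$ is an oriented manifold. Contractions are in the first slots: $i(\alpha_1\wedge\dots\wedge\alpha_k)P=P(\alpha_1,\dots,\alpha_k,\cdot,\dots)$ and $i(X_1\wedge\dots\wedge X_k)\omega=\omega(X_1,\dots,X_k,\cdot,\dots)$. $\#_1:\Omega^1(M)\to\mathcal{V}^{n-1}(M)$ is $\#_1(\alpha)=i(\alpha)\Lambda$. $\flat_\nu:\mathcal{V}^k(M)\to\Omega^{m-k}(M)$ is the isomorphism $\flat_\nu(P)=i(P)\nu$, and $\delta_\nu=\flat_\nu^{-1}\circ d\circ\flat_\nu:\mathcal{V}^k(M)\to\mathcal{V}^{k-1}(M)$. For $k\in\{1,\dots,n\}$,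 $\mathcal{V}^k_t(M,\Lambda)=\{P\in\mathcal{V}^k(M): i(\alpha)P=0\text{ for all }\alpha\in\Omega^1(M)\text{ with }\alpha\in\ker\#_1\}$, and $\mathcal{V}^0_t(M,\Lambda)=C^\infty(M,\mathbb{R})$. *)

theory Defs
  imports "HOL-Analysis.Analysis"
begin

section \<open>Smooth maps between open subsets of normed spaces\<close>

text \<open>Both notions are meant for open \<open>S\<close>; \<open>Ck_on k f S\<close> says that all iterated directional
  derivatives of order up to \<open>k\<close> exist and are continuous.\<close>

fun Ck_on :: "nat \<Rightarrow> ('a::real_normed_vector \<Rightarrow> 'b::real_normed_vector) \<Rightarrow> 'a set \<Rightarrow> bool" where
  "Ck_on 0 f S \<longleftrightarrow> continuous_on S f"
| "Ck_on (Suc k) f S \<longleftrightarrow>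
     (\<forall>x\<in>S. f differentiable (at x)) \<and> (\<forall>v. Ck_on k (\<lambda>x. frechet_derivative f (at x) v) S)"

definition smooth_on :: "('a::real_normed_vector \<Rightarrow> 'b::real_normed_vector) \<Rightarrow> 'a set \<Rightarrow> bool" where
  "smooth_on f S \<longleftrightarrow> (\<forall>k. Ck_on k f S)"

section \<open>Manifolds of dimension \<open>CARD('m)\<close>\<close>

text \<open>A chart is a pair \<open>(U, \<phi>)\<close> of a domain and a coordinate map; only the values of
  \<open>\<phi>\<close> on \<open>U\<close> matter.\<close>

type_synonym ('a, 'm) chart = "'a set \<times> ('a \<Rightarrow> real ^ 'm)"

definition chart_image :: "('a, 'm::finite) chart \<Rightarrow> (real ^ 'm) set" where
  "chart_image c = snd c ` fst c"

definition chart_inv :: "('a, 'm::finite) chart \<Rightarrow> real ^ 'm \<Rightarrow> 'a" where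
  "chart_inv c = inv_into (fst c) (snd c)"

definition is_chart :: "'a topology \<Rightarrow> ('a, 'm::finite) chart \<Rightarrow> bool" where
  "is_chart X c \<longleftrightarrow> openin X (fst c) \<and> open (chart_image c) \<and>
     homeomorphic_map (subtopology X (fst c)) (top_of_set (chart_image c)) (snd c)"

definition transition :: "('a, 'm::finite) chart \<Rightarrow> ('a, 'm) chart \<Rightarrow> real ^ 'm \<Rightarrow> real ^ 'm" where
  "transition c c' = snd c' \<circ> chart_inv c"

definition transition_deriv ::
    "('a, 'm::finite) chart \<Rightarrow> ('a, 'm) chart \<Rightarrow> 'a \<Rightarrow> (real ^ 'm) \<Rightarrow>\<^sub>L (real ^ 'm)" where
  "transition_deriv c c' p = Blinfun (frechet_derivative (transition c c') (at (snd c p)))"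

definition smooth_manifold :: "'a topology \<Rightarrow> ('a, 'm::finite) chart set \<Rightarrow> bool" where
  "smooth_manifold X A \<longleftrightarrow>
     Hausdorff_space X \<and> second_countable X \<and> connected_space X \<and>
     (\<forall>c\<in>A. is_chart X c) \<and> \<Union>(fst ` A) = topspace X \<and>
     (\<forall>c\<in>A. \<forall>c'\<in>A. smooth_on (transition c c') (snd c ` (fst c \<inter> fst c')))"

text \<open>An orientation is given by an atlas whose coordinate changes have positive Jacobian
  determinant.\<close>

definition oriented_manifold :: "'a topology \<Rightarrow> ('a, 'm::finite) chart set \<Rightarrow> bool" where
  "oriented_manifold X A \<longleftrightarrow> smooth_manifold X A \<and>
     (\<forall>c\<in>A. \<forall>c'\<in>A. \<forall>p\<in>fst c \<inter> fst c'.
        det (matrix (blinfun_apply (transition_deriv c c' p))) > 0)"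

definition smooth_functions :: "('a, 'm::finite) chart set \<Rightarrow> ('a \<Rightarrow> real) set" where
  "smooth_functions A = {f. \<forall>c\<in>A. smooth_on (f \<circ> chart_inv c) (chart_image c)}"

section \<open>Differential forms and multivector fields\<close>

text \<open>Alternating \<open>k\<close>-linear functionals, as functions of argument lists of length \<open>k\<close>
  (extended by \<open>0\<close> to lists of other lengths).\<close>

definition alt_multilinear :: "nat \<Rightarrow> ('v::real_vector list \<Rightarrow> real) \<Rightarrow> bool" where
  "alt_multilinear k T \<longleftrightarrow>
     (\<forall>vs. length vs \<noteq> k \<longrightarrow> T vs = 0) \<and>
     (\<forall>vs i. length vs = k \<longrightarrow> i < k \<longrightarrow> linear (\<lambda>v. T (vs[i := v]))) \<and>
     (\<forall>vs i j. length vs = k \<longrightarrow> i < j \<longrightarrow> j < k \<longrightarrow> vs ! i = vs ! j \<longrightarrow> T vs = 0)"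

type_synonym 'm covector = "(real ^ 'm) \<Rightarrow>\<^sub>L real"

text \<open>Forms and multivector fields are families of local tensor fields on the chart images,
  one for each chart of the atlas, that correspond to each other under the coordinate changes.
  A \<open>k\<close>-form assigns to each point an alternating functional of \<open>k\<close> tangent vectors, a
  \<open>k\<close>-vector field an alternating functional of \<open>k\<close> covectors. The second argument of a
  field is a point of the chart image; the family is \<open>0\<close> outside chart images, so
  that equality of fields is equality of functions.\<close>

type_synonym ('a, 'm, 'v) field = "('a, 'm) chart \<Rightarrow> real ^ 'm \<Rightarrow> 'v list \<Rightarrow> real"
type_synonym ('a, 'm) form = "('a, 'm, real ^ 'm) field"
type_synonym ('a, 'm) mvfield = "('a, 'm, 'm covector) field"

definition local_fields ::
    "('a, 'm::finite) chart set \<Rightarrow> nat \<Rightarrow> ('a, 'm, 'v::real_vector) field set" where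
  "local_fields A k = {T.
     (\<forall>c x. c \<notin> A \<or> x \<notin> chart_image c \<longrightarrow> T c x = (\<lambda>_. 0)) \<and>
     (\<forall>c\<in>A. \<forall>x\<in>chart_image c. alt_multilinear k (T c x)) \<and>
     (\<forall>c\<in>A. \<forall>vs. smooth_on (\<lambda>x. T c x vs) (chart_image c))}"

definition forms :: "('a, 'm::finite) chart set \<Rightarrow> nat \<Rightarrow> ('a, 'm) form set" where
  "forms A k = {\<omega> \<in> local_fields A k.
     \<forall>c\<in>A. \<forall>c'\<in>A. \<forall>p\<in>fst c \<inter> fst c'. \<forall>vs.
       \<omega> c (snd c p) vs = \<omega> c' (snd c' p) (map (blinfun_apply (transition_deriv c c' p)) vs)}"

definition mvfields :: "('a, 'm::finite) chart set \<Rightarrow> nat \<Rightarrow> ('a, 'm) mvfield set" where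
  "mvfields A k = {P \<in> local_fields A k.
     \<forall>c\<in>A. \<forall>c'\<in>A. \<forall>p\<in>fst c \<inter> fst c'. \<forall>\<alpha>s.
       P c' (snd c' p) \<alpha>s = P c (snd c p) (map (\<lambda>\<alpha>. \<alpha> o\<^sub>L transition_deriv c c' p) \<alpha>s)}"

text \<open>A smooth function regarded as a field of degree \<open>0\<close>.\<close>

definition scalar_field ::
    "('a, 'm::finite) chart set \<Rightarrow> ('a \<Rightarrow> real) \<Rightarrow> ('a, 'm, 'v) field" where
  "scalar_field A f = (\<lambda>c x vs.
     if c \<in> A \<and> x \<in> chart_image c \<and> vs = [] then f (chart_inv c x) else 0)"

definition volume_form :: "('a, 'm::finite) chart set \<Rightarrow> ('a, 'm) form \<Rightarrow> bool" where
  "volume_form A \<nu> \<longleftrightarrow> \<nu> \<in> forms A CARD('m) \<and>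
     (\<forall>c\<in>A. \<forall>x\<in>chart_image c. \<exists>vs. \<nu> c x vs \<noteq> 0)"

definition ext_deriv :: "('a, 'm::finite) chart set \<Rightarrow> ('a, 'm) form \<Rightarrow> ('a, 'm) form" where
  "ext_deriv A \<omega> = (\<lambda>c x vs.
     if c \<in> A \<and> x \<in> chart_image c then
       (\<Sum>j<length vs. (- 1) ^ j *
          frechet_derivative (\<lambda>y. \<omega> c y (take j vs @ drop (Suc j) vs)) (at x) (vs ! j))
     else 0)"

section \<open>Contractions\<close>

text \<open>The covector at a point of a chart image given by a 1-form.\<close>

definition covector_of :: "('a, 'm::finite) form \<Rightarrow> ('a, 'm) chart \<Rightarrow> real ^ 'm \<Rightarrow> 'm covector" where
  "covector_of \<alpha> c x = Blinfun (\<lambda>v. \<alpha> c x [v])"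

definition contract1 :: "('a, 'm::finite) form \<Rightarrow> ('a, 'm) mvfield \<Rightarrow> ('a, 'm) mvfield" where
  "contract1 \<alpha> P = (\<lambda>c x \<beta>s. P c x (covector_of \<alpha> c x # \<beta>s))"

definition dcoord :: "'m::finite \<Rightarrow> 'm covector" where
  "dcoord i = Blinfun (\<lambda>v. v $ i)"

text \<open>The contraction \<open>i(P)\<omega>\<close> by a \<open>k\<close>-vector field is the linear extension of
  \<open>i(X\<^sub>1 \<and> \<dots> \<and> X\<^sub>k)\<omega> = \<omega>(X\<^sub>1, \<dots>, X\<^sub>k, \<cdot>, \<dots>)\<close>. Here
  \<open>(X\<^sub>1 \<and> \<dots> \<and> X\<^sub>k)(\<alpha>\<^sub>1, \<dots>, \<alpha>\<^sub>k) = det (\<alpha>\<^sub>i(X\<^sub>j))\<close>, so that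
  \<open>P = 1/k! \<Sum>\<^sub>I P(dx\<^sub>I) \<partial>\<^sub>I\<close> with the sum over all \<open>k\<close>-tuples \<open>I\<close> of
  indices, \<open>dx\<^sub>I\<close> the corresponding tuple of coordinate covectors and \<open>\<partial>\<^sub>I\<close> the wedge
  product of the corresponding coordinate vectors.\<close>

definition contract :: "nat \<Rightarrow> ('a, 'm::finite) mvfield \<Rightarrow> ('a, 'm) form \<Rightarrow> ('a, 'm) form" where
  "contract k P \<omega> = (\<lambda>c x vs.
     (\<Sum>I\<in>{I. length I = k}. P c x (map dcoord I) * \<omega> c x (map (\<lambda>i. axis i 1) I @ vs)) / fact k)"

definition flat :: "('a, 'm::finite) form \<Rightarrow> nat \<Rightarrow> ('a, 'm) mvfield \<Rightarrow> ('a, 'm) form" where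
  "flat \<nu> k P = contract k P \<nu>"

text \<open>The operator \<open>\<delta>\<^sub>\<nu>\<close> on \<open>k\<close>-vector fields; meant for \<open>k \<ge> 1\<close>.\<close>

definition delta ::
    "('a, 'm::finite) chart set \<Rightarrow> ('a, 'm) form \<Rightarrow> nat \<Rightarrow> ('a, 'm) mvfield \<Rightarrow> ('a, 'm) mvfield" where
  "delta A \<nu> k P =
     the_inv_into (mvfields A (k - 1)) (flat \<nu> (k - 1)) (ext_deriv A (flat \<nu> k P))"

section \<open>Nambu-Poisson manifolds\<close>

definition differential_at :: "('a \<Rightarrow> real) \<Rightarrow> ('a, 'm::finite) chart \<Rightarrow> 'a \<Rightarrow> 'm covector" where
  "differential_at f c p = Blinfun (frechet_derivative (f \<circ> chart_inv c) (at (snd c p)))"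

text \<open>The value of the bracket is computed in an arbitrarily chosen chart around the point; for a
  multivector field it does not depend on the choice.\<close>

definition bracket ::
    "('a, 'm::finite) chart set \<Rightarrow> ('a, 'm) mvfield \<Rightarrow> ('a \<Rightarrow> real) list \<Rightarrow> 'a \<Rightarrow> real" where
  "bracket A \<Lambda> fs p =
     (let c = (SOME c. c \<in> A \<and> p \<in> fst c)
      in \<Lambda> c (snd c p) (map (\<lambda>f. differential_at f c p) fs))"

definition nambu_poisson_tensor ::
    "('a, 'm::finite) chart set \<Rightarrow> nat \<Rightarrow> ('a, 'm) mvfield \<Rightarrow> bool" where
  "nambu_poisson_tensor A n \<Lambda> \<longleftrightarrow> \<Lambda> \<in> mvfields A n \<and>
     (\<forall>fs gs. set fs \<subseteq> smooth_functions A \<longrightarrow> set gs \<subseteq> smooth_functions A \<longrightarrow>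
        length fs = n - 1 \<longrightarrow> length gs = n \<longrightarrow>
        (\<forall>p\<in>\<Union>(fst ` A). bracket A \<Lambda> (fs @ [bracket A \<Lambda> gs]) p =
           (\<Sum>i<n. bracket A \<Lambda> (gs[i := bracket A \<Lambda> (fs @ [gs ! i])]) p)))"

definition oriented_nambu_poisson_manifold ::
    "'a topology \<Rightarrow> ('a, 'm::finite) chart set \<Rightarrow> nat \<Rightarrow> ('a, 'm) mvfield \<Rightarrow> bool" where
  "oriented_nambu_poisson_manifold X A n \<Lambda> \<longleftrightarrow>
     oriented_manifold X A \<and> n \<le> CARD('m) \<and> nambu_poisson_tensor A n \<Lambda>"

definition sharp1 :: "('a, 'm::finite) mvfield \<Rightarrow> ('a, 'm) form \<Rightarrow> ('a, 'm) mvfield" where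
  "sharp1 \<Lambda> \<alpha> = contract1 \<alpha> \<Lambda>"

definition ker_sharp1 ::
    "('a, 'm::finite) chart set \<Rightarrow> ('a, 'm) mvfield \<Rightarrow> ('a, 'm) form set" where
  "ker_sharp1 A \<Lambda> = {\<alpha> \<in> forms A 1. sharp1 \<Lambda> \<alpha> = (\<lambda>c x \<beta>s. 0)}"

definition tangential_mvfields ::
    "('a, 'm::finite) chart set \<Rightarrow> ('a, 'm) mvfield \<Rightarrow> nat \<Rightarrow> ('a, 'm) mvfield set" where
  "tangential_mvfields A \<Lambda> k =
     (if k = 0 then scalar_field A ` smooth_functions A
      else {P \<in> mvfields A k. \<forall>\<alpha>\<in>ker_sharp1 A \<Lambda>. contract1 \<alpha> P = (\<lambda>c x \<beta>s. 0)})"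

end

theory Submission
  imports Defs
begin

text \<open>Let \<open>\<alpha> \<in> ker #\<^sub>1\<close> and let \<open>P\<close> be tangential. Since \<open>i(\<alpha>)P = 0\<close>, the coordinate formula for
  \<open>\<delta>\<^sub>\<nu>\<close> gives \<open>i(\<alpha>)\<delta>\<^sub>\<nu>P = \<plusminus>i(d\<alpha>)P\<close>. Let \<open>D\<^sub>x\<close> be the span of the Hamiltonian vectors
  \<open>\<Lambda>(\<beta>\<^sub>1, \<dots>, \<beta>\<^sub>n\<^sub>-\<^sub>1, \<cdot>)\<close> at \<open>x\<close>. By the fundamental identity \<open>d\<alpha>\<close> vanishes on \<open>D\<^sub>x \<times> D\<^sub>x\<close> at
  every point. In every open set there is a point \<open>x\<close> near which the dimension of \<open>D\<close> is constant;
  there each covector annihilating \<open>D\<^sub>x\<close> is a value of a form in \<open>ker #\<^sub>1\<close>, so \<open>P\<^sub>x\<close> lies in the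
  exterior power of \<open>D\<^sub>x\<close> and \<open>i(d\<alpha>)P\<close> vanishes at \<open>x\<close>. By continuity it vanishes everywhere. This
  avoids the decomposability of \<open>\<Lambda>\<close>.\<close>

section \<open>Alternating multilinear functionals on lists\<close>

text \<open>\<open>delta\<close> is defined through \<open>the_inv_into\<close>, so nothing can be
  computed until a preimage of \<open>ext_deriv A (flat \<nu> k P)\<close> is exhibited. The
  preimage is a weighted divergence of \<open>P\<close>, found chart by chart with Cramer's rule.
  That these local expressions form one multivector field follows from the naturality of d and of
  the contraction, together with the injectivity of the contraction into a volume form; the
  divergence itself is never transformed.

  The density argument is forced by the shape of tangentiality: \<open>P\<close> is tested only
  against global forms that lie in the kernel of #_1 everywhere. Where the dimension of D drops, a
  covector annihilating D need not be a value of such a form, and \<open>P\<close> need not lie in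
  the exterior power of D. Where the rank is maximal among nearby points, a nonzero minor of the
  Hamiltonian fields gives a local extension of the covector, and a cutoff function makes it
  global.\<close>

lemma alt_multilinear_length: "alt_multilinear k T \<Longrightarrow> length vs \<noteq> k \<Longrightarrow> T vs = 0"
  by (simp add: alt_multilinear_def)

text \<open>For a list of the wrong length the map is constantly zero, hence linear. The extension
  by 0 to other lengths thus keeps length bookkeeping out of all later linearity arguments.\<close>

lemma alt_multilinear_linear:
  assumes "alt_multilinear k T"
  shows "linear (\<lambda>v. T (us @ v # ws))"
proof (cases "length (us @ 0 # ws) = k")
  case True
  then have "linear (\<lambda>v. T ((us @ 0 # ws)[length us := v]))"
    using assms unfolding alt_multilinear_def by (metis add_Suc_right length_Cons length_append less_add_Suc1)
  then show ?thesis by simp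
next
  case False
  then have "T (us @ v # ws) = 0" for v
    using alt_multilinear_length[OF assms, of "us @ v # ws"] by auto
  then show ?thesis by (simp add: linear_zero)
qed

lemma alt_multilinear_linear_Cons: "alt_multilinear k T \<Longrightarrow> linear (\<lambda>v. T (v # ws))"
  using alt_multilinear_linear[of k T "[]"] by simp

lemma alt_multilinear_linear_update:
  "alt_multilinear k T \<Longrightarrow> i < length vs \<Longrightarrow> linear (\<lambda>v. T (vs[i := v]))"
  using alt_multilinear_linear[of k T "take i vs" "drop (Suc i) vs"]
  by (simp add: upd_conv_take_nth_drop)

lemma alt_multilinear_eq_nth:
  assumes "alt_multilinear k T" "i < j" "j < length vs" "vs ! i = vs ! j"
  shows "T vs = 0"
  using assms by (cases "length vs = k") (auto simp: alt_multilinear_def)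

lemma alt_multilinear_not_distinct:
  assumes "alt_multilinear k T" "\<not> distinct vs"
  shows "T vs = 0"
  using assms alt_multilinear_eq_nth[OF assms(1)] by (metis distinct_conv_nth linorder_neqE_nat)

lemma alt_multilinear_append:
  assumes "alt_multilinear k T" "length us \<le> k"
  shows "alt_multilinear (k - length us) (\<lambda>vs. T (us @ vs))"
proof -
  have "T (us @ vs) = 0" if "length vs \<noteq> k - length us" for vs
    using alt_multilinear_length[OF assms(1), of "us @ vs"] that assms(2) by auto
  moreover have "linear (\<lambda>v. T (us @ vs[i := v]))" if "length vs = k - length us" "i < k - length us" for vs i
    using alt_multilinear_linear[OF assms(1), of "us @ take i vs" "drop (Suc i) vs"] that
    by (simp add: upd_conv_take_nth_drop)
  moreover have "T (us @ vs) = 0" if "length vs = k - length us" "i < j" "j < k - length us" "vs ! i = vs ! j" for vs i j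
    using alt_multilinear_eq_nth[OF assms(1), of "length us + i" "length us + j" "us @ vs"] that
    by (simp add: nth_append)
  ultimately show ?thesis unfolding alt_multilinear_def by blast
qed

lemma alt_multilinear_Cons:
  "alt_multilinear (Suc k) T \<Longrightarrow> alt_multilinear k (\<lambda>vs. T (v # vs))"
  using alt_multilinear_append[of "Suc k" T "[v]"] by simp

lemma alt_multilinear_append_right:
  assumes "alt_multilinear k T" "length ws \<le> k"
  shows "alt_multilinear (k - length ws) (\<lambda>vs. T (vs @ ws))"
proof -
  have "T (vs @ ws) = 0" if "length vs \<noteq> k - length ws" for vs
    using alt_multilinear_length[OF assms(1), of "vs @ ws"] that assms(2) by auto
  moreover have "linear (\<lambda>v. T (vs[i := v] @ ws))" if "length vs = k - length ws" "i < k - length ws" for vs i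
    using alt_multilinear_linear[OF assms(1), of "take i vs" "drop (Suc i) vs @ ws"] that
    by (simp add: upd_conv_take_nth_drop)
  moreover have "T (vs @ ws) = 0" if "length vs = k - length ws" "i < j" "j < k - length ws" "vs ! i = vs ! j" for vs i j
    using alt_multilinear_eq_nth[OF assms(1), of i j "vs @ ws"] that
    by (simp add: nth_append)
  ultimately show ?thesis unfolding alt_multilinear_def by blast
qed

lemma alt_multilinear_zero: "alt_multilinear k (\<lambda>_. 0)"
  by (simp add: alt_multilinear_def linear_zero)

lemma alt_multilinear_add:
  "alt_multilinear k S \<Longrightarrow> alt_multilinear k T \<Longrightarrow> alt_multilinear k (\<lambda>vs. S vs + T vs)"
  unfolding alt_multilinear_def by (simp add: linear_compose_add)

lemma alt_multilinear_cmult: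
  "alt_multilinear k T \<Longrightarrow> alt_multilinear k (\<lambda>vs. a * T vs)"
  unfolding alt_multilinear_def using linear_compose_scale_right[of "\<lambda>v. T (vs[i := v])" a for vs i] by simp

lemma alt_multilinear_diff:
  "alt_multilinear k S \<Longrightarrow> alt_multilinear k T \<Longrightarrow> alt_multilinear k (\<lambda>vs. S vs - T vs)"
  using alt_multilinear_add[OF _ alt_multilinear_cmult, of k S T "-1"] by simp

lemma alt_multilinear_sum:
  "(\<And>i. i \<in> I \<Longrightarrow> alt_multilinear k (T i)) \<Longrightarrow> alt_multilinear k (\<lambda>vs. \<Sum>i\<in>I. T i vs)"
  by (induction I rule: infinite_finite_induct)
    (auto simp: alt_multilinear_zero intro!: alt_multilinear_add)

lemma alt_multilinear_map:
  assumes "alt_multilinear k T" "linear L"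
  shows "alt_multilinear k (\<lambda>vs. T (map L vs))"
proof -
  have "linear (\<lambda>v. T (map L (vs[i := v])))" if "length vs = k" "i < k" for vs i
    using linear_compose[OF assms(2) alt_multilinear_linear_update[OF assms(1), of i "map L vs"]] that
    by (simp add: map_update o_def)
  moreover have "T (map L vs) = 0" if "length vs = k" "i < j" "j < k" "vs ! i = vs ! j" for vs i j
    using alt_multilinear_eq_nth[OF assms(1) that(2), of "map L vs"] that by auto
  ultimately show ?thesis
    using alt_multilinear_length[OF assms(1)] unfolding alt_multilinear_def by simp
qed

lemma alt_multilinear_swap:
  assumes "alt_multilinear k T"
  shows "T (us @ a # b # ws) = - T (us @ b # a # ws)"
proof -
  note l1 = alt_multilinear_linear[OF assms, of us]
  note l2 = alt_multilinear_linear[OF assms, of "us @ [x]" for x, simplified]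
  have z: "T (us @ x # x # ws) = 0" for x
    using alt_multilinear_eq_nth[OF assms, of "length us" "Suc (length us)" "us @ x # x # ws"]
    by (simp add: nth_append)
  have "0 = T (us @ (a + b) # (a + b) # ws)" by (simp add: z)
  also have "\<dots> = T (us @ a # a # ws) + T (us @ a # b # ws) + (T (us @ b # a # ws) + T (us @ b # b # ws))"
    by (simp only: linear_add[OF l1] linear_add[OF l2])
  finally show ?thesis by (simp add: z)
qed

lemma alt_multilinear_move:
  assumes "alt_multilinear k T"
  shows "T (us @ ws @ a # zs) = (-1) ^ length ws * T (us @ a # ws @ zs)"
proof (induction ws arbitrary: us)
  case (Cons w ws)
  have "T (us @ (w # ws) @ a # zs) = T ((us @ [w]) @ ws @ a # zs)" by simp
  also have "\<dots> = (-1) ^ length ws * T (us @ w # a # ws @ zs)" unfolding Cons.IH by simp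
  also have "\<dots> = (-1) ^ length (w # ws) * T (us @ a # (w # ws) @ zs)"
    using alt_multilinear_swap[OF assms, of us w a "ws @ zs"] by simp
  finally show ?case .
qed simp

lemma alt_multilinear_to_front:
  "alt_multilinear k T \<Longrightarrow> T (ws @ a # zs) = (-1) ^ length ws * T (a # ws @ zs)"
  using alt_multilinear_move[of k T "[]"] by simp

text \<open>Instead of the sign of a permutation there is just some scalar, the same for all
  \<open>T\<close>. It comes from moving the head to its place in the other list, and it suffices
  for carrying vanishing from one ordering of a basis to another.\<close>

lemma alt_multilinear_permute:
  assumes "mset us = mset vs"
  shows "\<exists>s. s \<noteq> 0 \<and> (\<forall>T. alt_multilinear k T \<longrightarrow> T us = s * T vs)"
  using assms
proof (induction us arbitrary: vs k)
  case Nil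
  then show ?case by (auto intro: exI[of _ 1])
next
  case (Cons a us)
  show ?case
  proof (cases k)
    case 0
    have "T (a # us) = 1 * T vs" if "alt_multilinear k T" for T :: "'a list \<Rightarrow> real"
      using alt_multilinear_length[OF that] 0 Cons.prems
      by (metis length_greater_0_conv list.discI mult_zero_right not_gr_zero size_mset)
    then show ?thesis by (intro exI[of _ 1]) auto
  next
    case (Suc k')
    have "a \<in> set vs" using Cons.prems by (metis list.set_intros(1) set_mset_mset)
    then obtain xs ys where vs: "vs = xs @ a # ys" by (meson split_list)
    then have "mset us = mset (xs @ ys)" using Cons.prems by simp
    from Cons.IH[OF this, of k'] obtain s where s: "s \<noteq> 0"
      "\<And>T. alt_multilinear k' T \<Longrightarrow> T us = s * T (xs @ ys)" by blast
    have "T (a # us) = s * (-1) ^ length xs * T vs" if "alt_multilinear k T" for T :: "'a list \<Rightarrow> real"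
      using s(2)[OF alt_multilinear_Cons[of k' T a]] that Suc
        alt_multilinear_to_front[OF that, of xs a ys] vs by (simp add: mult.assoc)
    then show ?thesis using s(1) by (intro exI[of _ "s * (-1) ^ length xs"]) auto
  qed
qed

section \<open>Evaluation on spanning families and functionals of top degree\<close>

lemma linear_zero_on_span:
  fixes f :: "'v::real_vector \<Rightarrow> real"
  assumes "linear f" "\<And>i. f (e i) = 0" "v \<in> span (range e)"
  shows "f v = 0"
  using linear_eq_0_on_span[OF assms(1), of "range e"] assms by auto

text \<open>By induction the functional with first argument \<open>e i\<close> vanishes for every
  \<open>i\<close>; linearity in the first argument then passes from the \<open>e i\<close> to their
  span.\<close>

lemma alt_multilinear_eq_0_basis:
  assumes "alt_multilinear k T" "\<And>v. v \<in> span (range e)"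
    and "\<And>I. length I = k \<Longrightarrow> T (map e I) = 0"
  shows "T vs = 0"
  using assms(1,3)
proof (induction k arbitrary: T vs)
  case 0
  then show ?case using alt_multilinear_length[OF 0(1), of vs] by (cases vs) auto
next
  case (Suc k)
  show ?case
  proof (cases vs)
    case Nil
    then show ?thesis using alt_multilinear_length[OF Suc(2), of vs] by simp
  next
    case (Cons v ws)
    have "T (e i # ws) = 0" for i
      using Suc.IH[OF alt_multilinear_Cons[OF Suc.prems(1), of "e i"], of ws] Suc.prems(2)
      by (metis length_Cons list.simps(9))
    then show ?thesis
      using linear_zero_on_span[OF alt_multilinear_linear_Cons[OF Suc.prems(1)] _ assms(2)] Cons by blast
  qed
qed

text \<open>Pigeonhole: a tuple of more than \<open>CARD('m)\<close> indices repeats one. This is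
  the source of Cramer's rule below and of the bound on the rank of the Hamiltonian fields.\<close>

lemma alt_multilinear_too_long:
  fixes e :: "'m::finite \<Rightarrow> 'v::real_vector" and T :: "'v list \<Rightarrow> real"
  assumes "alt_multilinear k T" "\<And>v. v \<in> span (range e)" "k > CARD('m)"
  shows "T vs = 0"
proof (rule alt_multilinear_eq_0_basis[OF assms(1,2)])
  fix I :: "'m list" assume "length I = k"
  then have "\<not> distinct I"
    using assms(3) card_mono[OF finite subset_UNIV, of "set I"] distinct_card[of I] by auto
  then show "T (map e I) = 0"
    using alt_multilinear_not_distinct[OF assms(1)] by (simp add: distinct_map)
qed

lemma alt_multilinear_top_basis:
  fixes e :: "'m::finite \<Rightarrow> 'v::real_vector"
  assumes "alt_multilinear CARD('m) T" "\<And>v. v \<in> span (range e)"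
    and "distinct J" "set J = UNIV" "T (map e J) = 0"
  shows "T vs = 0"
proof (rule alt_multilinear_eq_0_basis[OF assms(1,2)])
  fix I :: "'m list" assume I: "length I = CARD('m)"
  show "T (map e I) = 0"
  proof (cases "distinct I")
    case True
    then have "set I = UNIV" using I by (intro card_subset_eq) (auto simp: distinct_card)
    then have "mset (map e I) = mset (map e J)"
      using True assms(3,4) by (metis mset_map set_eq_iff_mset_eq_distinct)
    then show ?thesis
      using alt_multilinear_permute[of "map e I" "map e J" "CARD('m)"] assms(1,5) by (metis mult_zero_right)
  qed (simp add: alt_multilinear_not_distinct[OF assms(1)] distinct_map)
qed

text \<open>The cross-multiplied difference has top degree and vanishes on the basis ordered by
  \<open>J\<close>. It serves to write the derivative of a volume form as a multiple of the form
  itself.\<close>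

lemma alt_multilinear_top_proportional:
  fixes e :: "'m::finite \<Rightarrow> 'v::real_vector"
  assumes "alt_multilinear CARD('m) S" "alt_multilinear CARD('m) T" "\<And>v. v \<in> span (range e)"
    and "distinct J" "set J = UNIV"
  shows "S (map e J) * T vs = T (map e J) * S vs"
  using alt_multilinear_top_basis[OF alt_multilinear_diff[OF
      alt_multilinear_cmult[OF assms(2), of "S (map e J)"]
      alt_multilinear_cmult[OF assms(1), of "T (map e J)"]] assms(3-5), of vs]
  by simp

lemma span_axis: "v \<in> span (range (\<lambda>i::'m::finite. axis i (1::real)))"
proof -
  have "(\<Sum>i\<in>UNIV. v $ i *\<^sub>R axis i 1) \<in> span (range (\<lambda>i::'m. axis i (1::real)))"
    by (intro span_sum span_scale span_base) auto
  then show ?thesis using basis_expansion[of v] by (simp add: scalar_mult_eq_scaleR)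
qed

section \<open>Alternating sums over the omitted argument\<close>

abbreviation omit :: "nat \<Rightarrow> 'v list \<Rightarrow> 'v list" where
  "omit j vs \<equiv> take j vs @ drop (Suc j) vs"

text \<open>One alternating sum for three purposes: the exterior derivative \<open>d_at\<close>, the
  Laplace expansion in \<open>minor\<close>, and Cramer's rule in \<open>altsum_con\<close>. The
  first argument of \<open>F\<close> is the entry singled out, the second the list of the
  others.\<close>

definition altsum :: "('v \<Rightarrow> 'v list \<Rightarrow> real) \<Rightarrow> 'v list \<Rightarrow> real" where
  "altsum F vs = (\<Sum>j<length vs. (-1) ^ j * F (vs ! j) (omit j vs))"

lemma length_omit: "j < length vs \<Longrightarrow> length (omit j vs) = length vs - 1"
  by auto

text \<open>If the entries at \<open>i < j\<close> coincide, every summand that omits another index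
  still contains both and vanishes. The two remaining summands differ by moving the common entry
  across the \<open>j - i - 1\<close> entries in between, so together with the factors
  \<open>(-1) ^ i\<close> and \<open>(-1) ^ j\<close> they cancel.\<close>

lemma alt_multilinear_altsum:
  assumes F: "\<And>v. alt_multilinear k (F v)" and lin: "\<And>us. linear (\<lambda>v. F v us)"
  shows "alt_multilinear (Suc k) (altsum F)"
proof -
  have "altsum F vs = 0" if "length vs \<noteq> Suc k" for vs
    unfolding altsum_def
    by (rule sum.neutral) (use that in \<open>auto intro!: alt_multilinear_length[OF F]\<close>)
  moreover have "linear (\<lambda>v. altsum F (vs[i := v]))" if "length vs = Suc k" "i < Suc k" for vs i
  proof -
    have "linear (\<lambda>v. (-1) ^ j * F (vs[i := v] ! j) (omit j (vs[i := v])))" if j: "j < Suc k" for j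
    proof -
      have "linear (\<lambda>v. F (vs[i := v] ! j) (omit j (vs[i := v])))"
      proof -
        consider "j = i" | "i < j" | "j < i" by linarith
        then show ?thesis
        proof cases
          case 1
          then show ?thesis using lin \<open>length vs = Suc k\<close> \<open>i < Suc k\<close> by simp
        next
          case 2
          then have "omit j (vs[i := v]) = (omit j vs)[i := v]" for v
            using j \<open>length vs = Suc k\<close> by (simp add: take_update_swap list_update_append drop_update_cancel)
          then show ?thesis
            using alt_multilinear_linear_update[OF F, of i "omit j vs"] 2 j \<open>length vs = Suc k\<close> by simp
        next
          case 3
          then have "omit j (vs[i := v]) = (omit j vs)[i - 1 := v]" for v
            using j \<open>length vs = Suc k\<close> by (auto simp: list_update_append drop_update_swap)
          then show ?thesis
            using alt_multilinear_linear_update[OF F, of "i - 1" "omit j vs"] 3 j \<open>length vs = Suc k\<close> \<open>i < Suc k\<close>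
            by simp
        qed
      qed
      then show ?thesis using linear_compose_scale_right[where c = "(-1) ^ j" and 'b = real] by simp
    qed
    then have "linear (\<lambda>v. \<Sum>j<Suc k. (-1) ^ j * F (vs[i := v] ! j) (omit j (vs[i := v])))"
      by (intro linear_compose_sum) auto
    then show ?thesis unfolding altsum_def using \<open>length vs = Suc k\<close> by simp
  qed
  moreover have "altsum F vs = 0" if len: "length vs = Suc k" and ij: "i < j" "j < Suc k" "vs ! i = vs ! j" for vs i j
  proof -
    define us where "us = take i vs"
    define ws where "ws = take (j - Suc i) (drop (Suc i) vs)"
    define zs where "zs = drop (Suc j) vs"
    define a where "a = vs ! i"
    have vs: "vs = us @ a # ws @ a # zs"
      using ij len unfolding us_def ws_def zs_def a_def
      by (metis (no_types, lifting) Cons_nth_drop_Suc Suc_leI append_take_drop_id drop_drop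
          le_add_diff_inverse2 less_trans)
    have i: "i = length us" and j: "j = Suc (length us + length ws)"
      using ij len unfolding us_def ws_def by auto
    have z: "F (vs ! l) (omit l vs) = 0" if "l < Suc k" "l \<noteq> i" "l \<noteq> j" for l
    proof -
      define p where "p x = (if x < l then x else x - 1)" for x
      have nth: "omit l vs ! p x = vs ! x" if "x < Suc k" "x \<noteq> l" for x
        using that \<open>l < Suc k\<close> len unfolding p_def by (auto simp: nth_append min_def)
      have "p i < p j" "p j < length (omit l vs)"
        using ij that len unfolding p_def by (auto simp: min_def)
      then show ?thesis
        using alt_multilinear_eq_nth[OF F, of "p i" "p j" "omit l vs" "vs ! l"] nth[of i] nth[of j] ij that
        by auto
    qed
    have "altsum F vs = (\<Sum>l\<in>{i, j}. (-1) ^ l * F (vs ! l) (omit l vs))"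
      unfolding altsum_def by (rule sum.mono_neutral_right) (use z ij len in auto)
    also have "\<dots> = (-1) ^ i * F a (omit i vs) + (-1) ^ j * F a (omit j vs)"
      using ij by (simp add: a_def)
    also have "omit i vs = us @ ws @ a # zs" unfolding vs i by simp
    also have "omit j vs = us @ a # ws @ zs" unfolding vs j by simp
    also have "(-1) ^ i * F a (us @ ws @ a # zs) + (-1) ^ j * F a (us @ a # ws @ zs) = 0"
      unfolding alt_multilinear_move[OF F] i j by (simp add: power_add)
    finally show ?thesis .
  qed
  ultimately show ?thesis unfolding alt_multilinear_def by blast
qed

section \<open>Contraction at a point\<close>

lemma dcoord_apply [simp]: "blinfun_apply (dcoord i) v = v $ i"
  unfolding dcoord_def
  by (subst bounded_linear_Blinfun_apply) (auto intro: bounded_linear_vec_nth)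

lemma covector_expand:
  fixes \<beta> :: "'m::finite covector"
  shows "\<beta> = (\<Sum>i\<in>UNIV. blinfun_apply \<beta> (axis i 1) *\<^sub>R dcoord i)"
proof (rule blinfun_eqI)
  fix v :: "real ^ 'm"
  have "blinfun_apply \<beta> v = blinfun_apply \<beta> (\<Sum>i\<in>UNIV. v $ i *\<^sub>R axis i 1)"
    using basis_expansion[of v] by (simp add: scalar_mult_eq_scaleR)
  then show "blinfun_apply \<beta> v = blinfun_apply (\<Sum>i\<in>UNIV. blinfun_apply \<beta> (axis i 1) *\<^sub>R dcoord i) v"
    by (simp add: blinfun.sum_right blinfun.scaleR_right blinfun.sum_left blinfun.scaleR_left mult.commute)
qed

lemma linear_expand_vec:
  fixes f :: "real ^ 'm \<Rightarrow> 'b::real_vector"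
  assumes "linear f"
  shows "f v = (\<Sum>i\<in>UNIV. v $ i *\<^sub>R f (axis i 1))"
proof -
  have "f v = f (\<Sum>i\<in>UNIV. v $ i *\<^sub>R axis i 1)"
    using basis_expansion[of v] by (simp add: scalar_mult_eq_scaleR)
  then show ?thesis by (simp add: linear_sum[OF assms] linear_scale[OF assms])
qed

lemma linear_expand_covector:
  fixes f :: "'m::finite covector \<Rightarrow> 'b::real_vector"
  assumes "linear f"
  shows "f \<beta> = (\<Sum>i\<in>UNIV. blinfun_apply \<beta> (axis i 1) *\<^sub>R f (dcoord i))"
  using arg_cong[OF covector_expand, of f \<beta>] by (simp only: linear_sum[OF assms] linear_scale[OF assms])

lemma sum_lists_insert:
  fixes f :: "'m::finite list \<Rightarrow> real"
  assumes "a \<le> k"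
  shows "(\<Sum>I\<in>{I. length I = Suc k}. f I) =
    (\<Sum>i\<in>UNIV. \<Sum>I\<in>{I. length I = k}. f (take a I @ i # drop a I))"
proof -
  let ?g = "\<lambda>(i::'m, I). take a I @ i # drop a I"
  have "bij_betw ?g (UNIV \<times> {I. length I = k}) {I. length I = Suc k}"
  proof (rule bij_betwI[where g = "\<lambda>I. (I ! a, omit a I)"])
    show "?g \<in> UNIV \<times> {I. length I = k} \<rightarrow> {I. length I = Suc k}" using assms by auto
    show "(\<lambda>I. (I ! a, omit a I)) \<in> {I. length I = Suc k} \<rightarrow> UNIV \<times> {I. length I = k}"
      using assms by auto
  next
    fix x :: "'m \<times> 'm list" assume "x \<in> UNIV \<times> {I. length I = k}"
    then show "((?g x) ! a, omit a (?g x)) = x"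
      using assms by (cases x) (auto simp: nth_append)
  next
    fix I :: "'m list" assume "I \<in> {I. length I = Suc k}"
    then show "?g (I ! a, omit a I) = I" using assms by (simp add: id_take_nth_drop[symmetric])
  qed
  then have "(\<Sum>I\<in>{I. length I = Suc k}. f I) = (\<Sum>x\<in>UNIV \<times> {I. length I = k}. f (?g x))"
    by (rule sum.reindex_bij_betw[symmetric])
  then show ?thesis by (simp add: sum.cartesian_product split_def)
qed

lemma sum_lists_Suc:
  fixes f :: "'m::finite list \<Rightarrow> real"
  shows "(\<Sum>I\<in>{I. length I = Suc k}. f I) = (\<Sum>i\<in>UNIV. \<Sum>I\<in>{I. length I = k}. f (i # I))"
  using sum_lists_insert[of 0 k f] by simp

text \<open>The contraction at a single point. Separated from charts and fields, the algebra
  concerns just two functionals.\<close>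

definition con :: "nat \<Rightarrow> ('m::finite covector list \<Rightarrow> real) \<Rightarrow> ((real ^ 'm) list \<Rightarrow> real)
    \<Rightarrow> (real ^ 'm) list \<Rightarrow> real" where
  "con k P N vs =
     (\<Sum>I\<in>{I. length I = k}. P (map dcoord I) * N (map (\<lambda>i. axis i 1) I @ vs)) / fact k"

lemma contract_eq_con: "contract k P \<omega> c x = con k (P c x) (\<omega> c x)"
  by (simp add: contract_def con_def fun_eq_iff)

lemma con_scale_left: "con k (\<lambda>\<beta>s. a * P \<beta>s) N vs = a * con k P N vs"
  by (simp add: con_def algebra_simps sum_distrib_left)

lemma con_wrong_length:
  assumes "alt_multilinear m N" "k + length vs \<noteq> m"
  shows "con k P N vs = 0"
  using assms(2) by (auto simp: con_def alt_multilinear_length[OF assms(1)])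

lemma alt_multilinear_con:
  assumes "alt_multilinear m N" "k \<le> m"
  shows "alt_multilinear (m - k) (con k P N)"
proof -
  have "alt_multilinear (m - k)
      (\<lambda>vs. inverse (fact k) * (\<Sum>I\<in>{I. length I = k}. P (map dcoord I) * N (map (\<lambda>i. axis i 1) I @ vs)))"
    using alt_multilinear_append[OF assms(1), of "map (\<lambda>i. axis i 1) I" for I] assms(2)
    by (intro alt_multilinear_cmult alt_multilinear_sum) auto
  moreover have "con k P N = (\<lambda>vs. inverse (fact k) * (\<Sum>I\<in>{I. length I = k}. P (map dcoord I) * N (map (\<lambda>i. axis i 1) I @ vs)))"
    by (simp add: con_def divide_inverse mult.commute fun_eq_iff)
  ultimately show ?thesis by simp
qed

lemma sum_lessThan_add:
  fixes f :: "nat \<Rightarrow> real"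
  shows "(\<Sum>a<m + n. f a) = (\<Sum>a<m. f a) + (\<Sum>j<n. f (m + j))"
  by (induction n) auto

lemma altsum_append:
  "altsum F (us @ vs) = (\<Sum>a<length us. (-1) ^ a * F (us ! a) (omit a us @ vs)) +
     (-1) ^ length us * (\<Sum>j<length vs. (-1) ^ j * F (vs ! j) (us @ omit j vs))"
proof -
  have "altsum F (us @ vs) =
      (\<Sum>a<length us + length vs. (-1) ^ a * F ((us @ vs) ! a) (omit a (us @ vs)))"
    by (simp add: altsum_def)
  also have "\<dots> = (\<Sum>a<length us. (-1) ^ a * F ((us @ vs) ! a) (omit a (us @ vs))) +
      (\<Sum>j<length vs. (-1) ^ (length us + j) * F ((us @ vs) ! (length us + j)) (omit (length us + j) (us @ vs)))"
    by (rule sum_lessThan_add)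
  also have "(\<Sum>a<length us. (-1) ^ a * F ((us @ vs) ! a) (omit a (us @ vs))) =
      (\<Sum>a<length us. (-1) ^ a * F (us ! a) (omit a us @ vs))"
    by (intro sum.cong) (auto simp: nth_append)
  also have "(\<Sum>j<length vs. (-1) ^ (length us + j) * F ((us @ vs) ! (length us + j)) (omit (length us + j) (us @ vs))) =
     (-1) ^ length us * (\<Sum>j<length vs. (-1) ^ j * F (vs ! j) (us @ omit j vs))"
    unfolding sum_distrib_left by (intro sum.cong) (auto simp: power_add)
  finally show ?thesis .
qed

text \<open>A form of Cramer's rule: the alternating sum of \<open>\<lambda> \<otimes> N\<close> is an
  alternating functional of degree \<open>m + 1\<close>, hence vanishes.\<close>

lemma altsum_con:
  fixes N :: "(real ^ 'm::finite) list \<Rightarrow> real"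
  assumes N: "alt_multilinear CARD('m) N"
    and G: "\<And>v. alt_multilinear (Suc k) (G v)" and lin: "\<And>\<beta>s. linear (\<lambda>v. G v \<beta>s)"
  shows "altsum (\<lambda>v. con (Suc k) (G v) N) vs =
    (-1) ^ k * con k (\<lambda>\<beta>s. \<Sum>i\<in>UNIV. G (axis i 1) (dcoord i # \<beta>s)) N vs"
proof -
  let ?e = "map (\<lambda>i::'m. axis i (1::real))" and ?L = "\<lambda>k. {I::'m list. length I = k}"
  define H where "H i I = G (axis i 1) (map dcoord I)" for i :: 'm and I
  \<comment> \<open>The vanishing alternating sum of \<open>\<lambda>v us. v $ i * N us\<close> on
    \<open>?e I @ vs\<close> is split into the entries coming from \<open>I\<close>, whose
    coefficients are Kronecker deltas, and those coming from \<open>vs\<close>.\<close>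
  have cramer: "(\<Sum>j<length vs. (-1) ^ j * (vs ! j $ i * N (?e I @ omit j vs))) =
      (-1) ^ k * (\<Sum>a<Suc k. (-1) ^ a * ((if I ! a = i then 1 else 0) * N (?e (omit a I) @ vs)))"
    if "length I = Suc k" for i I
  proof -
    have "alt_multilinear (Suc CARD('m)) (altsum (\<lambda>v us. v $ i * N us))"
      by (intro alt_multilinear_altsum alt_multilinear_cmult N linearI) (auto simp: algebra_simps)
    then have "0 = altsum (\<lambda>v us. v $ i * N us) (?e I @ vs)"
      using alt_multilinear_too_long[OF _ span_axis] by (metis lessI)
    also have "\<dots> = (\<Sum>a<Suc k. (-1) ^ a * ((if I ! a = i then 1 else 0) * N (?e (omit a I) @ vs)))
        + (-1) ^ Suc k * (\<Sum>j<length vs. (-1) ^ j * (vs ! j $ i * N (?e I @ omit j vs)))"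
      unfolding altsum_append using that
      by (intro arg_cong2[where f = "(+)"] sum.cong) (auto simp: axis_def take_map drop_map)
    finally show ?thesis by (auto simp: minus_one_power_iff)
  qed
  have GH: "G v (map dcoord I) = (\<Sum>i\<in>UNIV. v $ i * H i I)" for v I
    using linear_expand_vec[OF lin[of "map dcoord I"], of v] by (simp add: H_def)
  have "altsum (\<lambda>v. con (Suc k) (G v) N) vs =
      (\<Sum>j<length vs. (-1) ^ j * ((\<Sum>I\<in>?L (Suc k). (\<Sum>i\<in>UNIV. vs ! j $ i * H i I) * N (?e I @ omit j vs)) / fact (Suc k)))"
    unfolding altsum_def con_def GH ..
  also have "\<dots> = (\<Sum>j<length vs. \<Sum>I\<in>?L (Suc k). \<Sum>i\<in>UNIV. H i I * ((-1) ^ j * (vs ! j $ i * N (?e I @ omit j vs)))) / fact (Suc k)"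
    unfolding sum_distrib_left sum_distrib_right sum_divide_distrib
    by (intro sum.cong refl) simp
  also have "\<dots> = (\<Sum>I\<in>?L (Suc k). \<Sum>i\<in>UNIV. \<Sum>j<length vs. H i I * ((-1) ^ j * (vs ! j $ i * N (?e I @ omit j vs)))) / fact (Suc k)"
    by (simp only: sum.swap[where A = "{..<length vs}" and B = "UNIV :: 'm set"]
        sum.swap[where A = "{..<length vs}" and B = "?L (Suc k)"])
  also have "\<dots> = (\<Sum>I\<in>?L (Suc k). \<Sum>i\<in>UNIV. H i I *
      ((-1) ^ k * (\<Sum>a<Suc k. (-1) ^ a * ((if I ! a = i then 1 else 0) * N (?e (omit a I) @ vs))))) / fact (Suc k)"
    by (intro arg_cong2[where f = "(/)"] sum.cong refl)
      (simp only: sum_distrib_left[symmetric] mem_Collect_eq cramer)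
  also have "\<dots> = (\<Sum>I\<in>?L (Suc k). \<Sum>i\<in>UNIV. \<Sum>a<Suc k. 
      (-1) ^ k * (if i = I ! a then H i I * ((-1) ^ a * N (?e (omit a I) @ vs)) else 0)) / fact (Suc k)"
    unfolding sum_distrib_left
    by (intro arg_cong2[where f = "(/)"] sum.cong refl) auto
  also have "\<dots> = (\<Sum>a<Suc k. \<Sum>I\<in>?L (Suc k). \<Sum>i\<in>UNIV.
      (-1) ^ k * (if i = I ! a then H i I * ((-1) ^ a * N (?e (omit a I) @ vs)) else 0)) / fact (Suc k)"
    by (simp only: sum.swap[where A = "UNIV :: 'm set" and B = "{..<Suc k}"]
        sum.swap[where A = "?L (Suc k)" and B = "{..<Suc k}"])
  also have "\<dots> = (-1) ^ k * (\<Sum>a<Suc k. \<Sum>I\<in>?L (Suc k).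
      H (I ! a) I * ((-1) ^ a * N (?e (omit a I) @ vs))) / fact (Suc k)"
    by (simp only: sum_distrib_left[symmetric] sum.delta finite UNIV_I if_True)
  \<comment> \<open>Moving the index at position \<open>a\<close> to the front costs
    \<open>(-1) ^ a\<close>, which cancels the sign already there. All \<open>Suc k\<close>
    positions therefore contribute equally, and this factor reduces \<open>fact (Suc k)\<close> to
    \<open>fact k\<close>.\<close>
  also have "(\<Sum>I\<in>?L (Suc k). H (I ! a) I * ((-1) ^ a * N (?e (omit a I) @ vs))) =
      (\<Sum>i\<in>UNIV. \<Sum>I\<in>?L k. H i (i # I) * N (?e I @ vs))" if "a < Suc k" for a
  proof -
    have "H i (take a I @ i # drop a I) = (-1) ^ a * H i (i # I)" if "length I = k" for i I
      using alt_multilinear_to_front[OF G[of "axis i 1"], of "map dcoord (take a I)" "dcoord i" "map dcoord (drop a I)"]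
        that \<open>a < Suc k\<close> by (simp add: H_def) (simp flip: map_append)
    moreover have "(take a I @ i # drop a I) ! a = i" "omit a (take a I @ i # drop a I) = I"
      if "length I = k" for i and I :: "'m list"
      using that \<open>a < Suc k\<close> by (auto simp: nth_append)
    ultimately show ?thesis
      using that by (subst sum_lists_insert[of a k]) (auto intro!: sum.cong)
  qed
  then have "(\<Sum>a<Suc k. \<Sum>I\<in>?L (Suc k). H (I ! a) I * ((-1) ^ a * N (?e (omit a I) @ vs))) =
      real (Suc k) * (\<Sum>i\<in>UNIV. \<Sum>I\<in>?L k. H i (i # I) * N (?e I @ vs))"
    by simp
  also have "(-1) ^ k * \<dots> / fact (Suc k) =
      (-1) ^ k * ((\<Sum>i\<in>UNIV. \<Sum>I\<in>?L k. H i (i # I) * N (?e I @ vs)) / fact k)"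
    unfolding fact_Suc of_nat_mult by (simp del: of_nat_Suc)
  also have "(\<Sum>i\<in>UNIV. \<Sum>I\<in>?L k. H i (i # I) * N (?e I @ vs)) / fact k =
     con k (\<lambda>\<beta>s. \<Sum>i\<in>UNIV. G (axis i 1) (dcoord i # \<beta>s)) N vs"
    unfolding con_def H_def by (subst sum.swap) (simp add: sum_distrib_right)
  finally show ?thesis .
qed

section \<open>Injectivity and naturality of the contraction\<close>

lemma linear_scale_covector:
  fixes \<beta> :: "'m::finite covector" and a :: real
  shows "linear (\<lambda>v. blinfun_apply \<beta> v * a)"
  by (intro linearI) (simp_all add: blinfun.add_right blinfun.scaleR_right algebra_simps)

text \<open>Up to sign, \<beta> \<and> i(Q)N is the contraction of N by Q(\<beta>, ...): this is
  \<open>altsum_con\<close> for the family \<open>blinfun_apply \<beta> v * Q \<beta>s\<close>. So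
  if i(Q)N vanishes, the same holds with Q(\<beta>, ...), of one degree less, in place of Q. In
  degree 0 one evaluates at \<open>us\<close>.\<close>

lemma con_injective:
  fixes N :: "(real ^ 'm::finite) list \<Rightarrow> real"
  assumes "alt_multilinear CARD('m) N" "N us \<noteq> 0"
    and "alt_multilinear k Q" "\<And>vs. con k Q N vs = 0"
  shows "Q \<beta>s = 0"
  using assms(3,4)
proof (induction k arbitrary: Q \<beta>s)
  case 0
  have "Q [] * N us = 0" using 0(2)[of us] by (simp add: con_def)
  then show ?case using assms(2) alt_multilinear_length[OF 0(1)] by (cases \<beta>s) auto
next
  case (Suc k)
  show ?case
  proof (cases \<beta>s)
    case Nil
    then show ?thesis using alt_multilinear_length[OF Suc.prems(1)] by simp
  next
    case (Cons \<beta> \<gamma>s)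
    have "con k (\<lambda>\<beta>s. Q (\<beta> # \<beta>s)) N vs = 0" for vs
    proof -
      have "(\<Sum>i\<in>UNIV. blinfun_apply \<beta> (axis i 1) * Q (dcoord i # \<gamma>s)) = Q (\<beta> # \<gamma>s)" for \<gamma>s
        using linear_expand_covector[OF alt_multilinear_linear_Cons[OF Suc.prems(1)], of \<beta> \<gamma>s] by simp
      then have "altsum (\<lambda>v. con (Suc k) (\<lambda>\<beta>s. blinfun_apply \<beta> v * Q \<beta>s) N) vs =
          (-1) ^ k * con k (\<lambda>\<beta>s. Q (\<beta> # \<beta>s)) N vs"
        by (subst altsum_con[OF assms(1)])
          (auto intro: alt_multilinear_cmult Suc.prems(1) linear_scale_covector)
      moreover have "altsum (\<lambda>v. con (Suc k) (\<lambda>\<beta>s. blinfun_apply \<beta> v * Q \<beta>s) N) vs = 0"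
        by (simp add: altsum_def con_scale_left Suc.prems(2))
      ultimately show ?thesis by simp
    qed
    from Suc.IH[OF alt_multilinear_Cons[OF Suc.prems(1)] this] show ?thesis unfolding Cons .
  qed
qed

lemma dcoord_compose:
  "dcoord i o\<^sub>L L = (\<Sum>j\<in>UNIV. (blinfun_apply L (axis j 1) $ i) *\<^sub>R dcoord j)"
  by (subst covector_expand[of "dcoord i o\<^sub>L L"]) simp

text \<open>The full pairing of a multivector with a form lets \<open>L\<close> pass from the
  covectors to the vectors: on the leading index both sides expand with the same matrix entries
  \<open>?l i j\<close>, and the induction hypothesis treats the remaining indices.\<close>

lemma sum_pairing_natural:
  fixes L :: "(real ^ 'm::finite) \<Rightarrow>\<^sub>L (real ^ 'm)"
  assumes "alt_multilinear k P" "alt_multilinear k R"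
  shows "(\<Sum>I\<in>{I. length I = k}. P (map (\<lambda>i. dcoord i o\<^sub>L L) I) * R (map (\<lambda>i. axis i 1) I)) =
    (\<Sum>I\<in>{I. length I = k}. P (map dcoord I) * R (map (\<lambda>i. blinfun_apply L (axis i 1)) I))"
  using assms
proof (induction k arbitrary: P R)
  case (Suc k)
  let ?L = "{I::'m list. length I = k}" and ?l = "\<lambda>i j. blinfun_apply L (axis j 1) $ i"
  note P = alt_multilinear_linear_Cons[OF Suc.prems(1)] and R = alt_multilinear_linear_Cons[OF Suc.prems(2)]
  have PL: "P ((dcoord i o\<^sub>L L) # ws) = (\<Sum>j\<in>UNIV. ?l i j * P (dcoord j # ws))" for i ws
    unfolding dcoord_compose by (simp only: linear_sum[OF P] linear_scale[OF P] real_scaleR_def)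
  have RL: "R (blinfun_apply L (axis j 1) # us) = (\<Sum>i\<in>UNIV. ?l i j * R (axis i 1 # us))" for j us
    using linear_expand_vec[OF R, of "blinfun_apply L (axis j 1)" us] by simp
  have "(\<Sum>I\<in>{I. length I = Suc k}. P (map (\<lambda>i. dcoord i o\<^sub>L L) I) * R (map (\<lambda>i. axis i 1) I)) =
      (\<Sum>i\<in>UNIV. \<Sum>I\<in>?L. (\<Sum>j\<in>UNIV. ?l i j * P (dcoord j # map (\<lambda>i. dcoord i o\<^sub>L L) I)) * R (axis i 1 # map (\<lambda>i. axis i 1) I))"
    unfolding sum_lists_Suc list.map PL ..
  also have "\<dots> = (\<Sum>i\<in>UNIV. \<Sum>j\<in>UNIV. ?l i j * (\<Sum>I\<in>?L. P (dcoord j # map (\<lambda>i. dcoord i o\<^sub>L L) I) * R (axis i 1 # map (\<lambda>i. axis i 1) I)))"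
    unfolding sum_distrib_left sum_distrib_right mult.assoc
    by (intro sum.cong refl sum.swap)
  also have "\<dots> = (\<Sum>i\<in>UNIV. \<Sum>j\<in>UNIV. ?l i j * (\<Sum>I\<in>?L. P (dcoord j # map dcoord I) * R (axis i 1 # map (\<lambda>i. blinfun_apply L (axis i 1)) I)))"
    using Suc.IH[OF alt_multilinear_Cons[OF Suc.prems(1)] alt_multilinear_Cons[OF Suc.prems(2)]]
    by (simp only:)
  also have "\<dots> = (\<Sum>j\<in>UNIV. \<Sum>i\<in>UNIV. ?l i j * (\<Sum>I\<in>?L. P (dcoord j # map dcoord I) * R (axis i 1 # map (\<lambda>i. blinfun_apply L (axis i 1)) I)))"
    by (rule sum.swap)
  also have "\<dots> = (\<Sum>j\<in>UNIV. \<Sum>I\<in>?L. \<Sum>i\<in>UNIV. ?l i j * (P (dcoord j # map dcoord I) * R (axis i 1 # map (\<lambda>i. blinfun_apply L (axis i 1)) I)))"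
    unfolding sum_distrib_left by (intro sum.cong refl sum.swap)
  also have "\<dots> = (\<Sum>j\<in>UNIV. \<Sum>I\<in>?L. P (dcoord j # map dcoord I) * (\<Sum>i\<in>UNIV. ?l i j * R (axis i 1 # map (\<lambda>i. blinfun_apply L (axis i 1)) I)))"
    unfolding sum_distrib_left by (intro sum.cong refl mult.left_commute)
  also have "\<dots> = (\<Sum>I\<in>{I. length I = Suc k}. P (map dcoord I) * R (map (\<lambda>i. blinfun_apply L (axis i 1)) I))"
    unfolding sum_lists_Suc list.map RL ..
  finally show ?case .
qed simp

text \<open>With push-forward L_* on multivectors and pull-back L^* on forms this reads L^*(i(L_*
  P)N) = i(P)(L^* N). After \<open>vs\<close> has been filled in, only a full pairing is
  left.\<close>

lemma con_natural:
  fixes L :: "(real ^ 'm::finite) \<Rightarrow>\<^sub>L (real ^ 'm)"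
  assumes P: "alt_multilinear k P" and N: "alt_multilinear m N" and "k + length vs = m"
  shows "con k (\<lambda>\<alpha>s. P (map (\<lambda>\<alpha>. \<alpha> o\<^sub>L L) \<alpha>s)) N (map (blinfun_apply L) vs) =
    con k P (\<lambda>us. N (map (blinfun_apply L) us)) vs"
proof -
  have "alt_multilinear k (\<lambda>us. N (us @ map (blinfun_apply L) vs))"
    using alt_multilinear_append_right[OF N, of "map (blinfun_apply L) vs"] assms(3) by auto
  from sum_pairing_natural[OF P this, of L] show ?thesis
    by (simp add: con_def o_def)
qed

section \<open>Calculus of smooth functions\<close>

abbreviation fd :: "('a::real_normed_vector \<Rightarrow> 'b::real_normed_vector) \<Rightarrow> 'a \<Rightarrow> 'a \<Rightarrow> 'b" where
  "fd f x \<equiv> frechet_derivative f (at x)"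

lemma fd_eq: "(f has_derivative f') (at x) \<Longrightarrow> fd f x = f'"
  by (rule frechet_derivative_at[symmetric])

lemma has_derivative_fd: "f differentiable (at x) \<Longrightarrow> (f has_derivative fd f x) (at x)"
  by (simp add: frechet_derivative_works)

lemma linear_fd: "f differentiable (at x) \<Longrightarrow> linear (fd f x)"
  by (rule linear_frechet_derivative)

lemma has_derivative_cong_open:
  assumes "open S" "x \<in> S" "\<And>y. y \<in> S \<Longrightarrow> f y = g y"
  shows "(f has_derivative f') (at x) \<longleftrightarrow> (g has_derivative f') (at x)"
  using assms has_derivative_transform_within_open[of _ _ x UNIV S] by (metis (no_types, lifting))

lemma fd_cong:
  assumes "open S" "x \<in> S" "\<And>y. y \<in> S \<Longrightarrow> f y = g y"
  shows "fd f x = fd g x"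
  unfolding frechet_derivative_def using has_derivative_cong_open[OF assms] by simp

section \<open>Closure properties of maps of class C^k\<close>

lemma Ck_on_cong:
  assumes "open S" "\<And>x. x \<in> S \<Longrightarrow> f x = g x" "Ck_on k f S"
  shows "Ck_on k g S"
  using assms(2,3)
proof (induction k arbitrary: f g)
  case 0
  then show ?case using continuous_on_cong[of S S f g] by simp
next
  case (Suc k)
  have "g differentiable (at x)" if "x \<in> S" for x
  proof -
    have "f differentiable (at x)" using Suc.prems(2) that by simp
    then show ?thesis
      using has_derivative_cong_open[OF assms(1) that, of f g] Suc.prems(1)
      unfolding differentiable_def by metis
  qed
  moreover have "Ck_on k (\<lambda>x. fd g x v) S" for v
  proof (rule Suc.IH)
    show "fd f x v = fd g x v" if "x \<in> S" for x
      using fd_cong[OF assms(1) that, of f g] Suc.prems by simp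
    show "Ck_on k (\<lambda>x. fd f x v) S" using Suc.prems by simp
  qed
  ultimately show ?case by simp
qed

lemma Ck_on_SucI:
  assumes "open S" "\<And>x. x \<in> S \<Longrightarrow> (f has_derivative f' x) (at x)"
    and "\<And>v. Ck_on k (\<lambda>x. f' x v) S"
  shows "Ck_on (Suc k) f S"
proof -
  have "Ck_on k (\<lambda>x. fd f x v) S" for v
    by (rule Ck_on_cong[OF assms(1) _ assms(3)[of v]]) (simp add: fd_eq[OF assms(2)])
  then show ?thesis using assms(2) by (auto simp: differentiable_def)
qed

lemma Ck_on_Suc_D: "Ck_on (Suc k) f S \<Longrightarrow> Ck_on k f S"
proof (induction k arbitrary: f)
  case 0
  then show ?case
    by (auto intro!: continuous_at_imp_continuous_on differentiable_imp_continuous_within)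
next
  case (Suc k)
  then have "\<forall>x\<in>S. f differentiable (at x)" "\<And>v. Ck_on (Suc k) (\<lambda>x. fd f x v) S"
    unfolding Ck_on.simps(2)[of "Suc k" f] by blast+
  then show ?case unfolding Ck_on.simps(2)[of k f] using Suc.IH by blast
qed

lemma Ck_on_subset: "Ck_on k f S \<Longrightarrow> T \<subseteq> S \<Longrightarrow> Ck_on k f T"
  by (induction k arbitrary: f) (auto intro: continuous_on_subset)

lemma Ck_on_local:
  assumes "\<And>x. x \<in> S \<Longrightarrow> \<exists>U. open U \<and> x \<in> U \<and> Ck_on k f U"
  shows "Ck_on k f S"
  using assms
proof (induction k arbitrary: f)
  case 0
  then show ?case
    using continuous_on_eq_continuous_at continuous_at_imp_continuous_on by (metis Ck_on.simps(1))
next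
  case (Suc k)
  then show ?case unfolding Ck_on.simps(2) by metis
qed

lemma Ck_on_const: "Ck_on k (\<lambda>_. c) S"
proof (induction k arbitrary: c)
  case (Suc k)
  have "fd (\<lambda>_. c) x = (\<lambda>_. 0)" for x :: 'a by (rule fd_eq) simp
  then show ?case using Suc by simp
qed simp

lemma Ck_on_bounded_linear_compose:
  assumes "open S" "bounded_linear h" "Ck_on k f S"
  shows "Ck_on k (\<lambda>x. h (f x)) S"
  using assms(3)
proof (induction k arbitrary: f)
  case 0
  then show ?case using bounded_linear.continuous_on[OF assms(2)] by simp
next
  case (Suc k)
  show ?case
    by (rule Ck_on_SucI[OF assms(1), where f' = "\<lambda>x v. h (fd f x v)"])
      (use Suc assms in \<open>auto intro!: bounded_linear.has_derivative[OF assms(2)] has_derivative_fd\<close>)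
qed

lemma Ck_on_bounded_linear: "bounded_linear h \<Longrightarrow> Ck_on k h S"
proof (cases k)
  case (Suc n)
  assume h: "bounded_linear h"
  then have "fd h x = h" for x by (intro fd_eq bounded_linear_imp_has_derivative)
  then show ?thesis using h Suc by (simp add: Ck_on_const bounded_linear_imp_differentiable)
qed (simp add: linear_continuous_on)

lemma Ck_on_add:
  assumes "open S" "Ck_on k f S" "Ck_on k g S"
  shows "Ck_on k (\<lambda>x. f x + g x) S"
  using assms(2,3)
proof (induction k arbitrary: f g)
  case (Suc k)
  show ?case
    by (rule Ck_on_SucI[OF assms(1), where f' = "\<lambda>x v. fd f x v + fd g x v"])
      (use Suc in \<open>auto intro!: has_derivative_add has_derivative_fd assms(1)\<close>)
qed (auto intro: continuous_on_add)

lemma Ck_on_mult: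
  fixes f g :: "'a::real_normed_vector \<Rightarrow> real"
  assumes "open S" "Ck_on k f S" "Ck_on k g S"
  shows "Ck_on k (\<lambda>x. f x * g x) S"
  using assms(2,3)
proof (induction k arbitrary: f g)
  case (Suc k)
  show ?case
    by (rule Ck_on_SucI[OF assms(1), where f' = "\<lambda>x v. f x * fd g x v + fd f x v * g x"])
      (use Suc Ck_on_Suc_D[OF Suc.prems(1)] Ck_on_Suc_D[OF Suc.prems(2)] in
        \<open>auto intro!: has_derivative_mult has_derivative_fd Ck_on_add assms(1)\<close>)
qed (auto intro: continuous_on_mult)

lemma Ck_on_inverse:
  fixes f :: "'a::real_normed_vector \<Rightarrow> real"
  assumes "open S" "\<And>x. x \<in> S \<Longrightarrow> f x \<noteq> 0" "Ck_on k f S"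
  shows "Ck_on k (\<lambda>x. inverse (f x)) S"
  using assms(3)
proof (induction k)
  case 0
  then show ?case using assms(2) by (auto intro!: continuous_on_inverse)
next
  case (Suc k)
  have I: "Ck_on k (\<lambda>x. inverse (f x)) S" by (rule Suc.IH[OF Ck_on_Suc_D[OF Suc.prems]])
  show ?case
  proof (rule Ck_on_SucI[OF assms(1), where f' = "\<lambda>x v. (- 1) * (inverse (f x) * fd f x v * inverse (f x))"])
    fix x assume x: "x \<in> S"
    then have "(f has_derivative fd f x) (at x)" using Suc.prems has_derivative_fd by auto
    from Deriv.has_derivative_inverse[OF assms(2)[OF x] this]
    show "((\<lambda>x. inverse (f x)) has_derivative (\<lambda>v. (- 1) * (inverse (f x) * fd f x v * inverse (f x)))) (at x)"
      by simp
  next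
    show "Ck_on k (\<lambda>x. (- 1) * (inverse (f x) * fd f x v * inverse (f x))) S" for v
      using Suc.prems by (intro Ck_on_mult Ck_on_const I assms(1)) simp
  qed
qed

lemma Ck_on_sum:
  assumes "open S" "\<And>i. i \<in> I \<Longrightarrow> Ck_on k (f i) S"
  shows "Ck_on k (\<lambda>x. \<Sum>i\<in>I. f i x) S"
  using assms(2)
  by (induction I rule: infinite_finite_induct) (auto intro!: Ck_on_const Ck_on_add assms(1))

text \<open>The chain rule yields \<open>fd g (f x) (fd f x v)\<close>, where both \<open>x\<close>
  and the direction vary. Expanding the direction in an orthonormal basis gives products of
  components of \<open>fd f x v\<close> with partial derivatives of \<open>g\<close> composed with
  the same \<open>f\<close>; hence the induction over arbitrary \<open>g\<close>.\<close>

lemma Ck_on_compose: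
  fixes f :: "'a::real_normed_vector \<Rightarrow> 'b::euclidean_space" and g :: "'b \<Rightarrow> real"
  assumes "open S" "open T" "f ` S \<subseteq> T" "Ck_on k f S" "Ck_on k g T"
  shows "Ck_on k (\<lambda>x. g (f x)) S"
  using assms(4,5)
proof (induction k arbitrary: g)
  case 0
  then show ?case using assms(3) by (auto intro: continuous_on_compose2)
next
  case (Suc k)
  have lin: "fd g (f x) (fd f x v) = (\<Sum>b\<in>Basis. (fd f x v \<bullet> b) * fd g (f x) b)" if "x \<in> S" for x v
  proof -
    have l: "linear (fd g (f x))" using Suc.prems(2) that assms(3) by (auto intro!: linear_fd)
    have "fd g (f x) (fd f x v) = fd g (f x) (\<Sum>b\<in>Basis. (fd f x v \<bullet> b) *\<^sub>R b)"
      by (simp only: euclidean_representation)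
    also have "\<dots> = (\<Sum>b\<in>Basis. (fd f x v \<bullet> b) * fd g (f x) b)"
      by (simp only: linear_sum[OF l] linear_scale[OF l] real_scaleR_def)
    finally show ?thesis .
  qed
  show ?case
  proof (rule Ck_on_SucI[OF assms(1), where f' = "\<lambda>x v. fd g (f x) (fd f x v)"])
    fix x assume "x \<in> S"
    then show "((\<lambda>x. g (f x)) has_derivative (\<lambda>v. fd g (f x) (fd f x v))) (at x)"
      using Suc.prems assms(3)
      by (intro has_derivative_compose[of f _ x UNIV g, simplified] has_derivative_fd) auto
  next
    fix v
    have "Ck_on k (\<lambda>x. \<Sum>b\<in>Basis. (fd f x v \<bullet> b) * fd g (f x) b) S"
      using Suc.prems Ck_on_Suc_D[OF Suc.prems(1)]
      by (intro Ck_on_sum Ck_on_mult assms(1) Suc.IH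
          Ck_on_bounded_linear_compose[OF assms(1) bounded_linear_inner_left]) auto
    then show "Ck_on k (\<lambda>x. fd g (f x) (fd f x v)) S"
      by (rule Ck_on_cong[OF assms(1), rotated]) (simp add: lin)
  qed
qed

named_theorems smooth_intros

lemma smooth_on_subset: "smooth_on f S \<Longrightarrow> T \<subseteq> S \<Longrightarrow> smooth_on f T"
  by (auto simp: smooth_on_def intro: Ck_on_subset)

lemma smooth_on_cong:
  "smooth_on f S \<Longrightarrow> open S \<Longrightarrow> (\<And>x. x \<in> S \<Longrightarrow> f x = g x) \<Longrightarrow> smooth_on g S"
  by (auto simp: smooth_on_def intro: Ck_on_cong)

lemma smooth_on_local:
  "(\<And>x. x \<in> S \<Longrightarrow> \<exists>U. open U \<and> x \<in> U \<and> smooth_on f U) \<Longrightarrow> smooth_on f S"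
  unfolding smooth_on_def by (metis Ck_on_local)

lemma smooth_on_const [smooth_intros]: "smooth_on (\<lambda>_. c) S"
  by (simp add: smooth_on_def Ck_on_const)

lemma smooth_on_bounded_linear: "bounded_linear h \<Longrightarrow> smooth_on h S"
  by (simp add: smooth_on_def Ck_on_bounded_linear)

lemma smooth_on_bounded_linear_compose:
  "open S \<Longrightarrow> bounded_linear h \<Longrightarrow> smooth_on f S \<Longrightarrow> smooth_on (\<lambda>x. h (f x)) S"
  by (simp add: smooth_on_def Ck_on_bounded_linear_compose)

lemma smooth_on_nth [smooth_intros]: "smooth_on (\<lambda>x. x $ i) S"
  by (intro smooth_on_bounded_linear bounded_linear_vec_nth)

lemma smooth_on_add [smooth_intros]:
  "open S \<Longrightarrow> smooth_on f S \<Longrightarrow> smooth_on g S \<Longrightarrow> smooth_on (\<lambda>x. f x + g x) S"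
  by (simp add: smooth_on_def Ck_on_add)

lemma smooth_on_mult [smooth_intros]:
  fixes f g :: "'a::real_normed_vector \<Rightarrow> real"
  shows "open S \<Longrightarrow> smooth_on f S \<Longrightarrow> smooth_on g S \<Longrightarrow> smooth_on (\<lambda>x. f x * g x) S"
  by (simp add: smooth_on_def Ck_on_mult)

lemma smooth_on_diff [smooth_intros]:
  fixes f g :: "'a::real_normed_vector \<Rightarrow> real"
  shows "open S \<Longrightarrow> smooth_on f S \<Longrightarrow> smooth_on g S \<Longrightarrow> smooth_on (\<lambda>x. f x - g x) S"
  using smooth_on_add[of S f "\<lambda>x. (-1) * g x", OF _ _ smooth_on_mult[OF _ smooth_on_const]] by simp

lemma smooth_on_inverse [smooth_intros]:
  fixes f :: "'a::real_normed_vector \<Rightarrow> real"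
  shows "open S \<Longrightarrow> smooth_on f S \<Longrightarrow> (\<And>x. x \<in> S \<Longrightarrow> f x \<noteq> 0) \<Longrightarrow> smooth_on (\<lambda>x. inverse (f x)) S"
  by (simp add: smooth_on_def Ck_on_inverse)

lemma smooth_on_divide [smooth_intros]:
  fixes f g :: "'a::real_normed_vector \<Rightarrow> real"
  shows "open S \<Longrightarrow> smooth_on f S \<Longrightarrow> smooth_on g S \<Longrightarrow> (\<And>x. x \<in> S \<Longrightarrow> g x \<noteq> 0) \<Longrightarrow>
    smooth_on (\<lambda>x. f x / g x) S"
  unfolding divide_inverse by (intro smooth_intros)

lemma smooth_on_sum [smooth_intros]:
  "open S \<Longrightarrow> (\<And>i. i \<in> I \<Longrightarrow> smooth_on (f i) S) \<Longrightarrow> smooth_on (\<lambda>x. \<Sum>i\<in>I. f i x) S"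
  by (simp add: smooth_on_def Ck_on_sum)

lemma smooth_on_compose:
  fixes f :: "'a::real_normed_vector \<Rightarrow> 'b::euclidean_space" and g :: "'b \<Rightarrow> real"
  shows "open S \<Longrightarrow> open T \<Longrightarrow> f ` S \<subseteq> T \<Longrightarrow> smooth_on f S \<Longrightarrow> smooth_on g T \<Longrightarrow>
    smooth_on (\<lambda>x. g (f x)) S"
  by (simp add: smooth_on_def Ck_on_compose)

lemma smooth_on_differentiable: "smooth_on f S \<Longrightarrow> x \<in> S \<Longrightarrow> f differentiable (at x)"
  unfolding smooth_on_def by (drule spec[of _ "Suc 0"]) simp

lemma smooth_on_has_derivative: "smooth_on f S \<Longrightarrow> x \<in> S \<Longrightarrow> (f has_derivative fd f x) (at x)"
  by (intro has_derivative_fd smooth_on_differentiable)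

lemma smooth_on_linear_fd: "smooth_on f S \<Longrightarrow> x \<in> S \<Longrightarrow> linear (fd f x)"
  by (intro linear_fd smooth_on_differentiable)

lemma smooth_on_bounded_linear_fd: "smooth_on f S \<Longrightarrow> x \<in> S \<Longrightarrow> bounded_linear (fd f x)"
  using has_derivative_bounded_linear smooth_on_has_derivative by blast

lemma smooth_on_fd: "smooth_on f S \<Longrightarrow> smooth_on (\<lambda>x. fd f x v) S"
  unfolding smooth_on_def using Ck_on.simps(2)[of _ f S] by blast

lemma smooth_on_continuous_on: "smooth_on f S \<Longrightarrow> continuous_on S f"
  unfolding smooth_on_def by (drule spec[of _ 0]) simp

subsection \<open>Symmetry of second derivatives\<close>

text \<open>The mean value theorem is applied along \<open>u\<close> to the increment along
  \<open>v\<close>, and then along \<open>v\<close> to the derivative along \<open>u\<close>. The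
  left side is symmetric in \<open>u\<close> and \<open>v\<close>, the right side is not; this is
  what yields the symmetry of second derivatives.\<close>

lemma second_difference:
  fixes f :: "'a::real_normed_vector \<Rightarrow> real"
  assumes f: "smooth_on f S" and h: "h > 0"
    and box: "\<And>s t. 0 \<le> s \<Longrightarrow> s \<le> h \<Longrightarrow> 0 \<le> t \<Longrightarrow> t \<le> h \<Longrightarrow> x + s *\<^sub>R u + t *\<^sub>R v \<in> S"
  shows "\<exists>s t. 0 < s \<and> s < h \<and> 0 < t \<and> t < h \<and>
    f (x + h *\<^sub>R u + h *\<^sub>R v) - f (x + h *\<^sub>R u) - f (x + h *\<^sub>R v) + f x =
      h * h * fd (\<lambda>y. fd f y u) (x + s *\<^sub>R u + t *\<^sub>R v) v"
proof -
  let ?g = "\<lambda>s. f (x + s *\<^sub>R u + h *\<^sub>R v) - f (x + s *\<^sub>R u)"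
  have d1: "((\<lambda>s. f (x + s *\<^sub>R u + t *\<^sub>R v)) has_real_derivative fd f (x + s *\<^sub>R u + t *\<^sub>R v) u) (at s)"
    if "0 \<le> s" "s \<le> h" "0 \<le> t" "t \<le> h" for s t
  proof -
    have "((\<lambda>s. x + s *\<^sub>R u + t *\<^sub>R v) has_derivative (\<lambda>ds. ds *\<^sub>R u)) (at s)"
      by (auto intro!: derivative_eq_intros)
    from has_derivative_compose[OF this smooth_on_has_derivative[OF f box[OF that]]]
    show ?thesis unfolding has_field_derivative_def
      by (rule has_derivative_eq_rhs)
        (simp add: fun_eq_iff linear_scale[OF smooth_on_linear_fd[OF f box[OF that]]] mult.commute)
  qed
  have "\<exists>s. 0 < s \<and> s < h \<and> ?g h - ?g 0 =
      (h - 0) * (fd f (x + s *\<^sub>R u + h *\<^sub>R v) u - fd f (x + s *\<^sub>R u) u)"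
  proof (rule MVT2[OF h])
    show "(?g has_real_derivative fd f (x + s *\<^sub>R u + h *\<^sub>R v) u - fd f (x + s *\<^sub>R u) u) (at s)"
      if "0 \<le> s" "s \<le> h" for s
      using DERIV_diff[OF d1[of s h] d1[of s 0]] that h by simp
  qed
  then obtain s where s: "0 < s" "s < h"
    "?g h - ?g 0 = h * (fd f (x + s *\<^sub>R u + h *\<^sub>R v) u - fd f (x + s *\<^sub>R u) u)" by auto
  let ?k = "\<lambda>t. fd f (x + s *\<^sub>R u + t *\<^sub>R v) u"
  have d2: "(?k has_real_derivative fd (\<lambda>y. fd f y u) (x + s *\<^sub>R u + t *\<^sub>R v) v) (at t)"
    if "0 \<le> t" "t \<le> h" for t
  proof -
    have inS: "x + s *\<^sub>R u + t *\<^sub>R v \<in> S" using box s that by simp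
    have "((\<lambda>t. x + s *\<^sub>R u + t *\<^sub>R v) has_derivative (\<lambda>dt. dt *\<^sub>R v)) (at t)"
      by (auto intro!: derivative_eq_intros)
    from has_derivative_compose[OF this smooth_on_has_derivative[OF smooth_on_fd[OF f] inS]]
    show ?thesis unfolding has_field_derivative_def
      by (rule has_derivative_eq_rhs)
        (simp add: fun_eq_iff linear_scale[OF smooth_on_linear_fd[OF smooth_on_fd[OF f] inS]] mult.commute)
  qed
  have "\<exists>t. 0 < t \<and> t < h \<and> ?k h - ?k 0 = (h - 0) * fd (\<lambda>y. fd f y u) (x + s *\<^sub>R u + t *\<^sub>R v) v"
    using d2 by (intro MVT2[OF h]) auto
  then obtain t where t: "0 < t" "t < h"
    "?k h - ?k 0 = h * fd (\<lambda>y. fd f y u) (x + s *\<^sub>R u + t *\<^sub>R v) v" by auto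
  have "f (x + h *\<^sub>R u + h *\<^sub>R v) - f (x + h *\<^sub>R u) - f (x + h *\<^sub>R v) + f x = ?g h - ?g 0" by simp
  also have "\<dots> = h * (?k h - ?k 0)" unfolding s(3) by simp
  also have "\<dots> = h * h * fd (\<lambda>y. fd f y u) (x + s *\<^sub>R u + t *\<^sub>R v) v" unfolding t(3) by simp
  finally show ?thesis using s t by blast
qed

lemma fd_commute:
  fixes f :: "'a::real_normed_vector \<Rightarrow> real"
  assumes f: "smooth_on f S" and S: "open S" "x \<in> S"
  shows "fd (\<lambda>y. fd f y u) x v = fd (\<lambda>y. fd f y v) x u"
proof (rule ccontr)
  let ?F = "\<lambda>u v y. fd (\<lambda>y. fd f y u) y v"
  assume ne: "\<not> ?thesis"
  \<comment> \<open>Half the gap between the mixed derivatives at \<open>x\<close>. The second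
    difference, computed in both orders, gives two nearby points where the respective mixed
    derivatives have the same value, each within \<open>e\<close> of its value at
    \<open>x\<close>.\<close>
  define e where "e = \<bar>?F u v x - ?F v u x\<bar> / 2"
  have e: "e > 0" using ne by (simp add: e_def)
  have cont: "(?F a b \<longlongrightarrow> ?F a b x) (nhds x)" for a b
  proof -
    have "isCont (?F a b) x"
      using smooth_on_continuous_on[OF smooth_on_fd[OF smooth_on_fd[OF f]]] S
      by (simp add: continuous_on_eq_continuous_at)
    then show ?thesis unfolding isCont_def by (rule tendsto_at_iff_tendsto_nhds[THEN iffD1])
  qed
  have "\<exists>d>0. \<forall>y. dist y x < d \<longrightarrow> y \<in> S \<and> \<bar>?F u v y - ?F u v x\<bar> < e \<and> \<bar>?F v u y - ?F v u x\<bar> < e"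
  proof -
    have "eventually (\<lambda>y. y \<in> S \<and> dist (?F u v y) (?F u v x) < e \<and> dist (?F v u y) (?F v u x) < e) (nhds x)"
      by (intro eventually_conj eventually_nhds_in_open tendstoD[OF cont e] S)
    then show ?thesis by (auto simp: eventually_nhds_metric dist_real_def)
  qed
  then obtain d where d: "d > 0" "\<And>y. dist y x < d \<Longrightarrow> y \<in> S"
    "\<And>y. dist y x < d \<Longrightarrow> \<bar>?F u v y - ?F u v x\<bar> < e"
    "\<And>y. dist y x < d \<Longrightarrow> \<bar>?F v u y - ?F v u x\<bar> < e" by blast
  \<comment> \<open>Makes every point of the parallelogram lie within \<open>d / 2\<close> of
    \<open>x\<close>; the summand 1 covers the case \<open>u = v = 0\<close>.\<close>
  define h where "h = d / (2 * (norm u + norm v + 1))"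
  have pos: "norm u + norm v + 1 > 0" using norm_ge_zero[of u] norm_ge_zero[of v] by linarith
  have h: "h > 0" using d(1) pos by (simp add: h_def)
  have near: "dist (x + s *\<^sub>R u + t *\<^sub>R v) x < d" if "0 \<le> s" "s \<le> h" "0 \<le> t" "t \<le> h" for s t
  proof -
    have "dist (x + s *\<^sub>R u + t *\<^sub>R v) x = norm (s *\<^sub>R u + t *\<^sub>R v)" by (simp add: dist_norm add.assoc)
    also have "\<dots> \<le> s * norm u + t * norm v" using that by (intro norm_triangle_le) simp
    also have "\<dots> \<le> h * norm u + h * norm v" using that by (intro add_mono mult_right_mono) auto
    also have "\<dots> \<le> h * (norm u + norm v + 1)" using h by (simp add: algebra_simps)
    also have "\<dots> = d / 2" using pos unfolding h_def by (simp del: distrib_left_numeral)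
    finally show ?thesis using d(1) by simp
  qed
  then have box1: "x + s *\<^sub>R u + t *\<^sub>R v \<in> S" and box2: "x + s *\<^sub>R v + t *\<^sub>R u \<in> S"
    if "0 \<le> s" "s \<le> h" "0 \<le> t" "t \<le> h" for s t
    using d(2) that near[of t s] by (auto simp: algebra_simps)
  from second_difference[OF f h box1] obtain s t where st: "0 < s" "s < h" "0 < t" "t < h"
    "f (x + h *\<^sub>R u + h *\<^sub>R v) - f (x + h *\<^sub>R u) - f (x + h *\<^sub>R v) + f x = h * h * ?F u v (x + s *\<^sub>R u + t *\<^sub>R v)"
    by blast
  from second_difference[OF f h box2] obtain s' t' where st': "0 < s'" "s' < h" "0 < t'" "t' < h"
    "f (x + h *\<^sub>R v + h *\<^sub>R u) - f (x + h *\<^sub>R v) - f (x + h *\<^sub>R u) + f x = h * h * ?F v u (x + s' *\<^sub>R v + t' *\<^sub>R u)"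
    by blast
  have "?F u v (x + s *\<^sub>R u + t *\<^sub>R v) = ?F v u (x + t' *\<^sub>R u + s' *\<^sub>R v)"
  proof -
    have sw: "x + a *\<^sub>R v + b *\<^sub>R u = x + b *\<^sub>R u + a *\<^sub>R v" for a b by (simp add: algebra_simps)
    have "h * h * ?F u v (x + s *\<^sub>R u + t *\<^sub>R v) = h * h * ?F v u (x + t' *\<^sub>R u + s' *\<^sub>R v)"
      using st(5) st'(5) unfolding sw by linarith
    then show ?thesis using h by simp
  qed
  moreover have "\<bar>?F u v (x + s *\<^sub>R u + t *\<^sub>R v) - ?F u v x\<bar> < e"
    by (rule d(3)) (use near st in auto)
  moreover have "\<bar>?F v u (x + t' *\<^sub>R u + s' *\<^sub>R v) - ?F v u x\<bar> < e"
    by (rule d(4)) (use near st' in auto)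
  ultimately have "\<bar>?F u v x - ?F v u x\<bar> < 2 * e" unfolding abs_less_iff by linarith
  then show False by (simp add: e_def)
qed

subsection \<open>Cutoff functions\<close>

text \<open>The powers of \<open>t\<close> in the denominator make the family, up to linear
  combinations, closed under differentiation, so all of its members are shown to be smooth at
  once.\<close>

definition flat_exp :: "nat \<Rightarrow> real \<Rightarrow> real" where
  "flat_exp n t = (if t > 0 then exp (- 1 / t) / t ^ n else 0)"

lemma flat_exp_tendsto_0: "(flat_exp n \<longlongrightarrow> 0) (at 0)"
proof -
  have "((\<lambda>t::real. (inverse t) ^ n / exp (inverse t)) \<longlongrightarrow> 0) (at_right 0)"
    using filterlim_compose[OF tendsto_power_div_exp_0 filterlim_inverse_at_top_right] .
  then have "(flat_exp n \<longlongrightarrow> 0) (at_right 0)"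
    by (rule Lim_transform_eventually)
      (auto simp: eventually_at_right_less flat_exp_def exp_minus field_simps
        intro!: eventually_at_rightI[of 0 1])
  moreover have "(flat_exp n \<longlongrightarrow> 0) (at_left 0)"
    by (rule Lim_transform_eventually[OF tendsto_const])
      (auto simp: flat_exp_def intro!: eventually_at_leftI[of "-1" 0])
  ultimately show ?thesis by (simp add: filterlim_split_at)
qed

lemma flat_exp_derivative:
  "(flat_exp n has_real_derivative flat_exp (n + 2) t - real n * flat_exp (n + 1) t) (at t)"
proof -
  consider "t > 0" | "t < 0" | "t = 0" by linarith
  then show ?thesis
  proof cases
    case 1
    have "((\<lambda>t. exp (- 1 / t) / t ^ n) has_real_derivative flat_exp (n + 2) t - real n * flat_exp (n + 1) t) (at t)"
    proof (cases n)
      case (Suc k)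
      then show ?thesis using 1
        by (cases k)
          (auto intro!: derivative_eq_intros simp: flat_exp_def field_simps power2_eq_square, case_tac nat, auto)
    qed (use 1 in \<open>auto intro!: derivative_eq_intros simp: flat_exp_def field_simps power2_eq_square\<close>)
    then show ?thesis
      using 1 by (subst DERIV_cong_ev[OF refl _ refl, where g = "\<lambda>t. exp (- 1 / t) / t ^ n"])
        (auto simp: flat_exp_def intro!: eventually_mono[OF eventually_nhds_in_open[of "{0<..}"]])
  next
    case 2
    have "((\<lambda>t. 0) has_real_derivative flat_exp (n + 2) t - real n * flat_exp (n + 1) t) (at t)"
      using 2 by (simp add: flat_exp_def)
    then show ?thesis
      using 2 by (subst DERIV_cong_ev[OF refl _ refl, where g = "\<lambda>t. 0"])
        (auto simp: flat_exp_def intro!: eventually_mono[OF eventually_nhds_in_open[of "{..<0}"]])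
  next
    case 3
    \<comment> \<open>At 0 the difference quotient of one member of the family is the next member,
      which tends to 0.\<close>
    have "(\<lambda>h. (flat_exp n (0 + h) - flat_exp n 0) / h) = flat_exp (Suc n)"
      by (auto simp: flat_exp_def fun_eq_iff)
    then show ?thesis using 3 flat_exp_tendsto_0[of "Suc n"] by (simp add: DERIV_def flat_exp_def)
  qed
qed

lemma smooth_on_flat_exp: "smooth_on (flat_exp n) UNIV"
proof -
  have "Ck_on k (flat_exp n) UNIV" for k
  proof (induction k arbitrary: n)
    case 0
    then show ?case
      by (auto simp: continuous_on_eq_continuous_at intro: DERIV_isCont[OF flat_exp_derivative])
  next
    case (Suc k)
    show ?case
    proof (rule Ck_on_SucI[OF open_UNIV,
          where f' = "\<lambda>t v. flat_exp (n + 2) t * v + (- real n * v) * flat_exp (n + 1) t"])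
      show "(flat_exp n has_derivative (\<lambda>v. flat_exp (n + 2) t * v + (- real n * v) * flat_exp (n + 1) t)) (at t)" for t
        using flat_exp_derivative[of n t]
        by (rule has_derivative_eq_rhs[OF has_field_derivative_imp_has_derivative]) (simp add: fun_eq_iff algebra_simps)
    qed (intro Ck_on_add Ck_on_mult Ck_on_const Suc open_UNIV)
  qed
  then show ?thesis by (simp add: smooth_on_def)
qed

text \<open>The value is 0 for \<open>t \<le> 0\<close> and 1 for \<open>t \<ge> 1\<close>. The
  denominator is positive because \<open>t\<close> and \<open>1 - t\<close> are never both
  nonpositive.\<close>

definition smooth_step :: "real \<Rightarrow> real" where
  "smooth_step t = flat_exp 0 t / (flat_exp 0 t + flat_exp 0 (1 - t))"

lemma smooth_on_smooth_step: "smooth_on smooth_step UNIV"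
proof -
  have "smooth_on (\<lambda>t. flat_exp 0 (1 - t)) UNIV"
    by (rule smooth_on_compose[OF open_UNIV open_UNIV _ _ smooth_on_flat_exp])
      (auto intro!: smooth_intros smooth_on_bounded_linear[OF bounded_linear_ident])
  moreover have "flat_exp 0 t + flat_exp 0 (1 - t) \<noteq> 0" for t
    by (auto simp: flat_exp_def add_nonneg_eq_0_iff)
  ultimately show ?thesis
    unfolding smooth_step_def[abs_def] by (intro smooth_intros smooth_on_flat_exp open_UNIV)
qed

lemma exists_cutoff:
  fixes p :: "real ^ 'm::finite"
  assumes "r > 0"
  obtains \<psi> :: "real ^ 'm \<Rightarrow> real" where "smooth_on \<psi> UNIV"
    "\<And>x. x \<in> ball p (r / 2) \<Longrightarrow> \<psi> x = 1" "\<And>x. x \<notin> cball p r \<Longrightarrow> \<psi> x = 0"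
proof
  let ?q = "\<lambda>x. \<Sum>i\<in>UNIV. (x $ i - p $ i) * (x $ i - p $ i)"
  \<comment> \<open>The argument of the step is at least 1 once the squared distance is at most half
    of the squared radius, which covers the ball of radius \<open>r / 2\<close>, and it is
    nonpositive from distance \<open>r\<close> on. Using the squared distance keeps it polynomial at
    \<open>p\<close>.\<close>
  let ?f = "\<lambda>x. smooth_step (2 - ?q x * (2 / r\<^sup>2))"
  have q: "?q x = (dist p x)\<^sup>2" for x
    by (simp add: dist_norm norm_minus_commute[of p] power2_norm_eq_inner inner_vec_def)
  show "smooth_on ?f UNIV"
    by (rule smooth_on_compose[OF open_UNIV open_UNIV _ _ smooth_on_smooth_step])
      (use assms in \<open>auto intro!: smooth_intros\<close>)
  show "?f x = 1" if "x \<in> ball p (r / 2)" for x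
  proof -
    have "(dist p x)\<^sup>2 \<le> (r / 2)\<^sup>2" using that by (intro power_mono) auto
    then have "(dist p x)\<^sup>2 * 4 \<le> r\<^sup>2" by (simp add: power_divide)
    then have "(dist p x)\<^sup>2 * 2 \<le> r\<^sup>2" using zero_le_power2[of "dist p x"] by linarith
    then have "2 - ?q x * (2 / r\<^sup>2) \<ge> 1"
      unfolding q using assms by (simp add: field_simps)
    then show ?thesis by (auto simp: smooth_step_def flat_exp_def)
  qed
  show "?f x = 0" if "x \<notin> cball p r" for x
  proof -
    have "(dist p x)\<^sup>2 \<ge> r\<^sup>2" using that assms by (intro power_mono) auto
    then have "2 - ?q x * (2 / r\<^sup>2) \<le> 0"
      unfolding q using assms by (simp add: field_simps)
    then show ?thesis by (auto simp: smooth_step_def flat_exp_def)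
  qed
qed

section \<open>Smooth families of alternating functionals\<close>

lemma fd_const: "fd (\<lambda>y. c) x v = 0"
  by (simp add: fd_eq[OF has_derivative_const])

lemma fd_add:
  "f differentiable (at x) \<Longrightarrow> g differentiable (at x) \<Longrightarrow> fd (\<lambda>y. f y + g y) x v = fd f x v + fd g x v"
  by (simp add: fd_eq[OF has_derivative_add[OF has_derivative_fd has_derivative_fd]])

lemma fd_cmult:
  fixes f :: "'a::real_normed_vector \<Rightarrow> real"
  shows "f differentiable (at x) \<Longrightarrow> fd (\<lambda>y. c * f y) x v = c * fd f x v"
  by (simp add: fd_eq[OF has_derivative_mult_right[OF has_derivative_fd]])

lemma fd_mult:
  fixes f g :: "'a::real_normed_vector \<Rightarrow> real"
  shows "f differentiable (at x) \<Longrightarrow> g differentiable (at x) \<Longrightarrow>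
    fd (\<lambda>y. f y * g y) x v = f x * fd g x v + fd f x v * g x"
  by (simp add: fd_eq[OF has_derivative_mult[OF has_derivative_fd has_derivative_fd]])

lemma fd_sum:
  "(\<And>i. i \<in> I \<Longrightarrow> f i differentiable (at x)) \<Longrightarrow> fd (\<lambda>y. \<Sum>i\<in>I. f i y) x v = (\<Sum>i\<in>I. fd (f i) x v)"
  by (subst fd_eq[OF has_derivative_sum[where f' = "\<lambda>i. fd (f i) x"]]) (auto intro: has_derivative_fd)

text \<open>A field of \<open>local_fields\<close> seen in one chart. Smoothness is asked for
  constant arguments only; arguments that move with the point are treated by the product rule
  \<open>smooth_family_has_derivative\<close>.\<close>

definition smooth_family ::
    "(real ^ 'm::finite) set \<Rightarrow> nat \<Rightarrow> (real ^ 'm \<Rightarrow> 'v::real_vector list \<Rightarrow> real) \<Rightarrow> bool" where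
  "smooth_family S k T \<longleftrightarrow> open S \<and> (\<forall>y\<in>S. alt_multilinear k (T y)) \<and> (\<forall>vs. smooth_on (\<lambda>y. T y vs) S)"

lemma smooth_family_D:
  assumes "smooth_family S k T"
  shows "open S" "y \<in> S \<Longrightarrow> alt_multilinear k (T y)" "smooth_on (\<lambda>y. T y vs) S"
    "y \<in> S \<Longrightarrow> (\<lambda>y. T y vs) differentiable (at y)"
  using assms by (auto simp: smooth_family_def intro: smooth_on_differentiable)

text \<open>Every defining identity of \<open>T y\<close> holds for all \<open>y\<close> in an open
  set and can therefore be differentiated at \<open>x\<close>.\<close>

lemma alt_multilinear_fd:
  fixes T :: "real ^ 'm::finite \<Rightarrow> 'v::real_vector list \<Rightarrow> real"
  assumes T: "smooth_family S k T" and x: "x \<in> S"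
  shows "alt_multilinear k (\<lambda>vs. fd (\<lambda>y. T y vs) x v)"
proof -
  note S = smooth_family_D(1)[OF T] and alt = smooth_family_D(2)[OF T]
    and d = smooth_family_D(4)[OF T x]
  have z: "fd (\<lambda>y. T y vs) x v = 0" if "\<And>y. y \<in> S \<Longrightarrow> T y vs = 0" for vs
    using fd_cong[OF S x, of "\<lambda>y. T y vs" "\<lambda>_. 0"] that by (simp add: fd_const)
  have "linear (\<lambda>w. fd (\<lambda>y. T y (vs[i := w])) x v)" if "length vs = k" "i < k" for vs i
  proof (rule linearI)
    fix a b :: 'v and r :: real
    have l: "linear (\<lambda>w. T y (vs[i := w]))" if "y \<in> S" for y
      using alt_multilinear_linear_update[OF alt[OF that], of i vs] \<open>length vs = k\<close> \<open>i < k\<close> by simp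
    show "fd (\<lambda>y. T y (vs[i := a + b])) x v = fd (\<lambda>y. T y (vs[i := a])) x v + fd (\<lambda>y. T y (vs[i := b])) x v"
      by (subst fd_add[OF d d, symmetric], subst fd_cong[OF S x]) (simp_all add: linear_add[OF l])
    show "fd (\<lambda>y. T y (vs[i := r *\<^sub>R a])) x v = r *\<^sub>R fd (\<lambda>y. T y (vs[i := a])) x v"
      unfolding real_scaleR_def
      by (subst fd_cmult[OF d, symmetric], subst fd_cong[OF S x]) (simp_all add: linear_scale[OF l])
  qed
  moreover have "fd (\<lambda>y. T y vs) x v = 0" if "length vs \<noteq> k" for vs
    by (rule z) (use alt_multilinear_length[OF alt] that in blast)
  moreover have "fd (\<lambda>y. T y vs) x v = 0" if "length vs = k" "i < j" "j < k" "vs ! i = vs ! j" for vs i j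
    by (rule z) (use alt_multilinear_eq_nth[OF alt] that in blast)
  ultimately show ?thesis unfolding alt_multilinear_def by blast
qed

lemma smooth_family_Cons:
  "smooth_family S (Suc k) T \<Longrightarrow> smooth_family S k (\<lambda>y vs. T y (v # vs))"
  by (auto simp: smooth_family_def intro: alt_multilinear_Cons)

text \<open>The product rule for an evaluation on moving arguments. Expanding the first argument in
  coordinates leaves a finite sum of products of its components with evaluations that have one
  moving argument less.\<close>

lemma smooth_family_has_derivative:
  fixes ws :: "(real ^ 'm::finite \<Rightarrow> real ^ 'm) list"
  assumes "smooth_family S (length ws) T" "x \<in> S"
    and "\<And>w. w \<in> set ws \<Longrightarrow> w differentiable (at x)"
  shows "((\<lambda>y. T y (map (\<lambda>w. w y) ws)) has_derivative
    (\<lambda>v. fd (\<lambda>y. T y (map (\<lambda>w. w x) ws)) x v +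
      (\<Sum>i<length ws. T x ((map (\<lambda>w. w x) ws)[i := fd (ws ! i) x v])))) (at x)"
  using assms(1,3)
proof (induction ws arbitrary: T)
  case Nil
  then show ?case using has_derivative_fd[OF smooth_family_D(4)[OF Nil(1) assms(2)], of "[]"] by simp
next
  case (Cons w ws)
  let ?e = "\<lambda>l::'m. axis l (1::real)" and ?m = "\<lambda>y. map (\<lambda>w. w y) ws"
  note T = Cons.prems(1)[simplified]
  note S = smooth_family_D(1)[OF T] and alt = smooth_family_D(2)[OF T] and d = smooth_family_D(4)[OF T assms(2)]
  note lin = alt_multilinear_linear_Cons[OF alt]
  let ?D = "\<lambda>l v. fd (\<lambda>y. T y (?e l # ?m x)) x v +
      (\<Sum>i<length ws. T x (?e l # (?m x)[i := fd (ws ! i) x v]))"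
  have IH: "((\<lambda>y. T y (?e l # ?m y)) has_derivative ?D l) (at x)" for l
    using Cons.IH[OF smooth_family_Cons[OF T]] Cons.prems(2) by simp
  have w: "(w has_derivative fd w x) (at x)" using Cons.prems(2) by (intro has_derivative_fd) simp
  have wl: "((\<lambda>y. w y $ l) has_derivative (\<lambda>v. fd w x v $ l)) (at x)" for l
    using bounded_linear.has_derivative[OF bounded_linear_vec_nth w] .
  have expand: "T y (u # us) = (\<Sum>l\<in>UNIV. u $ l * T y (?e l # us))" if "y \<in> S" for y u us
    using linear_expand_vec[OF lin[OF that], of u us] by simp
  have "((\<lambda>y. \<Sum>l\<in>UNIV. w y $ l * T y (?e l # ?m y)) has_derivative
      (\<lambda>v. \<Sum>l\<in>UNIV. w x $ l * ?D l v + fd w x v $ l * T x (?e l # ?m x))) (at x)"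
    by (intro has_derivative_sum has_derivative_mult wl IH)
  moreover have "(\<Sum>l\<in>UNIV. w x $ l * ?D l v + fd w x v $ l * T x (?e l # ?m x)) =
     fd (\<lambda>y. T y (map (\<lambda>w. w x) (w # ws))) x v +
      (\<Sum>i<length (w # ws). T x ((map (\<lambda>w. w x) (w # ws))[i := fd ((w # ws) ! i) x v]))" for v
  proof -
    have "linear (\<lambda>u. fd (\<lambda>y. T y (u # ?m x)) x v)"
      by (rule alt_multilinear_linear_Cons[OF alt_multilinear_fd[OF T assms(2)]])
    from linear_expand_vec[OF this, of "w x"]
    have 1: "(\<Sum>l\<in>UNIV. w x $ l * fd (\<lambda>y. T y (?e l # ?m x)) x v) = fd (\<lambda>y. T y (w x # ?m x)) x v"
      by simp
    have "(\<Sum>l\<in>UNIV. w x $ l * (\<Sum>i<length ws. T x (?e l # (?m x)[i := fd (ws ! i) x v]))) =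
        (\<Sum>i<length ws. \<Sum>l\<in>UNIV. w x $ l * T x (?e l # (?m x)[i := fd (ws ! i) x v]))"
      unfolding sum_distrib_left by (rule sum.swap)
    also have "\<dots> = (\<Sum>i<length ws. T x (w x # (?m x)[i := fd (ws ! i) x v]))"
      by (intro sum.cong refl expand[OF assms(2), symmetric])
    finally have 2: "(\<Sum>l\<in>UNIV. w x $ l * (\<Sum>i<length ws. T x (?e l # (?m x)[i := fd (ws ! i) x v]))) =
        (\<Sum>i<length ws. T x (w x # (?m x)[i := fd (ws ! i) x v]))" .
    have 3: "(\<Sum>l\<in>UNIV. fd w x v $ l * T x (?e l # ?m x)) = T x (fd w x v # ?m x)"
      using expand[OF assms(2), of "fd w x v" "?m x"] by simp
    show ?thesis
      by (simp add: distrib_left sum.distrib 1 2 3 sum.lessThan_Suc_shift del: sum.lessThan_Suc)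
  qed
  ultimately have "((\<lambda>y. \<Sum>l\<in>UNIV. w y $ l * T y (?e l # ?m y)) has_derivative
     (\<lambda>v. fd (\<lambda>y. T y (map (\<lambda>w. w x) (w # ws))) x v +
      (\<Sum>i<length (w # ws). T x ((map (\<lambda>w. w x) (w # ws))[i := fd ((w # ws) ! i) x v])))) (at x)"
    by (simp only:)
  moreover have "T y (map (\<lambda>w. w y) (w # ws)) = (\<Sum>l\<in>UNIV. w y $ l * T y (?e l # ?m y))" if "y \<in> S" for y
    unfolding list.map by (rule expand[OF that])
  ultimately show ?case
    by (rule has_derivative_cong_open[OF S assms(2), THEN iffD2, rotated])
qed

section \<open>Naturality of the exterior derivative\<close>

text \<open>The terms of the alternating sum cancel in pairs: omitting the \<open>q\<close>-th argument and
  inserting \<open>B\<close> at the \<open>p\<close>-th place is opposite to the same with \<open>p\<close> and \<open>q\<close> exchanged.\<close>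

lemma altsum_symmetric:
  fixes B :: "'v \<Rightarrow> 'v \<Rightarrow> 'w::real_vector"
  assumes T: "alt_multilinear k T" and sym: "\<And>a b. B a b = B b a"
  shows "altsum (\<lambda>v us. \<Sum>i<length us. T ((map L us)[i := B v (us ! i)])) vs = 0"
proof -
  let ?n = "length vs"
  \<comment> \<open>The signed summand with entry \<open>q\<close> omitted and entry
    \<open>p\<close> replaced by B applied to both; behind \<open>q\<close> the position of
    \<open>p\<close> shifts by one. With the diagonal set to 0 the sum runs over a full square,
    where antisymmetry makes it vanish.\<close>
  define h where "h p q = (if p = q then 0 else
    (-1) ^ q * T ((map L (omit q vs))[(if p < q then p else p - 1) := B (vs ! q) (vs ! p)]))" for p q
  have anti1: "h p q = - h q p" if "p < q" "q < ?n" for p q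
  proof -
    define us where "us = take p vs"
    define ws where "ws = take (q - Suc p) (drop (Suc p) vs)"
    define zs where "zs = drop (Suc q) vs"
    define a b where "a = vs ! p" and "b = vs ! q"
    have vs: "vs = us @ a # ws @ b # zs"
      using that unfolding us_def ws_def zs_def a_def b_def
      by (metis (no_types, lifting) Cons_nth_drop_Suc Suc_leI append_take_drop_id drop_drop
          le_add_diff_inverse2 less_trans)
    have p: "p = length us" and q: "q = Suc (length us + length ws)"
      using that unfolding us_def ws_def by auto
    have nth: "vs ! length us = a" "vs ! q = b" using p by (simp_all add: a_def b_def)
    have oq: "omit q vs = us @ a # ws @ zs" and op: "omit p vs = us @ ws @ b # zs"
      unfolding vs p q by simp_all
    have "h p q = (-1) ^ q * T (map L us @ B b a # map L ws @ map L zs)"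
      using that unfolding h_def oq by (simp add: p nth list_update_append)
    moreover have "h q p = (-1) ^ p * T (map L us @ map L ws @ B a b # map L zs)"
      using that unfolding h_def op by (simp add: p q nth[unfolded q] list_update_append)
    ultimately show ?thesis
      using alt_multilinear_move[OF T, of "map L us" "map L ws"] sym[of a b] p q
      by (simp add: power_add)
  qed
  have anti: "h p q = - h q p" if "p < ?n" "q < ?n" for p q
    using anti1[of p q] anti1[of q p] that by (cases p q rule: linorder_cases) (auto simp: h_def)
  have "(-1) ^ q * (\<Sum>i<length (omit q vs). T ((map L (omit q vs))[i := B (vs ! q) (omit q vs ! i)])) =
      (\<Sum>p<?n. h p q)" if q: "q < ?n" for q
  proof -
    let ?g = "\<lambda>i. if i < q then i else Suc i"
    have "bij_betw ?g {..<?n - 1} ({..<?n} - {q})"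
    proof (rule bij_betwI[where g = "\<lambda>p. if p < q then p else p - 1"])
    qed (use q in \<open>auto split: if_splits\<close>)
    then have "(\<Sum>p\<in>{..<?n} - {q}. h p q) = (\<Sum>i<?n - 1. h (?g i) q)"
      by (rule sum.reindex_bij_betw[symmetric])
    also have "\<dots> = (\<Sum>i<?n - 1. (-1) ^ q * T ((map L (omit q vs))[i := B (vs ! q) (omit q vs ! i)]))"
      using q by (intro sum.cong) (auto simp: h_def nth_append min_def)
    finally have "(\<Sum>p\<in>{..<?n} - {q}. h p q) =
      (-1) ^ q * (\<Sum>i<?n - 1. T ((map L (omit q vs))[i := B (vs ! q) (omit q vs ! i)]))"
      by (simp only: sum_distrib_left)
    moreover have "(\<Sum>p<?n. h p q) = (\<Sum>p\<in>{..<?n} - {q}. h p q)"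
      using q by (subst sum.remove[of _ q]) (auto simp: h_def)
    ultimately show ?thesis using q by (simp add: length_omit)
  qed
  then have "altsum (\<lambda>v us. \<Sum>i<length us. T ((map L us)[i := B v (us ! i)])) vs = (\<Sum>q<?n. \<Sum>p<?n. h p q)"
    unfolding altsum_def by (intro sum.cong) auto
  also have "\<dots> = (\<Sum>q<?n. \<Sum>p<?n. - h q p)"
    by (intro sum.cong refl) (auto intro: anti)
  also have "\<dots> = - (\<Sum>q<?n. \<Sum>p<?n. h p q)"
    by (subst sum.swap) (simp add: sum_negf)
  finally show ?thesis
    using \<open>altsum _ vs = (\<Sum>q<?n. \<Sum>p<?n. h p q)\<close> by linarith
qed

lemma altsum_add: "altsum (\<lambda>v us. F v us + G v us) vs = altsum F vs + altsum G vs"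
  by (simp add: altsum_def distrib_left sum.distrib)

lemma altsum_map: "altsum (\<lambda>v us. F (L v) (map L us)) vs = altsum F (map L vs)"
  by (simp add: altsum_def take_map drop_map)

definition d_at :: "(real ^ 'm::finite \<Rightarrow> (real ^ 'm) list \<Rightarrow> real) \<Rightarrow> real ^ 'm \<Rightarrow> (real ^ 'm) list \<Rightarrow> real" where
  "d_at \<omega> x = altsum (\<lambda>v us. fd (\<lambda>y. \<omega> y us) x v)"

text \<open>Differentiating the pulled-back form produces the pulled-back derivative and, for each
  argument, a term with the second derivative of \<tau> in its place. Second derivatives are
  symmetric, so these terms disappear in the alternating sum by
  \<open>altsum_symmetric\<close>.\<close>

lemma d_at_natural:
  fixes \<tau> :: "real ^ 'm::finite \<Rightarrow> real ^ 'm"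
  assumes \<omega>': "smooth_family S' k \<omega>'" and S: "open S" "x \<in> S" and \<tau>: "smooth_on \<tau> S" "\<tau> ` S \<subseteq> S'"
    and eq: "\<And>y vs. y \<in> S \<Longrightarrow> \<omega> y vs = \<omega>' (\<tau> y) (map (fd \<tau> y) vs)"
  shows "d_at \<omega> x vs = d_at \<omega>' (\<tau> x) (map (fd \<tau> x) vs)"
proof -
  let ?L = "fd \<tau> x"
  define B where "B v w = fd (\<lambda>y. fd \<tau> y w) x v" for v w
  have sym: "B v w = B w v" for v w
  proof (rule vec_eq_iff[THEN iffD2], rule allI)
    fix i
    have comp: "fd (\<lambda>y. fd \<tau> y b) x a $ i = fd (\<lambda>y. fd (\<lambda>z. \<tau> z $ i) y b) x a" for a b
    proof -
      have "fd (\<lambda>z. \<tau> z $ i) y b = fd \<tau> y b $ i" if "y \<in> S" for y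
        using fd_eq[OF bounded_linear.has_derivative[OF bounded_linear_vec_nth
              smooth_on_has_derivative[OF \<tau>(1) that]]] by simp
      then have "fd (\<lambda>y. fd (\<lambda>z. \<tau> z $ i) y b) x a = fd (\<lambda>y. fd \<tau> y b $ i) x a"
        using fd_cong[OF S, of "\<lambda>y. fd (\<lambda>z. \<tau> z $ i) y b" "\<lambda>y. fd \<tau> y b $ i"] by simp
      then show ?thesis
        using fd_eq[OF bounded_linear.has_derivative[OF bounded_linear_vec_nth
              smooth_on_has_derivative[OF smooth_on_fd[OF \<tau>(1)] S(2)]]] by simp
    qed
    show "B v w $ i = B w v $ i"
      unfolding B_def comp
      by (rule fd_commute[OF smooth_on_bounded_linear_compose[OF S(1) bounded_linear_vec_nth \<tau>(1)] S])
  qed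
  define T where "T y us = \<omega>' (\<tau> y) us" for y us
  have alt: "alt_multilinear k (\<omega>' (\<tau> y))" if "y \<in> S" for y
    using smooth_family_D(2)[OF \<omega>'] \<tau>(2) that by blast
  have T: "smooth_family S k T"
    unfolding smooth_family_def T_def
    using S alt \<tau> by (auto intro!: smooth_on_compose[OF S(1) smooth_family_D(1)[OF \<omega>'] \<tau>(2,1)]
      smooth_family_D(3)[OF \<omega>'])
  have fdT: "fd (\<lambda>y. T y us) x v = fd (\<lambda>z. \<omega>' z us) (\<tau> x) (?L v)" for us v
  proof -
    have "((\<lambda>z. \<omega>' z us) has_derivative fd (\<lambda>z. \<omega>' z us) (\<tau> x)) (at (\<tau> x))"
      using smooth_family_D(4)[OF \<omega>'] \<tau>(2) S(2) by (intro has_derivative_fd) auto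
    from fd_eq[OF has_derivative_compose[OF smooth_on_has_derivative[OF \<tau>(1) S(2)] this]]
    show ?thesis by (simp add: T_def)
  qed
  have key: "fd (\<lambda>y. \<omega> y us) x v = fd (\<lambda>z. \<omega>' z (map ?L us)) (\<tau> x) (?L v) +
      (\<Sum>i<length us. \<omega>' (\<tau> x) ((map ?L us)[i := B v (us ! i)]))" for us v
  proof (cases "length us = k")
    case True
    have e: "fd (\<lambda>y. \<omega> y us) x = fd (\<lambda>y. T y (map (\<lambda>w. w y) (map (\<lambda>u y. fd \<tau> y u) us))) x"
      by (rule fd_cong[OF S]) (simp add: eq T_def o_def)
    have "fd (\<lambda>y. \<omega> y us) x v = fd (\<lambda>y. T y (map ?L us)) x v + (\<Sum>i<length us. T x ((map ?L us)[i := B v (us ! i)]))"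
      unfolding e using True T S(2) smooth_on_differentiable[OF smooth_on_fd[OF \<tau>(1)] S(2)]
      by (subst fd_eq[OF smooth_family_has_derivative[of S _ T]]) (auto simp: o_def B_def)
    then show ?thesis by (simp add: fdT) (simp add: T_def)
  next
    case False
    have "fd (\<lambda>y. \<omega> y us) x v = 0"
      using fd_cong[OF S, of "\<lambda>y. \<omega> y us" "\<lambda>_. 0"] alt_multilinear_length[OF alt] False
      by (simp add: eq fd_const)
    moreover have "fd (\<lambda>z. \<omega>' z (map ?L us)) (\<tau> x) (?L v) = 0"
      using alt_multilinear_length[OF alt_multilinear_fd[OF T S(2)], of "map ?L us"] False by (simp add: fdT)
    ultimately show ?thesis using alt_multilinear_length[OF alt[OF S(2)]] False by simp
  qed
  show ?thesis
    unfolding d_at_def key altsum_add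
      altsum_symmetric[where B = B and L = ?L, OF alt[OF S(2)] sym]
    using altsum_map[of "\<lambda>v us. fd (\<lambda>z. \<omega>' z us) (\<tau> x) v" ?L vs] by simp
qed

section \<open>The operator \<open>\<delta>\<^sub>\<nu>\<close> in a chart\<close>

text \<open>For \<open>\<nu> = \<rho> dx\<^sub>J\<close> this is \<open>\<delta>\<^sub>\<nu>P = (-1)\<^sup>k \<rho>\<^sup>-\<^sup>1 \<Sum>\<^sub>i \<partial>\<^sub>i(\<rho> P(dx\<^sub>i, \<cdot>))\<close> on \<open>(k + 1)\<close>-vector fields.\<close>

definition divergence :: "'m list \<Rightarrow> nat \<Rightarrow> (real ^ 'm::finite \<Rightarrow> 'm covector list \<Rightarrow> real) \<Rightarrow>
    (real ^ 'm \<Rightarrow> (real ^ 'm) list \<Rightarrow> real) \<Rightarrow> real ^ 'm \<Rightarrow> 'm covector list \<Rightarrow> real" where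
  "divergence J k P N x \<beta>s = (-1) ^ k * (\<Sum>i\<in>UNIV. fd (\<lambda>y. P y (dcoord i # \<beta>s)) x (axis i 1) +
     fd (\<lambda>y. N y (map (\<lambda>i. axis i 1) J)) x (axis i 1) / N x (map (\<lambda>i. axis i 1) J) * P x (dcoord i # \<beta>s))"

lemma smooth_family_divergence:
  assumes P: "smooth_family S (Suc k) P" and N: "smooth_family S m N"
    and nz: "\<And>y. y \<in> S \<Longrightarrow> N y (map (\<lambda>i. axis i 1) J) \<noteq> 0"
  shows "smooth_family S k (divergence J k P N)"
  unfolding smooth_family_def
proof (intro conjI ballI allI)
  show S: "open S" by (rule smooth_family_D(1)[OF P])
  show "alt_multilinear k (divergence J k P N x)" if "x \<in> S" for x
    unfolding divergence_def[abs_def]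
    by (intro alt_multilinear_cmult alt_multilinear_sum alt_multilinear_add alt_multilinear_Cons
        alt_multilinear_fd[OF smooth_family_Cons[OF P] that] smooth_family_D(2)[OF P that])
  show "smooth_on (\<lambda>x. divergence J k P N x \<beta>s) S" for \<beta>s
    unfolding divergence_def
    by (intro smooth_intros S smooth_on_fd smooth_family_D(3)[OF P] smooth_family_D(3)[OF N] nz)
qed

text \<open>The derivative of a top form is \<theta>(v) times the form, with \<theta> the
  logarithmic derivative of its density. So differentiating the contraction amounts to contracting
  with \<open>G v\<close>, the derivative of \<open>P\<close> plus \<theta>(v) \<open>P\<close>, and
  Cramer's rule turns the alternating sum into a trace over \<open>v\<close>.\<close>

lemma d_at_con:
  fixes P :: "real ^ 'm::finite \<Rightarrow> 'm covector list \<Rightarrow> real"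
  assumes P: "smooth_family S (Suc k) P" and N: "smooth_family S CARD('m) N"
    and J: "distinct J" "set J = UNIV" and nz: "N x (map (\<lambda>i. axis i 1) J) \<noteq> 0" and x: "x \<in> S"
  shows "d_at (\<lambda>y. con (Suc k) (P y) (N y)) x vs = con k (divergence J k P N x) (N x) vs"
proof -
  define \<theta> where "\<theta> v = fd (\<lambda>y. N y (map (\<lambda>i. axis i 1) J)) x v / N x (map (\<lambda>i. axis i 1) J)" for v
  define G where "G v \<beta>s = fd (\<lambda>y. P y \<beta>s) x v + \<theta> v * P x \<beta>s" for v \<beta>s
  note dP = smooth_family_D(4)[OF P x] and dN = smooth_family_D(4)[OF N x]
  have fdN: "fd (\<lambda>y. N y us) x v = \<theta> v * N x us" for us v
    using alt_multilinear_top_proportional[OF smooth_family_D(2)[OF N x] alt_multilinear_fd[OF N x] span_axis J,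
        of us v] nz by (simp add: \<theta>_def field_simps)
  have "fd (\<lambda>y. con (Suc k) (P y) (N y) us) x v = con (Suc k) (G v) (N x) us" for us v
  proof -
    let ?e = "map (\<lambda>i::'m. axis i (1::real))"
    have "((\<lambda>y. con (Suc k) (P y) (N y) us) has_derivative
        (\<lambda>v. (\<Sum>I\<in>{I. length I = Suc k}. P x (map dcoord I) * fd (\<lambda>y. N y (?e I @ us)) x v +
          fd (\<lambda>y. P y (map dcoord I)) x v * N x (?e I @ us)) / fact (Suc k))) (at x)"
      unfolding con_def divide_inverse
      by (intro has_derivative_mult_left has_derivative_sum has_derivative_mult has_derivative_fd dP dN)
    from fd_eq[OF this] show ?thesis
      by (simp add: con_def G_def fdN algebra_simps cong: sum.cong)
  qed
  then have "d_at (\<lambda>y. con (Suc k) (P y) (N y)) x vs = altsum (\<lambda>v. con (Suc k) (G v) (N x)) vs"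
    by (simp add: d_at_def)
  also have "\<dots> = (-1) ^ k * con k (\<lambda>\<beta>s. \<Sum>i\<in>UNIV. G (axis i 1) (dcoord i # \<beta>s)) (N x) vs"
  proof (rule altsum_con)
    show "alt_multilinear CARD('m) (N x)" by (rule smooth_family_D(2)[OF N x])
    show "alt_multilinear (Suc k) (G v)" for v
      unfolding G_def[abs_def]
      by (intro alt_multilinear_add alt_multilinear_cmult alt_multilinear_fd[OF P x] smooth_family_D(2)[OF P x])
    show "linear (\<lambda>v. G v \<beta>s)" for \<beta>s
      by (rule linearI)
        (simp_all add: G_def \<theta>_def linear_add[OF linear_fd[OF dP]] linear_scale[OF linear_fd[OF dP]]
          linear_add[OF linear_fd[OF dN]] linear_scale[OF linear_fd[OF dN]] add_divide_distrib algebra_simps)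
  qed
  also have "\<dots> = con k (divergence J k P N x) (N x) vs"
    by (simp add: divergence_def[abs_def] G_def \<theta>_def con_scale_left)
  finally show ?thesis .
qed

text \<open>With \<open>i(\<alpha>)P = 0\<close>, the contraction of the divergence by \<open>\<alpha>\<close> is up to sign the
  contraction of \<open>P\<close> by \<open>d\<alpha>\<close>.\<close>

lemma divergence_contract:
  fixes P :: "real ^ 'm::finite \<Rightarrow> 'm covector list \<Rightarrow> real" and \<alpha> :: "real ^ 'm \<Rightarrow> 'm covector"
  assumes P: "smooth_family S (Suc (Suc k)) P" and x: "x \<in> S"
    and \<alpha>: "\<And>l. smooth_on (\<lambda>y. blinfun_apply (\<alpha> y) (axis l 1)) S"
    and zero: "\<And>y \<beta>s. y \<in> S \<Longrightarrow> P y (\<alpha> y # \<beta>s) = 0"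
  shows "divergence J (Suc k) P N x (\<alpha> x # \<beta>s) =
    (-1) ^ k * (\<Sum>i\<in>UNIV. \<Sum>l\<in>UNIV. fd (\<lambda>y. blinfun_apply (\<alpha> y) (axis l 1)) x (axis i 1) *
       P x (dcoord i # dcoord l # \<beta>s))"
proof -
  note S = smooth_family_D(1)[OF P] and alt = smooth_family_D(2)[OF P]
  let ?a = "\<lambda>l y. blinfun_apply (\<alpha> y) (axis l 1)"
  have zero2: "P y (dcoord i # \<alpha> y # \<beta>s) = 0" if "y \<in> S" for y i
    using alt_multilinear_swap[OF alt[OF that], of "[]" "dcoord i" "\<alpha> y" \<beta>s] zero[OF that] by simp
  have expand: "T (\<beta> # \<gamma> # \<beta>s) = (\<Sum>l\<in>UNIV. blinfun_apply \<gamma> (axis l 1) * T (\<beta> # dcoord l # \<beta>s))"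
    if "alt_multilinear (Suc (Suc k)) T" for T \<beta> \<gamma>
    using linear_expand_covector[OF alt_multilinear_linear[OF that, of "[\<beta>]"], of \<gamma> \<beta>s] by simp
  have "fd (\<lambda>y. P y (dcoord i # \<alpha> x # \<beta>s)) x v =
      - (\<Sum>l\<in>UNIV. fd (?a l) x v * P x (dcoord i # dcoord l # \<beta>s))" for i v
  proof -
    have "0 = fd (\<lambda>y. P y (dcoord i # \<alpha> y # \<beta>s)) x v"
      using fd_cong[OF S x, of "\<lambda>y. P y (dcoord i # \<alpha> y # \<beta>s)" "\<lambda>_. 0"] zero2 by (simp add: fd_const)
    also have "\<dots> = fd (\<lambda>y. \<Sum>l\<in>UNIV. ?a l y * P y (dcoord i # dcoord l # \<beta>s)) x v"
      by (rule fun_cong[OF fd_cong[OF S x expand[OF alt]]])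
    also have "\<dots> = (\<Sum>l\<in>UNIV. ?a l x * fd (\<lambda>y. P y (dcoord i # dcoord l # \<beta>s)) x v +
        fd (?a l) x v * P x (dcoord i # dcoord l # \<beta>s))"
      using smooth_on_differentiable[OF \<alpha> x] smooth_family_D(4)[OF P x]
      by (subst fd_sum) (auto simp: fd_mult intro!: differentiable_mult)
    also have "\<dots> = fd (\<lambda>y. P y (dcoord i # \<alpha> x # \<beta>s)) x v +
        (\<Sum>l\<in>UNIV. fd (?a l) x v * P x (dcoord i # dcoord l # \<beta>s))"
      unfolding sum.distrib
      using expand[OF alt_multilinear_fd[OF P x], where \<beta> = "dcoord i" and \<gamma> = "\<alpha> x"] by simp
    finally show ?thesis by linarith
  qed
  then show ?thesis
    using zero2[OF x] by (simp add: divergence_def sum_negf)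
qed

text \<open>The hypothesis \<open>ann\<close> says that the bivector \<open>R\<close> lies in the
  second exterior power of \<open>D\<close>. For a projection \<pi> onto \<open>D\<close> the
  covector \<beta> - \<beta> \<circ> \<pi> annihilates \<open>D\<close>, so \<open>R\<close> sees
  only \<beta> \<circ> \<pi>. Moving \<pi> over to \<open>B\<close> leaves a bilinear form that is
  symmetric everywhere, and its pairing with an alternating one is zero.\<close>

lemma sum_symmetric_alternating_eq_0:
  fixes R :: "'m::finite covector \<Rightarrow> 'm covector \<Rightarrow> real" and B :: "real ^ 'm \<Rightarrow> real ^ 'm \<Rightarrow> real"
  assumes R1: "\<And>\<gamma>. linear (\<lambda>\<beta>. R \<beta> \<gamma>)" and anti: "\<And>\<beta> \<gamma>. R \<beta> \<gamma> = - R \<gamma> \<beta>"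
    and B1: "\<And>w. linear (\<lambda>v. B v w)" and B2: "\<And>v. linear (B v)"
    and D: "subspace D" and sym: "\<And>v w. v \<in> D \<Longrightarrow> w \<in> D \<Longrightarrow> B v w = B w v"
    and ann: "\<And>\<beta> \<gamma>. (\<And>v. v \<in> D \<Longrightarrow> blinfun_apply \<beta> v = 0) \<Longrightarrow> R \<beta> \<gamma> = 0"
  shows "(\<Sum>i\<in>UNIV. \<Sum>l\<in>UNIV. B (axis i 1) (axis l 1) * R (dcoord i) (dcoord l)) = 0"
proof -
  obtain \<pi> where \<pi>: "range \<pi> \<subseteq> D" "linear \<pi>" "\<And>v. v \<in> D \<Longrightarrow> \<pi> v = v"
    using linear_exists_left_inverse_on[OF linear_id D, simplified] by auto
  define L where "L = Blinfun \<pi>"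
  have L: "blinfun_apply L = \<pi>"
    unfolding L_def by (rule bounded_linear_Blinfun_apply) (use \<pi>(2) linear_conv_bounded_linear in auto)
  have R2: "linear (R \<beta>)" for \<beta>
  proof -
    have "R \<beta> = (\<lambda>\<gamma>. - R \<gamma> \<beta>)" by (rule ext) (rule anti)
    then show ?thesis using linear_compose_neg[OF R1[of \<beta>]] by simp
  qed
  have left: "R \<beta> \<gamma> = R (\<beta> o\<^sub>L L) \<gamma>" for \<beta> \<gamma>
  proof -
    have "R (\<beta> - (\<beta> o\<^sub>L L)) \<gamma> = 0" by (rule ann) (simp add: blinfun.diff_left L \<pi>(3))
    then show ?thesis using linear_diff[OF R1, of \<beta> "\<beta> o\<^sub>L L" \<gamma>] by linarith
  qed
  have RL: "R \<beta> \<gamma> = R (\<beta> o\<^sub>L L) (\<gamma> o\<^sub>L L)" for \<beta> \<gamma>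
    using left anti by metis
  let ?l = "\<lambda>i j. \<pi> (axis j 1) $ i"
  let ?U = "UNIV :: 'm set"
  have RL2: "R (dcoord i) (dcoord l) = (\<Sum>j\<in>?U. \<Sum>k\<in>?U. ?l i j * ?l l k * R (dcoord j) (dcoord k))" for i l
    unfolding RL[of "dcoord i"] dcoord_compose L
    unfolding linear_sum[OF R1] linear_scale[OF R1]
    unfolding linear_sum[OF R2] linear_scale[OF R2] real_scaleR_def sum_distrib_left mult.assoc ..
  have BL: "(\<Sum>i\<in>?U. \<Sum>l\<in>?U. ?l i j * ?l l k * B (axis i 1) (axis l 1)) = B (\<pi> (axis j 1)) (\<pi> (axis k 1))" for j k
    unfolding linear_expand_vec[OF B1, of "\<pi> (axis j 1)"]
    unfolding linear_expand_vec[OF B2, of _ "\<pi> (axis k 1)"]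
    by (simp add: sum_distrib_left mult.assoc)
  let ?s = "\<lambda>R. \<Sum>j\<in>?U. \<Sum>k\<in>?U. B (\<pi> (axis j 1)) (\<pi> (axis k 1)) * R j k"
  have "(\<Sum>i\<in>?U. \<Sum>l\<in>?U. B (axis i 1) (axis l 1) * R (dcoord i) (dcoord l)) =
      (\<Sum>i\<in>?U. \<Sum>l\<in>?U. \<Sum>j\<in>?U. \<Sum>k\<in>?U. ?l i j * ?l l k * B (axis i 1) (axis l 1) * R (dcoord j) (dcoord k))"
  proof (intro sum.cong refl)
    fix i l
    show "B (axis i 1) (axis l 1) * R (dcoord i) (dcoord l) =
        (\<Sum>j\<in>?U. \<Sum>k\<in>?U. ?l i j * ?l l k * B (axis i 1) (axis l 1) * R (dcoord j) (dcoord k))"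
      unfolding RL2[of i l] sum_distrib_left by (intro sum.cong refl) simp
  qed
  also have "\<dots> = (\<Sum>i\<in>?U. \<Sum>j\<in>?U. \<Sum>l\<in>?U. \<Sum>k\<in>?U. ?l i j * ?l l k * B (axis i 1) (axis l 1) * R (dcoord j) (dcoord k))"
    by (intro sum.cong refl sum.swap)
  also have "\<dots> = (\<Sum>j\<in>?U. \<Sum>i\<in>?U. \<Sum>k\<in>?U. \<Sum>l\<in>?U. ?l i j * ?l l k * B (axis i 1) (axis l 1) * R (dcoord j) (dcoord k))"
    by (subst sum.swap) (intro sum.cong refl sum.swap)
  also have "\<dots> = (\<Sum>j\<in>?U. \<Sum>k\<in>?U. \<Sum>i\<in>?U. \<Sum>l\<in>?U. ?l i j * ?l l k * B (axis i 1) (axis l 1) * R (dcoord j) (dcoord k))"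
    by (intro sum.cong refl sum.swap)
  also have "\<dots> = ?s (\<lambda>j k. R (dcoord j) (dcoord k))"
    unfolding BL[symmetric] sum_distrib_right ..
  finally have eq: "(\<Sum>i\<in>?U. \<Sum>l\<in>?U. B (axis i 1) (axis l 1) * R (dcoord i) (dcoord l)) = ?s (\<lambda>j k. R (dcoord j) (dcoord k))" .
  have "?s (\<lambda>j k. R (dcoord j) (dcoord k)) = (\<Sum>j\<in>?U. \<Sum>k\<in>?U. - (B (\<pi> (axis k 1)) (\<pi> (axis j 1)) * R (dcoord k) (dcoord j)))"
    using sym \<pi>(1) anti by (intro sum.cong refl) (metis mult_minus_right rangeI subset_eq)
  also have "\<dots> = - ?s (\<lambda>j k. R (dcoord j) (dcoord k))"
    by (subst sum.swap) (simp add: sum_negf)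
  finally show ?thesis using eq by linarith
qed

lemma linear_blinfun_apply: "linear (blinfun_apply \<beta>)"
  by (rule bounded_linear.linear[OF blinfun.bounded_linear_right])

section \<open>Annihilators of families of vector fields\<close>

text \<open>The determinant with rows \<open>ws\<close> and columns \<open>is\<close>, expanded
  along its first column. It is 0 for unequal lengths, as an alternating functional of the rows has
  to be.\<close>

fun minor :: "(real ^ 'm::finite) list \<Rightarrow> 'm list \<Rightarrow> real" where
  "minor ws [] = (if ws = [] then 1 else 0)"
| "minor ws (i # is) = altsum (\<lambda>w us. w $ i * minor us is) ws"

lemma linear_nth_mult: "linear (\<lambda>w. w $ i * (a::real))"
  by (rule linearI) (simp_all add: algebra_simps)

lemma alt_multilinear_minor: "alt_multilinear (length is) (\<lambda>ws. minor ws is)"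
proof (induction "is")
  case Nil
  show ?case by (simp add: alt_multilinear_def)
next
  case (Cons i "is")
  have "alt_multilinear (Suc (length is)) (altsum (\<lambda>w us. w $ i * minor us is))"
    by (rule alt_multilinear_altsum[OF alt_multilinear_cmult[OF Cons] linear_nth_mult])
  then show ?case by simp
qed

lemma altsum_Cons:
  "altsum F (v # us) = F v us - (\<Sum>j<length us. (-1) ^ j * F (us ! j) (v # omit j us))"
  using altsum_append[of F "[v]" us] by simp

lemma smooth_on_altsum:
  assumes "open S" "\<And>w us. w \<in> set ws \<Longrightarrow> set us \<subseteq> set ws \<Longrightarrow> smooth_on (\<lambda>x. F (w x) (map (\<lambda>w. w x) us)) S"
  shows "smooth_on (\<lambda>x. altsum F (map (\<lambda>w. w x) ws)) S"
proof -
  have "smooth_on (\<lambda>x. F (map (\<lambda>w. w x) ws ! j) (omit j (map (\<lambda>w. w x) ws))) S" if "j < length ws" for j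
    using assms(2)[of "ws ! j" "omit j ws"] that set_take_subset[of j ws] set_drop_subset[of "Suc j" ws]
    by (simp add: take_map drop_map)
  then show ?thesis unfolding altsum_def by (auto intro!: smooth_intros assms(1))
qed

lemma smooth_on_minor:
  assumes "open S" "\<And>w i. w \<in> set ws \<Longrightarrow> smooth_on (\<lambda>x. w x $ i) S"
  shows "smooth_on (\<lambda>x. minor (map (\<lambda>w. w x) ws) is) S"
  using assms(2)
proof (induction "is" arbitrary: ws)
  case Nil
  show ?case by (cases ws) (simp_all add: smooth_on_const)
next
  case (Cons i "is")
  show ?case unfolding minor.simps
    by (intro smooth_on_altsum smooth_on_mult assms(1) Cons) auto
qed

text \<open>At a point where some minor of maximal size does not vanish, every covector annihilating the
  fields extends to a field of such covectors, by expanding a vanishing minor along a column.\<close>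

lemma extend_annihilator:
  fixes Y :: "'b \<Rightarrow> real ^ 'm::finite \<Rightarrow> real ^ 'm"
  assumes U: "open U" "U \<noteq> {}" and Y: "\<And>b i. smooth_on (\<lambda>x. Y b x $ i) U"
  obtains p where "p \<in> U" "\<And>\<beta> :: 'm covector. (\<And>b. blinfun_apply \<beta> (Y b p) = 0) \<Longrightarrow>
    \<exists>\<theta> c. (\<forall>l. smooth_on (\<lambda>x. blinfun_apply (\<theta> x) (axis l 1)) U) \<and>
      (\<forall>x\<in>U. \<forall>b. blinfun_apply (\<theta> x) (Y b x) = 0) \<and> c \<noteq> 0 \<and> \<theta> p = c *\<^sub>R \<beta>"
proof -
  \<comment> \<open>\<open>rk r\<close> says that some minor of size \<open>r\<close> is nonzero
    somewhere in \<open>U\<close>. For the largest such \<open>r\<close> all minors of size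
    \<open>Suc r\<close> vanish on the whole of \<open>U\<close>, so \<open>U\<close> need not be
    shrunk around \<open>p\<close>.\<close>
  define rk where "rk r \<longleftrightarrow> (\<exists>x\<in>U. \<exists>bs is. length bs = r \<and> length is = r \<and> minor (map (\<lambda>b. Y b x) bs) is \<noteq> 0)" for r
  have "rk 0" using U by (auto simp: rk_def)
  moreover have "r \<le> CARD('m)" if "rk r" for r
    using that alt_multilinear_too_long[OF alt_multilinear_minor span_axis]
    unfolding rk_def by (metis not_le_imp_less)
  ultimately obtain r where r: "rk r" and max: "\<And>s. rk s \<Longrightarrow> s \<le> r"
    using GreatestI_nat[of rk 0 "CARD('m)"] Greatest_le_nat[of rk _ "CARD('m)"] by blast
  then obtain p bs "is" where p: "p \<in> U" "length bs = r" "length is = r" "minor (map (\<lambda>b. Y b p) bs) is \<noteq> 0"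
    unfolding rk_def by blast
  have vanish: "minor (map (\<lambda>b. Y b x) (b # bs)) (i # is) = 0" if "x \<in> U" for x b i
    using max[of "Suc r"] that p(2,3) unfolding rk_def by (metis Suc_n_not_le_n length_Cons)
  have "\<exists>\<theta> c. (\<forall>l. smooth_on (\<lambda>x. blinfun_apply (\<theta> x) (axis l 1)) U) \<and>
      (\<forall>x\<in>U. \<forall>b. blinfun_apply (\<theta> x) (Y b x) = 0) \<and> c \<noteq> 0 \<and> \<theta> p = c *\<^sub>R \<beta>"
    if \<beta>: "\<And>b. blinfun_apply \<beta> (Y b p) = 0" for \<beta> :: "'m covector"
  proof -
    let ?F = "\<lambda>w us. blinfun_apply \<beta> w * minor us is"
    \<comment> \<open>A determinant with rows \<open>v\<close> and the chosen fields, columns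
      \<open>is\<close> and an additional first column holding the values of the fixed \<beta>.
      Expanding \<beta> in coordinates makes it a combination of minors of size
      \<open>Suc r\<close>, so it vanishes when \<open>v\<close> is one of the fields. At
      \<open>p\<close> the fields have zeros in the first column, which leaves the nonzero minor
      times \<beta>.\<close>
    define E where "E x v = altsum ?F (v # map (\<lambda>b. Y b x) bs)" for x v
    have "alt_multilinear (Suc r) (altsum ?F)"
      using alt_multilinear_altsum[OF alt_multilinear_cmult[OF alt_multilinear_minor[of "is"]] linear_scale_covector] p(3)
      by simp
    then have lin: "linear (E x)" for x
      unfolding E_def[abs_def] by (rule alt_multilinear_linear_Cons)
    define \<theta> where "\<theta> x = Blinfun (E x)" for x
    have \<theta>: "blinfun_apply (\<theta> x) = E x" for x
      unfolding \<theta>_def by (rule bounded_linear_Blinfun_apply) (use lin linear_conv_bounded_linear in auto)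
    have expand: "(\<Sum>i\<in>UNIV. blinfun_apply \<beta> (axis i 1) * u $ i) = blinfun_apply \<beta> u" for u
      using linear_expand_vec[OF linear_blinfun_apply, of \<beta> u] by (simp add: mult.commute)
    have "smooth_on (\<lambda>x. E x v) U" for v
    proof -
      have "smooth_on (\<lambda>x. altsum ?F (map (\<lambda>w. w x) ((\<lambda>x. v) # map Y bs))) U"
      proof (rule smooth_on_altsum[OF U(1)])
        fix w us assume w: "w \<in> set ((\<lambda>x. v) # map Y bs)" "set us \<subseteq> set ((\<lambda>x. v) # map Y bs)"
        have sm: "smooth_on (\<lambda>x. w x $ i) U" if "w \<in> set ((\<lambda>x. v) # map Y bs)" for w i
          using that Y by (auto intro: smooth_on_const)
        have "smooth_on (\<lambda>x. \<Sum>i\<in>UNIV. w x $ i * blinfun_apply \<beta> (axis i 1)) U"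
          by (intro smooth_intros U(1) sm w)
        then have "smooth_on (\<lambda>x. blinfun_apply \<beta> (w x)) U"
          by (rule smooth_on_cong[OF _ U(1)]) (use expand in \<open>simp add: mult.commute\<close>)
        then show "smooth_on (\<lambda>x. blinfun_apply \<beta> (w x) * minor (map (\<lambda>w. w x) us) is) U"
          using w by (intro smooth_on_mult smooth_on_minor U(1) sm) auto
      qed
      then show ?thesis by (simp add: E_def o_def)
    qed
    moreover have "E x (Y b x) = 0" if "x \<in> U" for x b
    proof -
      have "altsum ?F ws = (\<Sum>i\<in>UNIV. blinfun_apply \<beta> (axis i 1) * minor ws (i # is))" for ws
      proof -
        have "altsum ?F ws = (\<Sum>j<length ws. \<Sum>i\<in>UNIV. blinfun_apply \<beta> (axis i 1) * ((-1) ^ j * (ws ! j $ i * minor (omit j ws) is)))"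
          unfolding altsum_def expand[of "ws ! j" for j, symmetric] sum_distrib_left sum_distrib_right
          by (intro sum.cong refl) simp
        also have "\<dots> = (\<Sum>i\<in>UNIV. \<Sum>j<length ws. blinfun_apply \<beta> (axis i 1) * ((-1) ^ j * (ws ! j $ i * minor (omit j ws) is)))"
          by (rule sum.swap)
        finally show ?thesis by (simp add: altsum_def sum_distrib_left)
      qed
      then show ?thesis using vanish[OF that, of b] by (simp add: E_def)
    qed
    moreover have "E p v = minor (map (\<lambda>b. Y b p) bs) is * blinfun_apply \<beta> v" for v
      unfolding E_def altsum_Cons by (simp add: \<beta>)
    then have "\<theta> p = minor (map (\<lambda>b. Y b p) bs) is *\<^sub>R \<beta>"
      by (intro blinfun_eqI) (simp add: \<theta> blinfun.scaleR_left)
    ultimately show ?thesis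
      using p(4) \<theta> by (intro exI[of _ \<theta>] exI[of _ "minor (map (\<lambda>b. Y b p) bs) is"]) auto
  qed
  with p(1) that show thesis by blast
qed

section \<open>The characteristic distribution in a chart\<close>

text \<open>The Hamiltonian vector of \<open>\<beta>s\<close>. Lists of the wrong length give the
  zero vector, so all lists of covectors may serve as indices of the family.\<close>

definition ham :: "(real ^ 'm::finite \<Rightarrow> 'm covector list \<Rightarrow> real) \<Rightarrow> 'm covector list \<Rightarrow> real ^ 'm \<Rightarrow> real ^ 'm" where
  "ham \<Lambda> \<beta>s x = (\<chi> i. \<Lambda> x (\<beta>s @ [dcoord i]))"

lemma apply_ham:
  assumes "alt_multilinear n (\<Lambda> x)"
  shows "blinfun_apply \<gamma> (ham \<Lambda> \<beta>s x) = \<Lambda> x (\<beta>s @ [\<gamma>])"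
proof -
  have "blinfun_apply \<gamma> (ham \<Lambda> \<beta>s x) = (\<Sum>i\<in>UNIV. ham \<Lambda> \<beta>s x $ i * blinfun_apply \<gamma> (axis i 1))"
    using linear_expand_vec[OF linear_blinfun_apply, of \<gamma> "ham \<Lambda> \<beta>s x"] by simp
  also have "\<dots> = \<Lambda> x (\<beta>s @ [\<gamma>])"
    using linear_expand_covector[OF alt_multilinear_linear[OF assms, of \<beta>s "[]"], of \<gamma>]
    by (simp add: ham_def mult.commute)
  finally show ?thesis .
qed

lemma smooth_on_ham: "smooth_family S n \<Lambda> \<Longrightarrow> smooth_on (\<lambda>x. ham \<Lambda> \<beta>s x $ i) S"
  by (simp add: ham_def smooth_family_D(3))

text \<open>The derivative of \<alpha> in direction \<open>v\<close>, applied to \<open>w\<close>.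
  Exchanging \<open>v\<close> and \<open>w\<close> and subtracting gives d\<alpha>(v, w); closedness
  on a pair of vectors thus appears as symmetry.\<close>

definition fd_field :: "(real ^ 'm::finite \<Rightarrow> 'm covector) \<Rightarrow> real ^ 'm \<Rightarrow> real ^ 'm \<Rightarrow> real ^ 'm \<Rightarrow> real" where
  "fd_field \<alpha> x v w = (\<Sum>l\<in>UNIV. w $ l * fd (\<lambda>y. blinfun_apply (\<alpha> y) (axis l 1)) x v)"

text \<open>For \<open>\<alpha>\<close> in the kernel of \<open>#\<^sub>1\<close> the fundamental identity, applied to \<open>\<gamma>s\<close> and the constant
  covector \<open>\<alpha>(x)\<close>, says that \<open>d\<alpha>\<close> vanishes on pairs of Hamiltonian vectors.\<close>

lemma d_kernel_vanishes_on_ham: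
  fixes \<Lambda> :: "real ^ 'm::finite \<Rightarrow> 'm covector list \<Rightarrow> real" and \<alpha> :: "real ^ 'm \<Rightarrow> 'm covector"
  assumes \<Lambda>: "smooth_family S (Suc n) \<Lambda>" and x: "x \<in> S"
    and FI: "\<And>\<beta>s \<gamma>s. length \<beta>s = n \<Longrightarrow> length \<gamma>s = Suc n \<Longrightarrow>
      \<Lambda> x (\<beta>s @ [Blinfun (fd (\<lambda>y. \<Lambda> y \<gamma>s) x)]) =
      (\<Sum>i<Suc n. \<Lambda> x (\<gamma>s[i := Blinfun (fd (\<lambda>y. \<Lambda> y (\<beta>s @ [\<gamma>s ! i])) x)]))"
    and \<alpha>: "\<And>l. smooth_on (\<lambda>y. blinfun_apply (\<alpha> y) (axis l 1)) S"
    and zero: "\<And>y \<beta>s. y \<in> S \<Longrightarrow> \<Lambda> y (\<alpha> y # \<beta>s) = 0"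
  shows "fd_field \<alpha> x (ham \<Lambda> \<beta>s x) (ham \<Lambda> \<gamma>s x) = fd_field \<alpha> x (ham \<Lambda> \<gamma>s x) (ham \<Lambda> \<beta>s x)"
proof -
  note S = smooth_family_D(1)[OF \<Lambda>] and alt = smooth_family_D(2)[OF \<Lambda>] and d = smooth_family_D(4)[OF \<Lambda> x]
  note app = apply_ham[of "Suc n" \<Lambda> x, OF alt[OF x]]
  have Blinfun_fd: "blinfun_apply (Blinfun (fd (\<lambda>y. \<Lambda> y \<gamma>s) x)) = fd (\<lambda>y. \<Lambda> y \<gamma>s) x" for \<gamma>s
    by (rule bounded_linear_Blinfun_apply[OF smooth_on_bounded_linear_fd[OF smooth_family_D(3)[OF \<Lambda>] x]])
  have zero': "\<Lambda> y (us @ \<alpha> y # vs) = 0" if "y \<in> S" for y us vs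
    using alt_multilinear_to_front[OF alt[OF that], of us "\<alpha> y" vs] zero[OF that] by simp
  have key: "fd (\<lambda>y. \<Lambda> y (\<beta>s @ [\<alpha> x])) x v = - fd_field \<alpha> x v (ham \<Lambda> \<beta>s x)" for \<beta>s v
  proof -
    let ?a = "\<lambda>l y. blinfun_apply (\<alpha> y) (axis l 1)"
    have expand: "T (\<beta>s @ [\<gamma>]) = (\<Sum>l\<in>UNIV. blinfun_apply \<gamma> (axis l 1) * T (\<beta>s @ [dcoord l]))"
      if "alt_multilinear (Suc n) T" for T \<gamma>
      using linear_expand_covector[OF alt_multilinear_linear[OF that, of \<beta>s "[]"], of \<gamma>] by simp
    have "0 = fd (\<lambda>y. \<Lambda> y (\<beta>s @ [\<alpha> y])) x v"
      using fd_cong[OF S x, of "\<lambda>y. \<Lambda> y (\<beta>s @ [\<alpha> y])" "\<lambda>_. 0"] zero' by (simp add: fd_const)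
    also have "\<dots> = fd (\<lambda>y. \<Sum>l\<in>UNIV. ?a l y * \<Lambda> y (\<beta>s @ [dcoord l])) x v"
      by (rule fun_cong[OF fd_cong[OF S x expand[OF alt]]])
    also have "\<dots> = (\<Sum>l\<in>UNIV. ?a l x * fd (\<lambda>y. \<Lambda> y (\<beta>s @ [dcoord l])) x v +
        fd (?a l) x v * \<Lambda> x (\<beta>s @ [dcoord l]))"
      using smooth_on_differentiable[OF \<alpha> x] d
      by (subst fd_sum) (auto simp: fd_mult intro!: differentiable_mult)
    also have "\<dots> = fd (\<lambda>y. \<Lambda> y (\<beta>s @ [\<alpha> x])) x v + fd_field \<alpha> x v (ham \<Lambda> \<beta>s x)"
      unfolding sum.distrib fd_field_def
      using expand[OF alt_multilinear_fd[OF \<Lambda> x], where \<gamma> = "\<alpha> x"] by (simp add: ham_def mult.commute)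
    finally show ?thesis by linarith
  qed
  show ?thesis
  proof (cases "length \<beta>s = n \<and> length \<gamma>s = n")
    case True
    \<comment> \<open>On the right of the fundamental identity every summand but the last keeps the
      kernel covector in its final slot and vanishes.\<close>
    have "\<Lambda> x ((\<gamma>s @ [\<alpha> x])[i := \<delta>]) = 0" if "i < n" for i \<delta>
      using zero'[OF x, of "\<gamma>s[i := \<delta>]" "[]"] True that by (simp add: list_update_append)
    then have "(\<Sum>i<Suc n. \<Lambda> x ((\<gamma>s @ [\<alpha> x])[i := Blinfun (fd (\<lambda>y. \<Lambda> y (\<beta>s @ [(\<gamma>s @ [\<alpha> x]) ! i])) x)])) =
        \<Lambda> x (\<gamma>s @ [Blinfun (fd (\<lambda>y. \<Lambda> y (\<beta>s @ [\<alpha> x])) x)])"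
      using True by (simp add: nth_append list_update_append)
    then have "\<Lambda> x (\<beta>s @ [Blinfun (fd (\<lambda>y. \<Lambda> y (\<gamma>s @ [\<alpha> x])) x)]) =
        \<Lambda> x (\<gamma>s @ [Blinfun (fd (\<lambda>y. \<Lambda> y (\<beta>s @ [\<alpha> x])) x)])"
      using FI[of \<beta>s "\<gamma>s @ [\<alpha> x]"] True by simp
    then show ?thesis unfolding app[symmetric] Blinfun_fd key by simp
  next
    case False
    have "ham \<Lambda> \<delta>s x = 0" if "length \<delta>s \<noteq> n" for \<delta>s
      using alt_multilinear_length[OF alt[OF x]] that by (simp add: ham_def vec_eq_iff)
    moreover have "fd_field \<alpha> x 0 w = 0" "fd_field \<alpha> x v 0 = 0" for v w
      using linear_0[OF smooth_on_linear_fd[OF \<alpha> x]] by (simp_all add: fd_field_def)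
    ultimately show ?thesis using False by auto
  qed
qed

text \<open>Symmetry on pairs of Hamiltonian vectors extends to their span by bilinearity, one
  argument at a time. With \<open>\<beta>s\<close> fixed, \<open>tang\<close> places the remaining
  bivector in the exterior square of that span.\<close>

lemma d_kernel_contract_eq_0:
  fixes \<Lambda> :: "real ^ 'm::finite \<Rightarrow> 'm covector list \<Rightarrow> real" and \<alpha> :: "real ^ 'm \<Rightarrow> 'm covector"
  assumes sym: "\<And>\<beta>s \<gamma>s. fd_field \<alpha> x (ham \<Lambda> \<beta>s x) (ham \<Lambda> \<gamma>s x) = fd_field \<alpha> x (ham \<Lambda> \<gamma>s x) (ham \<Lambda> \<beta>s x)"
    and x: "x \<in> S" and \<alpha>: "\<And>l. smooth_on (\<lambda>y. blinfun_apply (\<alpha> y) (axis l 1)) S"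
    and P: "alt_multilinear k P"
    and tang: "\<And>\<beta> \<beta>s. (\<And>\<gamma>s. blinfun_apply \<beta> (ham \<Lambda> \<gamma>s x) = 0) \<Longrightarrow> P (\<beta> # \<beta>s) = 0"
  shows "(\<Sum>i\<in>UNIV. \<Sum>l\<in>UNIV. fd (\<lambda>y. blinfun_apply (\<alpha> y) (axis l 1)) x (axis i 1) *
       P (dcoord i # dcoord l # \<beta>s)) = 0"
proof -
  let ?D = "span (range (\<lambda>\<gamma>s. ham \<Lambda> \<gamma>s x))"
  note lin = smooth_on_linear_fd[OF \<alpha> x]
  have B1: "linear (\<lambda>v. fd_field \<alpha> x v w)" for w
    by (rule linearI) (simp_all add: fd_field_def linear_add[OF lin] linear_scale[OF lin] distrib_left
        sum.distrib sum_distrib_left mult.left_commute)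
  have B2: "linear (\<lambda>w. fd_field \<alpha> x v w)" for v
    by (rule linearI) (simp_all add: fd_field_def distrib_right sum.distrib sum_distrib_left mult.assoc)
  have sub: "subspace {v. fd_field \<alpha> x v w = fd_field \<alpha> x w v}" for w
    by (auto simp: subspace_def linear_add[OF B1] linear_add[OF B2] linear_scale[OF B1] linear_scale[OF B2]
        linear_0[OF B1] linear_0[OF B2])
  have 1: "fd_field \<alpha> x v (ham \<Lambda> \<gamma>s x) = fd_field \<alpha> x (ham \<Lambda> \<gamma>s x) v" if "v \<in> ?D" for v \<gamma>s
    using span_minimal[OF _ sub[of "ham \<Lambda> \<gamma>s x"], of "range (\<lambda>\<gamma>s. ham \<Lambda> \<gamma>s x)"] sym that by auto
  have 2: "fd_field \<alpha> x v w = fd_field \<alpha> x w v" if "v \<in> ?D" "w \<in> ?D" for v w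
    using span_minimal[OF _ sub[of w], of "range (\<lambda>\<gamma>s. ham \<Lambda> \<gamma>s x)"] 1[OF that(2), symmetric] that(1) by auto
  have "(\<Sum>i\<in>UNIV. \<Sum>l\<in>UNIV. fd_field \<alpha> x (axis i 1) (axis l 1) * P (dcoord i # dcoord l # \<beta>s)) = 0"
  proof (rule sum_symmetric_alternating_eq_0[where D = ?D, OF _ _ B1 B2 subspace_span 2])
    show "linear (\<lambda>\<beta>. P (\<beta> # \<gamma> # \<beta>s))" for \<gamma> by (rule alt_multilinear_linear_Cons[OF P])
    show "P (\<beta> # \<gamma> # \<beta>s) = - P (\<gamma> # \<beta> # \<beta>s)" for \<beta> \<gamma>
      using alt_multilinear_swap[OF P, of "[]" \<beta> \<gamma> \<beta>s] by simp
    show "P (\<beta> # \<gamma> # \<beta>s) = 0" if "\<And>v. v \<in> ?D \<Longrightarrow> blinfun_apply \<beta> v = 0" for \<beta> \<gamma>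
      by (rule tang) (auto intro: that span_base)
  qed
  moreover have "fd_field \<alpha> x v (axis l 1) = fd (\<lambda>y. blinfun_apply (\<alpha> y) (axis l 1)) x v" for v l
    by (simp add: fd_field_def axis_def if_distrib[of "\<lambda>c. c * _"] cong: if_cong)
  ultimately show ?thesis by simp
qed

section \<open>Charts\<close>

definition overlap :: "('a, 'm::finite) chart \<Rightarrow> ('a, 'm) chart \<Rightarrow> (real ^ 'm) set" where
  "overlap c c' = snd c ` (fst c \<inter> fst c')"

locale manifold =
  fixes X :: "'a topology" and A :: "('a, 'm::finite) chart set"
  assumes manifold: "smooth_manifold X A"
begin

lemma openin_chart: "c \<in> A \<Longrightarrow> openin X (fst c)"
  and open_chart_image: "c \<in> A \<Longrightarrow> open (chart_image c)"
  and homeo: "c \<in> A \<Longrightarrow> homeomorphic_map (subtopology X (fst c)) (top_of_set (chart_image c)) (snd c)"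
  using manifold by (auto simp: smooth_manifold_def is_chart_def)

lemma topspace_chart: "c \<in> A \<Longrightarrow> topspace (subtopology X (fst c)) = fst c"
  using openin_subset[OF openin_chart[of c]] by (simp add: Int_absorb1)

lemma inj_on_chart: "c \<in> A \<Longrightarrow> inj_on (snd c) (fst c)"
  using homeomorphic_imp_injective_map[OF homeo] by (simp add: topspace_chart del: topspace_subtopology)

lemma chart_inv_chart [simp]: "c \<in> A \<Longrightarrow> p \<in> fst c \<Longrightarrow> chart_inv c (snd c p) = p"
  by (simp add: chart_inv_def inj_on_chart)

lemma chart_inv_in: "x \<in> chart_image c \<Longrightarrow> chart_inv c x \<in> fst c"
  unfolding chart_image_def chart_inv_def by (rule inv_into_into)

lemma chart_chart_inv: "x \<in> chart_image c \<Longrightarrow> snd c (chart_inv c x) = x"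
  unfolding chart_image_def chart_inv_def by (rule f_inv_into_f)

lemma chart_in_image: "p \<in> fst c \<Longrightarrow> snd c p \<in> chart_image c"
  by (simp add: chart_image_def)

lemma open_chart_image_of:
  assumes "c \<in> A" "openin X V" "V \<subseteq> fst c"
  shows "open (snd c ` V)"
proof -
  have "openin (subtopology X (fst c)) V"
    using assms by (auto simp: openin_subtopology)
  then have "openin (top_of_set (chart_image c)) (snd c ` V)"
    using homeomorphic_imp_open_map[OF homeo[OF assms(1)]] by (simp add: open_map_def)
  then show ?thesis using open_chart_image[OF assms(1)] openin_open_trans by blast
qed

lemma open_overlap: "c \<in> A \<Longrightarrow> c' \<in> A \<Longrightarrow> open (overlap c c')"
  unfolding overlap_def by (intro open_chart_image_of openin_Int openin_chart) auto

lemma overlap_subset: "overlap c c' \<subseteq> chart_image c"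
  by (auto simp: overlap_def chart_image_def)

lemma in_overlap_iff:
  "c \<in> A \<Longrightarrow> x \<in> chart_image c \<Longrightarrow> x \<in> overlap c c' \<longleftrightarrow> chart_inv c x \<in> fst c'"
  using chart_inv_in[of x c] chart_chart_inv[of x c] by (force simp: overlap_def)

lemma transition_chart [simp]: "c \<in> A \<Longrightarrow> p \<in> fst c \<Longrightarrow> transition c c' (snd c p) = snd c' p"
  by (simp add: transition_def)

lemma transition_image: "c \<in> A \<Longrightarrow> transition c c' ` overlap c c' \<subseteq> overlap c' c"
  by (auto simp: overlap_def)

lemma smooth_transition: "c \<in> A \<Longrightarrow> c' \<in> A \<Longrightarrow> smooth_on (transition c c') (overlap c c')"
  using manifold by (auto simp: smooth_manifold_def overlap_def)

lemma transition_deriv_apply: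
  assumes "c \<in> A" "c' \<in> A" "p \<in> fst c" "p \<in> fst c'"
  shows "blinfun_apply (transition_deriv c c' p) = fd (transition c c') (snd c p)"
  unfolding transition_deriv_def
  by (intro bounded_linear_Blinfun_apply smooth_on_bounded_linear_fd[OF smooth_transition])
    (use assms in \<open>auto simp: overlap_def\<close>)

lemma transition_has_derivative:
  assumes "c \<in> A" "c' \<in> A" "p \<in> fst c" "p \<in> fst c'"
  shows "(transition c c' has_derivative blinfun_apply (transition_deriv c c' p)) (at (snd c p))"
  unfolding transition_deriv_apply[OF assms]
  by (intro smooth_on_has_derivative[OF smooth_transition]) (use assms in \<open>auto simp: overlap_def\<close>)

lemma transition_deriv_cocycle:
  assumes c: "c \<in> A" "c' \<in> A" "d \<in> A" and p: "p \<in> fst c" "p \<in> fst c'" "p \<in> fst d"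
  shows "transition_deriv c' d p o\<^sub>L transition_deriv c c' p = transition_deriv c d p"
proof (rule blinfun_eqI)
  fix v
  let ?S = "snd c ` (fst c \<inter> fst c' \<inter> fst d)"
  have S: "open ?S" by (intro open_chart_image_of openin_Int openin_chart c) auto
  have "((\<lambda>y. transition c' d (transition c c' y)) has_derivative
      (\<lambda>v. blinfun_apply (transition_deriv c' d p) (blinfun_apply (transition_deriv c c' p) v))) (at (snd c p))"
    using has_derivative_compose[OF transition_has_derivative[OF c(1,2) p(1,2)], of "transition c' d"]
      transition_has_derivative[OF c(2,3) p(2,3)] c(1) p(1) by simp
  note fd_eq[OF this]
  moreover have "fd (\<lambda>y. transition c' d (transition c c' y)) (snd c p) = fd (transition c d) (snd c p)"
    by (rule fd_cong[OF S]) (use c p in auto)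
  ultimately have "fd (transition c d) (snd c p) v =
      blinfun_apply (transition_deriv c' d p) (blinfun_apply (transition_deriv c c' p) v)" by simp
  then show "blinfun_apply (transition_deriv c' d p o\<^sub>L transition_deriv c c' p) v =
      blinfun_apply (transition_deriv c d p) v"
    by (simp add: transition_deriv_apply[OF c(1,3) p(1,3)])
qed

lemma transition_deriv_refl:
  assumes "c \<in> A" "p \<in> fst c"
  shows "transition_deriv c c p = id_blinfun"
proof (rule blinfun_eqI)
  fix v
  have "fd (transition c c) (snd c p) = fd (\<lambda>x. x) (snd c p)"
    by (rule fd_cong[OF open_chart_image[OF assms(1)] chart_in_image[OF assms(2)]])
      (simp add: transition_def chart_chart_inv)
  then show "blinfun_apply (transition_deriv c c p) v = blinfun_apply id_blinfun v"
    using fd_eq[OF has_derivative_ident, of "snd c p"] by (simp add: transition_deriv_apply assms)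
qed

lemma transition_deriv_inverse:
  assumes "c \<in> A" "c' \<in> A" "p \<in> fst c" "p \<in> fst c'"
  shows "transition_deriv c' c p o\<^sub>L transition_deriv c c' p = id_blinfun"
  using transition_deriv_cocycle[of c c' c p] transition_deriv_refl assms by simp

subsection \<open>Extension by zero\<close>

lemma continuous_map_chart_inv:
  assumes "c \<in> A"
  shows "continuous_map (top_of_set (chart_image c)) X (chart_inv c)"
proof -
  obtain g where "homeomorphic_maps (subtopology X (fst c)) (top_of_set (chart_image c)) (snd c) g"
    using homeo[OF assms] by (auto simp: homeomorphic_map_maps)
  then have g: "continuous_map (top_of_set (chart_image c)) (subtopology X (fst c)) g"
    "\<And>y. y \<in> chart_image c \<Longrightarrow> snd c (g y) = y" "\<And>y. y \<in> chart_image c \<Longrightarrow> g y \<in> fst c"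
    by (auto simp: homeomorphic_maps_def continuous_map_def)
  have "continuous_map (top_of_set (chart_image c)) X g"
    using g(1) by (simp add: continuous_map_in_subtopology)
  then show ?thesis
  proof (rule continuous_map_eq)
    fix y assume "y \<in> topspace (top_of_set (chart_image c))"
    then have y: "y \<in> chart_image c" by simp
    show "g y = chart_inv c y"
      using chart_inv_chart[OF assms g(3)[OF y]] g(2)[OF y] by simp
  qed
qed

text \<open>The point of \<open>X\<close> belonging to \<open>K\<close> form a compact and,
  \<open>X\<close> being Hausdorff, closed set. A point of the chart \<open>c'\<close> outside the
  domain of \<open>c\<close> thus has a neighbourhood avoiding it, where the function is 0.\<close>

lemma smooth_extend_by_zero:
  assumes c: "c \<in> A" "c' \<in> A" and K: "compact K" "K \<subseteq> chart_image c"
    and g: "smooth_on g (overlap c' c)"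
    and zero: "\<And>y. y \<in> chart_image c' \<Longrightarrow> \<not> (y \<in> overlap c' c \<and> transition c' c y \<in> K) \<Longrightarrow> g y = 0"
  shows "smooth_on g (chart_image c')"
proof (rule smooth_on_local)
  fix x assume x: "x \<in> chart_image c'"
  show "\<exists>U. open U \<and> x \<in> U \<and> smooth_on g U"
  proof (cases "x \<in> overlap c' c")
    case True
    then show ?thesis using g open_overlap[OF c(2,1)] by blast
  next
    case False
    let ?C = "chart_inv c ` K"
    have "compactin (top_of_set (chart_image c)) K"
      using K by (simp add: compactin_subtopology)
    then have "compactin X ?C" by (rule image_compactin[OF _ continuous_map_chart_inv[OF c(1)]])
    then have C: "closedin X ?C"
      using compactin_imp_closedin manifold by (auto simp: smooth_manifold_def)
    let ?U = "snd c' ` (fst c' - ?C)"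
    have U: "open ?U"
      by (intro open_chart_image_of[OF c(2)] openin_diff openin_chart c(2) C) auto
    have "chart_inv c' x \<notin> fst c" using False in_overlap_iff[OF c(2) x] by simp
    then have "chart_inv c' x \<notin> ?C" using chart_inv_in K(2) by fastforce
    then have "x \<in> ?U" using chart_inv_in[OF x] chart_chart_inv[OF x] by (intro image_eqI[of _ _ "chart_inv c' x"]) auto
    moreover have "g y = 0" if "y \<in> ?U" for y
    proof (rule zero)
      from that obtain q where q: "q \<in> fst c'" "q \<notin> ?C" "y = snd c' q" by auto
      then show "y \<in> chart_image c'" by (simp add: chart_in_image)
      show "\<not> (y \<in> overlap c' c \<and> transition c' c y \<in> K)"
      proof
        assume a: "y \<in> overlap c' c \<and> transition c' c y \<in> K"
        then have "q \<in> fst c" using in_overlap_iff[OF c(2) chart_in_image[OF q(1)], of c] q c by simp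
        then have "q = chart_inv c (transition c' c y)" using q c by simp
        moreover have "transition c' c y \<in> K" using a by blast
        ultimately show False using q(2) by blast
      qed
    qed
    then have "smooth_on g ?U"
      by (intro smooth_on_cong[OF smooth_on_const[of 0] U]) simp
    ultimately show ?thesis using U by blast
  qed
qed

definition cut :: "('a, 'm) chart \<Rightarrow> (real ^ 'm \<Rightarrow> real) \<Rightarrow> 'a \<Rightarrow> real" where
  "cut c F p = (if p \<in> fst c then F (snd c p) else 0)"

lemma cut_smooth:
  assumes c: "c \<in> A" and K: "compact K" "K \<subseteq> chart_image c" and F: "smooth_on F (chart_image c)"
    and zero: "\<And>x. x \<in> chart_image c \<Longrightarrow> x \<notin> K \<Longrightarrow> F x = 0"
  shows "cut c F \<in> smooth_functions A"
  unfolding smooth_functions_def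
proof (intro CollectI ballI)
  fix c' assume c': "c' \<in> A"
  have eq: "cut c F (chart_inv c' y) = F (transition c' c y)" if "y \<in> overlap c' c" for y
    using that c' by (auto simp: cut_def overlap_def)
  show "smooth_on (cut c F \<circ> chart_inv c') (chart_image c')"
  proof (rule smooth_extend_by_zero[OF c c' K])
    have "smooth_on (\<lambda>y. F (transition c' c y)) (overlap c' c)"
      using transition_image[OF c', of c] overlap_subset[of c c']
      by (intro smooth_on_compose[OF open_overlap[OF c' c] open_chart_image[OF c] _ smooth_transition[OF c' c] F]) auto
    then show "smooth_on (cut c F \<circ> chart_inv c') (overlap c' c)"
      by (rule smooth_on_cong[OF _ open_overlap[OF c' c]]) (simp add: eq)
  next
    fix y assume y: "y \<in> chart_image c'" "\<not> (y \<in> overlap c' c \<and> transition c' c y \<in> K)"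
    show "(cut c F \<circ> chart_inv c') y = 0"
    proof (cases "y \<in> overlap c' c")
      case True
      then have "transition c' c y \<in> chart_image c"
        using transition_image[OF c', of c] overlap_subset[of c c'] by blast
      then show ?thesis using eq[OF True] zero y True by simp
    next
      case False
      then show ?thesis using in_overlap_iff[OF c' y(1)] by (simp add: cut_def)
    qed
  qed
qed

text \<open>The form is \<theta> times a cutoff function, pulled back to the other charts. By the
  last conclusion each of its values is zero or a multiple of a pulled-back value of \<theta>, so it
  inherits linear conditions at points, such as being annihilated by #_1.\<close>

lemma form_extension:
  fixes \<theta> :: "real ^ 'm \<Rightarrow> 'm covector"
  assumes c: "c \<in> A" and U: "open U" "U \<subseteq> chart_image c" and p: "p \<in> U"
    and \<theta>: "\<And>l. smooth_on (\<lambda>x. blinfun_apply (\<theta> x) (axis l 1)) U"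
  obtains \<alpha> where "\<alpha> \<in> forms A 1" "\<And>v. \<alpha> c p [v] = blinfun_apply (\<theta> p) v"
    "\<And>c' q. c' \<in> A \<Longrightarrow> q \<in> fst c' \<Longrightarrow> (\<forall>v. \<alpha> c' (snd c' q) [v] = 0) \<or>
      (q \<in> fst c \<and> snd c q \<in> U \<and>
        (\<exists>s. \<forall>v. \<alpha> c' (snd c' q) [v] = s * blinfun_apply (\<theta> (snd c q)) (blinfun_apply (transition_deriv c' c q) v)))"
proof -
  obtain r where r: "r > 0" "cball p r \<subseteq> U" using U(1) p open_contains_cball by blast
  obtain \<psi> :: "real ^ 'm \<Rightarrow> real" where \<psi>: "smooth_on \<psi> UNIV"
    "\<And>x. x \<in> ball p (r / 2) \<Longrightarrow> \<psi> x = 1" "\<And>x. x \<notin> cball p r \<Longrightarrow> \<psi> x = 0"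
    using exists_cutoff[OF r(1), of p] by blast
  define \<alpha> :: "('a, 'm) form" where "\<alpha> c' x vs =
    (if c' \<in> A \<and> x \<in> overlap c' c \<and> length vs = 1 \<and> snd c (chart_inv c' x) \<in> U
     then \<psi> (snd c (chart_inv c' x)) * blinfun_apply (\<theta> (snd c (chart_inv c' x)))
       (blinfun_apply (transition_deriv c' c (chart_inv c' x)) (hd vs)) else 0)" for c' x vs
  have \<alpha>_at: "\<alpha> c' (snd c' q) [v] = (if q \<in> fst c \<and> snd c q \<in> U
      then \<psi> (snd c q) * blinfun_apply (\<theta> (snd c q)) (blinfun_apply (transition_deriv c' c q) v) else 0)"
    if "c' \<in> A" "q \<in> fst c'" for c' q v
    using that in_overlap_iff[OF that(1) chart_in_image[OF that(2)], of c] by (simp add: \<alpha>_def)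
  have alt: "alt_multilinear 1 (\<alpha> c' x)" for c' x
  proof -
    have "linear (\<lambda>v. \<alpha> c' x (vs[i := v]))" if "length vs = 1" "i < 1" for vs i
    proof -
      obtain u where "vs = [u]" using \<open>length vs = 1\<close> by (cases vs) auto
      moreover have "linear (\<lambda>v. \<alpha> c' x [v])"
        by (rule linearI) (auto simp: \<alpha>_def blinfun.add_right blinfun.scaleR_right algebra_simps)
      ultimately show ?thesis using \<open>i < 1\<close> by simp
    qed
    then show ?thesis by (simp add: alt_multilinear_def) (simp add: \<alpha>_def)
  qed
  have smooth: "smooth_on (\<lambda>x. \<alpha> c' x vs) (chart_image c')" if c': "c' \<in> A" for c' vs
  proof (cases "\<exists>v. vs = [v]")
    case False
    then have "(\<lambda>x. \<alpha> c' x vs) = (\<lambda>x. 0)" by (auto simp: \<alpha>_def fun_eq_iff length_Suc_conv)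
    then show ?thesis by (simp add: smooth_on_const)
  next
    case True
    then obtain v where v: "vs = [v]" by blast
    \<comment> \<open>The components of the cut-off field, extended by zero to the whole coordinate
      space. They are smooth on \<open>U\<close> and on the complement of the closed ball, and these
      two open sets cover the space.\<close>
    define \<Theta> where "\<Theta> l y = (if y \<in> U then \<psi> y * blinfun_apply (\<theta> y) (axis l 1) else 0)" for l y
    have \<Theta>: "smooth_on (\<Theta> l) UNIV" for l
    proof (rule smooth_on_local)
      fix y :: "real ^ 'm"
      show "\<exists>V. open V \<and> y \<in> V \<and> smooth_on (\<Theta> l) V"
      proof (cases "y \<in> U")
        case True
        have "smooth_on (\<lambda>y. \<psi> y * blinfun_apply (\<theta> y) (axis l 1)) U"
          by (intro smooth_on_mult U(1) \<theta> smooth_on_subset[OF \<psi>(1)]) simp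
        then have "smooth_on (\<Theta> l) U" by (rule smooth_on_cong[OF _ U(1)]) (simp add: \<Theta>_def)
        then show ?thesis using True U(1) by blast
      next
        case False
        have "smooth_on (\<Theta> l) (- cball p r)"
          by (rule smooth_on_cong[OF smooth_on_const[of 0]]) (auto simp: \<Theta>_def \<psi>(3) open_Compl)
        then show ?thesis using False r(2) by (intro exI[of _ "- cball p r"]) (auto simp: open_Compl)
      qed
    qed
    have eq: "\<alpha> c' y vs = (\<Sum>l\<in>UNIV. \<Theta> l (transition c' c y) * fd (transition c' c) y v $ l)"
      if "y \<in> overlap c' c" for y
    proof -
      from that obtain q where q: "q \<in> fst c'" "q \<in> fst c" "y = snd c' q" by (auto simp: overlap_def)
      have "blinfun_apply (\<theta> z) w = (\<Sum>l\<in>UNIV. w $ l * blinfun_apply (\<theta> z) (axis l 1))" for z w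
        using linear_expand_vec[OF linear_blinfun_apply, of "\<theta> z" w] by simp
      note e = this[of "snd c q" "blinfun_apply (transition_deriv c' c q) v"]
      show ?thesis
        unfolding v q(3) \<alpha>_at[OF c' q(1)] e
        using q c' by (simp add: \<Theta>_def transition_deriv_apply[OF c' c q(1,2)] sum_distrib_left algebra_simps)
    qed
    show ?thesis
    proof (rule smooth_extend_by_zero[OF c c' compact_cball])
      show "cball p r \<subseteq> chart_image c" using r(2) U(2) by blast
      have "smooth_on (\<lambda>y. \<Sum>l\<in>UNIV. \<Theta> l (transition c' c y) * fd (transition c' c) y v $ l) (overlap c' c)"
        by (intro smooth_on_sum smooth_on_mult open_overlap[OF c' c]
            smooth_on_compose[OF open_overlap[OF c' c] open_UNIV subset_UNIV smooth_transition[OF c' c] \<Theta>]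
            smooth_on_bounded_linear_compose[OF open_overlap[OF c' c] bounded_linear_vec_nth]
            smooth_on_fd smooth_transition[OF c' c])
      then show "smooth_on (\<lambda>x. \<alpha> c' x vs) (overlap c' c)"
        by (rule smooth_on_cong[OF _ open_overlap[OF c' c]]) (simp add: eq)
    next
      fix y assume y: "y \<in> chart_image c'" "\<not> (y \<in> overlap c' c \<and> transition c' c y \<in> cball p r)"
      then show "\<alpha> c' y vs = 0"
        using \<psi>(3)[of "transition c' c y"] by (auto simp: \<alpha>_def transition_def)
    qed
  qed
  have "\<alpha> \<in> forms A 1"
    unfolding forms_def local_fields_def
  proof (intro CollectI conjI allI impI ballI)
    show "\<alpha> c' x = (\<lambda>_. 0)" if "c' \<notin> A \<or> x \<notin> chart_image c'" for c' x
      using that overlap_subset[of c' c] by (auto simp: \<alpha>_def fun_eq_iff)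
    show "alt_multilinear 1 (\<alpha> c' x)" for c' x by (rule alt)
    show "smooth_on (\<lambda>x. \<alpha> c' x vs) (chart_image c')" if "c' \<in> A" for c' vs by (rule smooth[OF that])
    fix c1 c2 q vs assume c12: "c1 \<in> A" "c2 \<in> A" and q: "q \<in> fst c1 \<inter> fst c2"
    show "\<alpha> c1 (snd c1 q) vs = \<alpha> c2 (snd c2 q) (map (blinfun_apply (transition_deriv c1 c2 q)) vs)"
    proof (cases "\<exists>v. vs = [v]")
      case False
      then show ?thesis
        using alt_multilinear_length[OF alt] by (metis One_nat_def length_0_conv length_Suc_conv length_map)
    next
      case True
      then obtain v where v: "vs = [v]" by blast
      have "blinfun_apply (transition_deriv c2 c q) (blinfun_apply (transition_deriv c1 c2 q) v) =
          blinfun_apply (transition_deriv c1 c q) v" if "q \<in> fst c"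
        using transition_deriv_cocycle[OF c12 c, of q] q that
        by (metis IntD1 IntD2 blinfun_apply_blinfun_compose)
      then show ?thesis using c12 q by (simp add: v \<alpha>_at)
    qed
  qed
  moreover have "\<alpha> c p [v] = blinfun_apply (\<theta> p) v" for v
  proof -
    have pc: "p \<in> chart_image c" using p U(2) by blast
    show ?thesis
      using \<alpha>_at[OF c chart_inv_in[OF pc], of v] p r(1) \<psi>(2)[of p]
      by (simp add: chart_chart_inv[OF pc] chart_inv_in[OF pc] transition_deriv_refl[OF c])
  qed
  moreover have "(\<forall>v. \<alpha> c' (snd c' q) [v] = 0) \<or>
      (q \<in> fst c \<and> snd c q \<in> U \<and>
        (\<exists>s. \<forall>v. \<alpha> c' (snd c' q) [v] = s * blinfun_apply (\<theta> (snd c q)) (blinfun_apply (transition_deriv c' c q) v)))"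
    if "c' \<in> A" "q \<in> fst c'" for c' q
    using \<alpha>_at[OF that] by auto
  ultimately show thesis by (rule that)
qed

end

section \<open>Fields on the manifold\<close>

lemma blinfun_compose_assoc: "(f o\<^sub>L g) o\<^sub>L h = f o\<^sub>L (g o\<^sub>L h)"
  by (rule blinfun_eqI) simp

lemma blinfun_compose_id_right: "f o\<^sub>L id_blinfun = f"
  by (rule blinfun_eqI) simp

context manifold
begin

lemma smooth_family_local_field:
  "T \<in> local_fields A k \<Longrightarrow> c \<in> A \<Longrightarrow> smooth_family (chart_image c) k (T c)"
  by (auto simp: local_fields_def smooth_family_def open_chart_image)

lemma contract1_eq_0_D:
  assumes "contract1 \<alpha> P = (\<lambda>c x \<beta>s. 0)"
  shows "P c y (covector_of \<alpha> c y # \<beta>s) = 0"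
proof -
  have "contract1 \<alpha> P c y \<beta>s = 0" using assms by simp
  then show ?thesis by (simp add: contract1_def)
qed

lemma local_field_outside:
  assumes "T \<in> local_fields A k" "c \<notin> A \<or> x \<notin> chart_image c"
  shows "T c x vs = 0"
proof -
  have "T c x = (\<lambda>_. 0)" using assms unfolding local_fields_def by blast
  then show ?thesis by simp
qed

lemma mvfields_local: "P \<in> mvfields A k \<Longrightarrow> P \<in> local_fields A k"
  and forms_local: "\<omega> \<in> forms A k \<Longrightarrow> \<omega> \<in> local_fields A k"
  by (auto simp: mvfields_def forms_def)

lemma mvfields_change:
  "P \<in> mvfields A k \<Longrightarrow> c \<in> A \<Longrightarrow> c' \<in> A \<Longrightarrow> p \<in> fst c \<Longrightarrow> p \<in> fst c' \<Longrightarrow>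
    P c' (snd c' p) \<alpha>s = P c (snd c p) (map (\<lambda>\<alpha>. \<alpha> o\<^sub>L transition_deriv c c' p) \<alpha>s)"
  unfolding mvfields_def by blast

lemma forms_change:
  "\<omega> \<in> forms A k \<Longrightarrow> c \<in> A \<Longrightarrow> c' \<in> A \<Longrightarrow> p \<in> fst c \<Longrightarrow> p \<in> fst c' \<Longrightarrow>
    \<omega> c (snd c p) vs = \<omega> c' (snd c' p) (map (blinfun_apply (transition_deriv c c' p)) vs)"
  unfolding forms_def by blast

lemma covector_of_apply:
  assumes "\<alpha> \<in> forms A 1" "c \<in> A" "x \<in> chart_image c"
  shows "blinfun_apply (covector_of \<alpha> c x) v = \<alpha> c x [v]"
proof -
  have "linear (\<lambda>v. \<alpha> c x [v])"
    using alt_multilinear_linear_Cons[OF smooth_family_D(2)[OF smooth_family_local_field[OF forms_local]]] assms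
    by blast
  then show ?thesis
    unfolding covector_of_def by (subst bounded_linear_Blinfun_apply) (simp_all add: linear_conv_bounded_linear)
qed

subsection \<open>The fundamental identity in a chart\<close>

lemma differential_at_apply:
  assumes "(f \<circ> chart_inv c) differentiable (at (snd c p))"
  shows "blinfun_apply (differential_at f c p) = fd (f \<circ> chart_inv c) (snd c p)"
  unfolding differential_at_def
  by (rule bounded_linear_Blinfun_apply[OF has_derivative_bounded_linear[OF has_derivative_fd[OF assms]]])

lemma differential_at_change:
  assumes c: "c \<in> A" "c' \<in> A" and p: "p \<in> fst c" "p \<in> fst c'"
    and f: "(f \<circ> chart_inv c) differentiable (at (snd c p))"
  shows "differential_at f c' p = differential_at f c p o\<^sub>L transition_deriv c' c p"
proof -
  let ?g = "\<lambda>y. (f \<circ> chart_inv c) (transition c' c y)"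
  have "(?g has_derivative (\<lambda>v. blinfun_apply (differential_at f c p) (blinfun_apply (transition_deriv c' c p) v))) (at (snd c' p))"
    using has_derivative_compose[OF transition_has_derivative[OF c(2,1) p(2,1)], of "f \<circ> chart_inv c"]
      has_derivative_fd[OF f] c(2) p(2) by (simp add: differential_at_apply[OF f])
  moreover have "?g y = (f \<circ> chart_inv c') y" if "y \<in> overlap c' c" for y
    using that c by (auto simp: overlap_def)
  ultimately have "((f \<circ> chart_inv c') has_derivative
      (\<lambda>v. blinfun_apply (differential_at f c p) (blinfun_apply (transition_deriv c' c p) v))) (at (snd c' p))"
    using has_derivative_cong_open[OF open_overlap[OF c(2,1)], of "snd c' p" ?g "f \<circ> chart_inv c'"] p
    by (auto simp: overlap_def)
  then show ?thesis
    by (intro blinfun_eqI) (simp add: differential_at_apply differentiableI fd_eq)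
qed

text \<open>The transformation rules of \<Lambda> and of differentials cancel. Only
  differentiability at the point is assumed because the functions may themselves be brackets, which
  are studied only near the point.\<close>

lemma bracket_eq:
  assumes \<Lambda>: "\<Lambda> \<in> mvfields A n" and c: "c \<in> A" "p \<in> fst c"
    and f: "\<And>f. f \<in> set fs \<Longrightarrow> (f \<circ> chart_inv c) differentiable (at (snd c p))"
  shows "bracket A \<Lambda> fs p = \<Lambda> c (snd c p) (map (\<lambda>f. differential_at f c p) fs)"
proof -
  define c' where "c' = (SOME c. c \<in> A \<and> p \<in> fst c)"
  have c': "c' \<in> A" "p \<in> fst c'"
    unfolding c'_def using someI[of "\<lambda>c. c \<in> A \<and> p \<in> fst c" c] c by auto
  have "differential_at f c' p o\<^sub>L transition_deriv c c' p = differential_at f c p" if "f \<in> set fs" for f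
    using differential_at_change[OF c(1) c'(1) c(2) c'(2) f[OF that]]
      transition_deriv_inverse[OF c(1) c'(1) c(2) c'(2)]
    by (simp add: blinfun_compose_assoc blinfun_compose_id_right)
  then have "map (\<lambda>\<alpha>. \<alpha> o\<^sub>L transition_deriv c c' p) (map (\<lambda>f. differential_at f c' p) fs) =
      map (\<lambda>f. differential_at f c p) fs"
    by simp
  then show ?thesis
    unfolding bracket_def Let_def c'_def[symmetric] mvfields_change[OF \<Lambda> c(1) c'(1) c(2) c'(2)]
    by (simp only:)
qed

lemma fundamental_identity_chart:
  assumes NP: "nambu_poisson_tensor A (Suc n) \<Lambda>" and c: "c \<in> A" and x: "x \<in> chart_image c"
    and len: "length \<beta>s = n" "length \<gamma>s = Suc n"
  shows "\<Lambda> c x (\<beta>s @ [Blinfun (fd (\<lambda>y. \<Lambda> c y \<gamma>s) x)]) =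
    (\<Sum>i<Suc n. \<Lambda> c x (\<gamma>s[i := Blinfun (fd (\<lambda>y. \<Lambda> c y (\<beta>s @ [\<gamma>s ! i])) x)]))"
proof -
  have \<Lambda>: "\<Lambda> \<in> mvfields A (Suc n)" using NP by (simp add: nambu_poisson_tensor_def)
  note fam = smooth_family_local_field[OF mvfields_local[OF \<Lambda>] c]
  define p where "p = chart_inv c x"
  have p: "p \<in> fst c" "snd c p = x" using x by (simp_all add: p_def chart_inv_in chart_chart_inv)
  obtain r where r: "r > 0" "cball x r \<subseteq> chart_image c"
    using open_chart_image[OF c] x open_contains_cball by blast
  obtain \<psi> :: "real ^ 'm \<Rightarrow> real" where \<psi>: "smooth_on \<psi> UNIV"
    "\<And>y. y \<in> ball x (r / 2) \<Longrightarrow> \<psi> y = 1" "\<And>y. y \<notin> cball x r \<Longrightarrow> \<psi> y = 0"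
    using exists_cutoff[OF r(1), of x] by blast
  define V where "V = ball x (r / 2)"
  have V: "open V" "x \<in> V" "V \<subseteq> chart_image c" using r by (auto simp: V_def)
  \<comment> \<open>A global function that equals the linear function \<beta> of the coordinates
    near \<open>x\<close>, so its differential is constantly \<beta> there. Brackets of such
    functions are the components of \<Lambda>, and a second bracket differentiates these
    components.\<close>
  define f where "f \<beta> = cut c (\<lambda>y. \<psi> y * blinfun_apply \<beta> y)" for \<beta>
  have f_smooth: "f \<beta> \<in> smooth_functions A" for \<beta>
    unfolding f_def
  proof (rule cut_smooth[OF c compact_cball r(2)])
    show "smooth_on (\<lambda>y. \<psi> y * blinfun_apply \<beta> y) (chart_image c)"
      by (intro smooth_on_mult open_chart_image c smooth_on_subset[OF \<psi>(1) subset_UNIV]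
          smooth_on_bounded_linear[OF blinfun.bounded_linear_right])
  qed (simp add: \<psi>(3))
  have f_deriv: "((f \<beta> \<circ> chart_inv c) has_derivative blinfun_apply \<beta>) (at y)" if "y \<in> V" for \<beta> y
  proof (subst has_derivative_cong_open[OF V(1) that])
    show "(blinfun_apply \<beta> has_derivative blinfun_apply \<beta>) (at y)"
      by (rule bounded_linear_imp_has_derivative[OF blinfun.bounded_linear_right])
    show "(f \<beta> \<circ> chart_inv c) z = blinfun_apply \<beta> z" if "z \<in> V" for z
      using that V(3) \<psi>(2)[of z] by (auto simp: f_def cut_def V_def chart_inv_in chart_chart_inv)
  qed
  have br: "bracket A \<Lambda> (map f \<gamma>s) (chart_inv c y) = \<Lambda> c y \<gamma>s" if "y \<in> V" for y \<gamma>s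
  proof -
    have y: "chart_inv c y \<in> fst c" "snd c (chart_inv c y) = y"
      using that V(3) by (auto intro: chart_inv_in chart_chart_inv)
    have "(f \<beta> \<circ> chart_inv c) differentiable (at (snd c (chart_inv c y)))" for \<beta>
      using f_deriv[OF that] by (auto simp: y intro: differentiableI)
    moreover from this have "differential_at (f \<beta>) c (chart_inv c y) = \<beta>" for \<beta>
      using fd_eq[OF f_deriv[OF that]] by (intro blinfun_eqI) (simp add: differential_at_apply y)
    ultimately show ?thesis
      using bracket_eq[OF \<Lambda> c y(1), of "map f \<gamma>s"] by (auto simp: y o_def)
  qed
  have br_diff: "(bracket A \<Lambda> (map f \<gamma>s) \<circ> chart_inv c) differentiable (at (snd c p))" for \<gamma>s
    using smooth_family_D(4)[OF fam x, of \<gamma>s]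
      has_derivative_cong_open[OF V(1,2), of "bracket A \<Lambda> (map f \<gamma>s) \<circ> chart_inv c" "\<lambda>y. \<Lambda> c y \<gamma>s"] br
    unfolding p(2) differentiable_def by auto
  have br_fd: "differential_at (bracket A \<Lambda> (map f \<gamma>s)) c p = Blinfun (fd (\<lambda>y. \<Lambda> c y \<gamma>s) x)" for \<gamma>s
    using fd_cong[OF V(1,2), of "bracket A \<Lambda> (map f \<gamma>s) \<circ> chart_inv c" "\<lambda>y. \<Lambda> c y \<gamma>s"] br
    unfolding differential_at_def p(2) by simp
  have f_diff: "(f \<beta> \<circ> chart_inv c) differentiable (at (snd c p))" for \<beta>
    using f_deriv[OF V(2)] p(2) by (auto intro: differentiableI)
  have f_fd: "differential_at (f \<beta>) c p = \<beta>" for \<beta>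
    using fd_eq[OF f_deriv[OF V(2)]] f_diff p(2) by (intro blinfun_eqI) (simp add: differential_at_apply)
  have map_f_fd: "map (\<lambda>g. differential_at g c p) (map f \<beta>s) = \<beta>s" for \<beta>s
    by (simp add: f_fd o_def)
  have "\<Lambda> c x (\<beta>s @ [Blinfun (fd (\<lambda>y. \<Lambda> c y \<gamma>s) x)]) =
      bracket A \<Lambda> (map f \<beta>s @ [bracket A \<Lambda> (map f \<gamma>s)]) p"
    by (subst bracket_eq[OF \<Lambda> c p(1)]) (use f_diff br_diff in \<open>auto simp: f_fd br_fd p(2) o_def\<close>)
  also have "\<dots> = (\<Sum>i<Suc n. bracket A \<Lambda> ((map f \<gamma>s)[i := bracket A \<Lambda> (map f \<beta>s @ [map f \<gamma>s ! i])]) p)"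
  proof -
    have "set (map f \<beta>s) \<subseteq> smooth_functions A" "set (map f \<gamma>s) \<subseteq> smooth_functions A"
      "length (map f \<beta>s) = Suc n - 1" "length (map f \<gamma>s) = Suc n" "p \<in> \<Union>(fst ` A)"
      using f_smooth len c p(1) by auto
    then show ?thesis using NP unfolding nambu_poisson_tensor_def by blast
  qed
  also have "\<dots> = (\<Sum>i<Suc n. \<Lambda> c x (\<gamma>s[i := Blinfun (fd (\<lambda>y. \<Lambda> c y (\<beta>s @ [\<gamma>s ! i])) x)]))"
  proof (rule sum.cong[OF refl])
    fix i assume "i \<in> {..<Suc n}"
    then have i: "map f \<beta>s @ [map f \<gamma>s ! i] = map f (\<beta>s @ [\<gamma>s ! i])" using len by simp
    have "(g \<circ> chart_inv c) differentiable (at (snd c p))"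
      if "g \<in> set ((map f \<gamma>s)[i := bracket A \<Lambda> (map f (\<beta>s @ [\<gamma>s ! i]))])" for g
      using that set_update_subset_insert[of "map f \<gamma>s" i] f_diff br_diff by fastforce
    then show "bracket A \<Lambda> ((map f \<gamma>s)[i := bracket A \<Lambda> (map f \<beta>s @ [map f \<gamma>s ! i])]) p =
        \<Lambda> c x (\<gamma>s[i := Blinfun (fd (\<lambda>y. \<Lambda> c y (\<beta>s @ [\<gamma>s ! i])) x)])"
      unfolding i by (subst bracket_eq[OF \<Lambda> c p(1)]) (simp_all only: map_update map_f_fd br_fd p(2))
  qed
  finally show ?thesis .
qed

subsection \<open>The operator \<open>\<delta>\<^sub>\<nu>\<close>\<close>

lemma flat_form:
  assumes P: "P \<in> mvfields A k" and \<nu>: "\<nu> \<in> forms A m" and k: "k \<le> m"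
  shows "flat \<nu> k P \<in> forms A (m - k)"
  unfolding forms_def local_fields_def
proof (intro CollectI conjI allI impI ballI)
  note P' = mvfields_local[OF P] and \<nu>' = forms_local[OF \<nu>]
  note famP = smooth_family_local_field[OF P'] and fam\<nu> = smooth_family_local_field[OF \<nu>']
  show "flat \<nu> k P c x = (\<lambda>_. 0)" if "c \<notin> A \<or> x \<notin> chart_image c" for c x
    using local_field_outside[OF P' that] by (simp add: flat_def contract_def fun_eq_iff)
  fix c assume c: "c \<in> A"
  have alt: "alt_multilinear m (\<nu> c x)" if "x \<in> chart_image c" for x
    using smooth_family_D(2)[OF fam\<nu>[OF c] that] .
  show "alt_multilinear (m - k) (flat \<nu> k P c x)" if "x \<in> chart_image c" for x
    using alt_multilinear_con[OF alt[OF that] k] by (simp add: flat_def contract_eq_con)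
  show "smooth_on (\<lambda>x. flat \<nu> k P c x vs) (chart_image c)" for vs
    unfolding flat_def contract_def
    by (intro smooth_intros open_chart_image c smooth_family_D(3)[OF famP] smooth_family_D(3)[OF fam\<nu>]) simp
  fix c' p vs assume c': "c' \<in> A" and p: "p \<in> fst c \<inter> fst c'"
  let ?T = "transition_deriv c c' p" and ?x = "snd c p" and ?x' = "snd c' p"
  have x: "?x \<in> chart_image c" "?x' \<in> chart_image c'" using p by (auto intro: chart_in_image)
  have alt': "alt_multilinear m (\<nu> c' ?x')" using smooth_family_D(2)[OF fam\<nu>[OF c'] x(2)] .
  show "flat \<nu> k P c ?x vs = flat \<nu> k P c' ?x' (map (blinfun_apply ?T) vs)"
  proof (cases "k + length vs = m")
    case True
    have "P c' ?x' = (\<lambda>\<alpha>s. P c ?x (map (\<lambda>\<alpha>. \<alpha> o\<^sub>L ?T) \<alpha>s))"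
      using mvfields_change[OF P c c'] p by (simp add: fun_eq_iff)
    moreover have "\<nu> c ?x = (\<lambda>us. \<nu> c' ?x' (map (blinfun_apply ?T) us))"
      using forms_change[OF \<nu> c c'] p by (simp add: fun_eq_iff)
    ultimately show ?thesis
      using con_natural[OF smooth_family_D(2)[OF famP[OF c] x(1)] alt' True, of ?T]
      by (simp add: flat_def contract_eq_con)
  next
    case False
    then show ?thesis
      using con_wrong_length[OF alt[OF x(1)], of k vs] con_wrong_length[OF alt', of k "map (blinfun_apply ?T) vs"]
      by (simp add: flat_def contract_eq_con)
  qed
qed

lemma ext_deriv_eq_d_at:
  "c \<in> A \<Longrightarrow> x \<in> chart_image c \<Longrightarrow> ext_deriv A \<omega> c x vs = d_at (\<omega> c) x vs"
  by (simp add: ext_deriv_def d_at_def altsum_def)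

lemma ext_deriv_change:
  assumes \<omega>: "\<omega> \<in> forms A k" and c: "c \<in> A" "c' \<in> A" and p: "p \<in> fst c" "p \<in> fst c'"
  shows "ext_deriv A \<omega> c (snd c p) vs =
    ext_deriv A \<omega> c' (snd c' p) (map (blinfun_apply (transition_deriv c c' p)) vs)"
proof -
  have "d_at (\<omega> c) (snd c p) vs =
      d_at (\<omega> c') (transition c c' (snd c p)) (map (fd (transition c c') (snd c p)) vs)"
  proof (rule d_at_natural[OF smooth_family_local_field[OF forms_local[OF \<omega>] c(2)] open_overlap[OF c] _
        smooth_transition[OF c]])
    show "snd c p \<in> overlap c c'" using p by (auto simp: overlap_def)
    show "transition c c' ` overlap c c' \<subseteq> chart_image c'"
      using transition_image[OF c(1), of c'] overlap_subset[of c' c] by blast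
    fix y vs assume "y \<in> overlap c c'"
    then obtain q where "q \<in> fst c" "q \<in> fst c'" "y = snd c q" by (auto simp: overlap_def)
    then show "\<omega> c y vs = \<omega> c' (transition c c' y) (map (fd (transition c c') y) vs)"
      using forms_change[OF \<omega> c, of q vs] c by (simp add: transition_deriv_apply)
  qed
  then show ?thesis
    using c p by (simp add: ext_deriv_eq_d_at chart_in_image transition_deriv_apply)
qed

lemma volume_form_basis:
  assumes \<nu>: "volume_form A \<nu>" and J: "distinct J" "set J = UNIV" and c: "c \<in> A" "x \<in> chart_image c"
  shows "\<nu> c x (map (\<lambda>i. axis i 1) J) \<noteq> 0"
proof
  have "\<nu> \<in> forms A CARD('m)" using \<nu> by (simp add: volume_form_def)
  note alt = smooth_family_D(2)[OF smooth_family_local_field[OF forms_local[OF this] c(1)] c(2)]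
  assume "\<nu> c x (map (\<lambda>i. axis i 1) J) = 0"
  then have "\<nu> c x vs = 0" for vs
    using alt_multilinear_top_basis[OF alt span_axis J] by blast
  then show False using \<nu> c by (auto simp: volume_form_def)
qed

lemma flat_inj_on:
  assumes \<nu>: "volume_form A \<nu>"
  shows "inj_on (flat \<nu> k) (mvfields A k)"
proof (rule inj_onI, intro ext)
  fix P Q c x \<beta>s assume P: "P \<in> mvfields A k" and Q: "Q \<in> mvfields A k" and eq: "flat \<nu> k P = flat \<nu> k Q"
  have \<nu>': "\<nu> \<in> forms A CARD('m)" using \<nu> by (simp add: volume_form_def)
  show "P c x \<beta>s = Q c x \<beta>s"
  proof (cases "c \<in> A \<and> x \<in> chart_image c")
    case True
    then obtain us where us: "\<nu> c x us \<noteq> 0" using \<nu> by (auto simp: volume_form_def)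
    note alt = smooth_family_D(2)[OF smooth_family_local_field[OF mvfields_local]]
    have "P c x \<beta>s - Q c x \<beta>s = 0"
    proof (rule con_injective[where N = "\<nu> c x" and us = us, OF _ us])
      show "alt_multilinear CARD('m) (\<nu> c x)"
        using smooth_family_D(2)[OF smooth_family_local_field[OF forms_local[OF \<nu>']]] True by blast
      show "alt_multilinear k (\<lambda>\<beta>s. P c x \<beta>s - Q c x \<beta>s)"
        using alt[OF P] alt[OF Q] True by (intro alt_multilinear_diff) auto
      have "con k (P c x) (\<nu> c x) vs = con k (Q c x) (\<nu> c x) vs" for vs
        using fun_cong[OF fun_cong[OF fun_cong[OF eq]], of c x vs] by (simp add: flat_def contract_eq_con)
      then show "con k (\<lambda>\<beta>s. P c x \<beta>s - Q c x \<beta>s) (\<nu> c x) vs = 0" for vs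
        by (simp add: con_def left_diff_distrib sum_subtractf)
    qed
    then show ?thesis by simp
  next
    case False
    then show ?thesis using local_field_outside[OF mvfields_local] P Q by metis
  qed
qed

definition delta_field :: "'m list \<Rightarrow> ('a, 'm) form \<Rightarrow> nat \<Rightarrow> ('a, 'm) mvfield \<Rightarrow> ('a, 'm) mvfield" where
  "delta_field J \<nu> k P = (\<lambda>c x \<beta>s.
     if c \<in> A \<and> x \<in> chart_image c then divergence J k (P c) (\<nu> c) x \<beta>s else 0)"

text \<open>The divergence solves the equation for the preimage in every chart. Since d of
  \<open>flat \<nu> (Suc k) P\<close> is a form and the contraction is natural, the expression from
  another chart, carried over, solves the same equation; injectivity of the contraction makes both
  agree. The result is a global preimage, which evaluates \<open>the_inv_into\<close>.\<close>

lemma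
  assumes \<nu>: "volume_form A \<nu>" and J: "distinct J" "set J = UNIV"
    and P: "P \<in> mvfields A (Suc k)" and k: "Suc k \<le> CARD('m)"
  shows delta_field_mvfields: "delta_field J \<nu> k P \<in> mvfields A k"
    and delta_eq_delta_field: "delta A \<nu> (Suc k) P = delta_field J \<nu> k P"
proof -
  let ?Q = "delta_field J \<nu> k P" and ?E = "ext_deriv A (flat \<nu> (Suc k) P)"
  have \<nu>': "\<nu> \<in> forms A CARD('m)" using \<nu> by (simp add: volume_form_def)
  note fam\<nu> = smooth_family_local_field[OF forms_local[OF \<nu>']]
    and famP = smooth_family_local_field[OF mvfields_local[OF P]]
  note nz = volume_form_basis[OF \<nu> J]
  have famQ: "smooth_family (chart_image c) k (divergence J k (P c) (\<nu> c))" if "c \<in> A" for c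
    by (rule smooth_family_divergence[OF famP[OF that] fam\<nu>[OF that] nz[OF that]])
  have Q: "?Q \<in> local_fields A k"
    unfolding local_fields_def
  proof (intro CollectI conjI allI impI ballI)
    show "?Q c x = (\<lambda>_. 0)" if "c \<notin> A \<or> x \<notin> chart_image c" for c x
      using that by (auto simp: delta_field_def)
    show "alt_multilinear k (?Q c x)" if "c \<in> A" "x \<in> chart_image c" for c x
      using smooth_family_D(2)[OF famQ[OF that(1)] that(2)] that by (simp add: delta_field_def)
    show "smooth_on (\<lambda>x. ?Q c x \<beta>s) (chart_image c)" if "c \<in> A" for c \<beta>s
      by (rule smooth_on_cong[OF smooth_family_D(3)[OF famQ[OF that]] open_chart_image[OF that]])
        (simp add: delta_field_def that)
  qed
  have E: "?E c x vs = con k (?Q c x) (\<nu> c x) vs" if "c \<in> A" "x \<in> chart_image c" for c x vs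
  proof -
    have "?E c x vs = d_at (\<lambda>y. con (Suc k) (P c y) (\<nu> c y)) x vs"
      unfolding ext_deriv_eq_d_at[OF that] by (simp add: flat_def contract_eq_con[abs_def])
    also have "\<dots> = con k (divergence J k (P c) (\<nu> c) x) (\<nu> c x) vs"
      by (rule d_at_con[OF famP[OF that(1)] fam\<nu>[OF that(1)] J nz[OF that] that(2)])
    finally show ?thesis using that by (simp add: delta_field_def[abs_def])
  qed
  show Q_mv: "?Q \<in> mvfields A k"
    unfolding mvfields_def
  proof (intro CollectI conjI ballI allI Q)
    fix c c' p \<alpha>s assume c: "c \<in> A" "c' \<in> A" and p: "p \<in> fst c \<inter> fst c'"
    let ?T = "transition_deriv c c' p" and ?T' = "transition_deriv c' c p"
      and ?x = "snd c p" and ?x' = "snd c' p"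
    have x: "?x \<in> chart_image c" "?x' \<in> chart_image c'" using p by (auto intro: chart_in_image)
    have alt: "alt_multilinear k (?Q c ?x)" "alt_multilinear k (?Q c' ?x')"
      using smooth_family_D(2)[OF smooth_family_local_field[OF Q]] c x by blast+
    have alt\<nu>: "alt_multilinear CARD('m) (\<nu> c ?x)" "alt_multilinear CARD('m) (\<nu> c' ?x')"
      using smooth_family_D(2)[OF fam\<nu>] c x by blast+
    \<comment> \<open>The expression from \<open>c'\<close>, transported to \<open>c\<close> by the
      inverse Jacobian.\<close>
    define R where "R \<alpha>s = ?Q c' ?x' (map (\<lambda>\<alpha>. \<alpha> o\<^sub>L ?T') \<alpha>s)" for \<alpha>s
    have "linear (\<lambda>\<alpha>. \<alpha> o\<^sub>L ?T' :: 'm covector)"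
      by (rule linearI) (auto intro!: blinfun_eqI simp: blinfun.add_left blinfun.scaleR_left)
    then have R: "alt_multilinear k R"
      unfolding R_def[abs_def] by (rule alt_multilinear_map[OF alt(2)])
    have R_pull: "R (map (\<lambda>\<alpha>. \<alpha> o\<^sub>L ?T) \<alpha>s) = ?Q c' ?x' \<alpha>s" for \<alpha>s
      using transition_deriv_inverse[of c' c p] c p by (simp add: R_def o_def blinfun_compose_assoc blinfun_compose_id_right)
    have \<nu>_pull: "(\<lambda>us. \<nu> c' ?x' (map (blinfun_apply ?T) us)) = \<nu> c ?x"
      using forms_change[OF \<nu>' c] p by (simp add: fun_eq_iff)
    have "con k R (\<nu> c ?x) vs = con k (?Q c ?x) (\<nu> c ?x) vs" for vs
    proof (cases "k + length vs = CARD('m)")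
      case True
      have "con k R (\<nu> c ?x) vs = con k (?Q c' ?x') (\<nu> c' ?x') (map (blinfun_apply ?T) vs)"
        using con_natural[OF R alt\<nu>(2) True, of ?T] by (simp only: R_pull \<nu>_pull)
      also have "\<dots> = ?E c' ?x' (map (blinfun_apply ?T) vs)" by (simp only: E[OF c(2) x(2)])
      also have "\<dots> = ?E c ?x vs"
        using ext_deriv_change[OF flat_form[OF P \<nu>' k] c] p by simp
      also have "\<dots> = con k (?Q c ?x) (\<nu> c ?x) vs" by (simp only: E[OF c(1) x(1)])
      finally show ?thesis .
    qed (simp add: con_wrong_length[OF alt\<nu>(1)])
    then have "con k (\<lambda>\<alpha>s. R \<alpha>s - ?Q c ?x \<alpha>s) (\<nu> c ?x) vs = 0" for vs
      by (simp add: con_def left_diff_distrib sum_subtractf)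
    then have "R \<alpha>s - ?Q c ?x \<alpha>s = 0" for \<alpha>s
      using con_injective[OF alt\<nu>(1) nz[OF c(1) x(1)] alt_multilinear_diff[OF R alt(1)]] by blast
    then show "?Q c' ?x' \<alpha>s = ?Q c ?x (map (\<lambda>\<alpha>. \<alpha> o\<^sub>L ?T) \<alpha>s)"
      using R_pull by simp
  qed
  have "flat \<nu> k ?Q = ?E"
  proof (intro ext)
    fix c x vs
    show "flat \<nu> k ?Q c x vs = ?E c x vs"
    proof (cases "c \<in> A \<and> x \<in> chart_image c")
      case True
      then show ?thesis using E by (simp add: flat_def contract_eq_con)
    next
      case False
      then show ?thesis using local_field_outside[OF Q] by (auto simp: flat_def contract_def ext_deriv_def)
    qed
  qed
  then show "delta A \<nu> (Suc k) P = ?Q"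
    unfolding delta_def using the_inv_into_f_f[OF flat_inj_on[OF \<nu>] Q_mv] by simp
qed

text \<open>For \<open>k = 1\<close> the target space is defined by functions. The function is the
  value on the empty list, which the transformation rule makes the same in all charts.\<close>

lemma mvfields_0_scalar:
  assumes "Q \<in> mvfields A 0"
  shows "Q \<in> scalar_field A ` smooth_functions A"
proof
  define f where "f p = (let c = (SOME c. c \<in> A \<and> p \<in> fst c) in Q c (snd c p) [])" for p
  have f: "f p = Q c (snd c p) []" if "c \<in> A" "p \<in> fst c" for c p
  proof -
    define c' where "c' = (SOME c. c \<in> A \<and> p \<in> fst c)"
    have "c' \<in> A" "p \<in> fst c'"
      unfolding c'_def using someI[of "\<lambda>c. c \<in> A \<and> p \<in> fst c" c] that by auto
    then show ?thesis
      using mvfields_change[OF assms that(1) _ that(2), of c' "[]"] by (simp add: f_def Let_def flip: c'_def)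
  qed
  have fx: "f (chart_inv c x) = Q c x []" if "c \<in> A" "x \<in> chart_image c" for c x
    using f[OF that(1) chart_inv_in[OF that(2)]] by (simp add: chart_chart_inv[OF that(2)])
  note fam = smooth_family_local_field[OF mvfields_local[OF assms]]
  show "f \<in> smooth_functions A"
    unfolding smooth_functions_def
  proof (intro CollectI ballI)
    fix c assume c: "c \<in> A"
    show "smooth_on (f \<circ> chart_inv c) (chart_image c)"
      by (rule smooth_on_cong[OF smooth_family_D(3)[OF fam[OF c], of "[]"] open_chart_image[OF c]])
        (simp add: fx c)
  qed
  show "Q = scalar_field A f"
  proof (intro ext)
    fix c x \<beta>s
    show "Q c x \<beta>s = scalar_field A f c x \<beta>s"
      using alt_multilinear_length[OF smooth_family_D(2)[OF fam, of c x], of \<beta>s]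
        local_field_outside[OF mvfields_local[OF assms], of c x \<beta>s]
      by (auto simp: scalar_field_def fx)
  qed
qed

subsection \<open>Tangential multivector fields\<close>

text \<open>Annihilating the Hamiltonian vectors means that inserting \<theta> into \<Lambda> gives
  0 on \<open>U\<close>. The values of the extended form are zero or multiples of pulled-back values
  of \<theta>, so the contraction vanishes in every chart.\<close>

lemma kernel_extension:
  assumes \<Lambda>: "\<Lambda> \<in> mvfields A n" and c: "c \<in> A" and U: "open U" "U \<subseteq> chart_image c" and p: "p \<in> U"
    and \<theta>: "\<And>l. smooth_on (\<lambda>x. blinfun_apply (\<theta> x) (axis l 1)) U"
    and ann: "\<And>x \<beta>s. x \<in> U \<Longrightarrow> blinfun_apply (\<theta> x) (ham (\<Lambda> c) \<beta>s x) = 0"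
  obtains \<alpha> where "\<alpha> \<in> ker_sharp1 A \<Lambda>" "covector_of \<alpha> c p = \<theta> p"
proof -
  obtain \<alpha> where \<alpha>: "\<alpha> \<in> forms A 1" "\<And>v. \<alpha> c p [v] = blinfun_apply (\<theta> p) v"
    and \<alpha>_at: "\<And>c' q. c' \<in> A \<Longrightarrow> q \<in> fst c' \<Longrightarrow> (\<forall>v. \<alpha> c' (snd c' q) [v] = 0) \<or>
      (q \<in> fst c \<and> snd c q \<in> U \<and>
        (\<exists>s. \<forall>v. \<alpha> c' (snd c' q) [v] = s * blinfun_apply (\<theta> (snd c q)) (blinfun_apply (transition_deriv c' c q) v)))"
    by (rule form_extension[OF c U p \<theta>]) (rule that, blast+)
  note alt = smooth_family_D(2)[OF smooth_family_local_field[OF mvfields_local[OF \<Lambda>]]]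
  have \<theta>0: "\<Lambda> c x (\<theta> x # \<beta>s) = 0" if "x \<in> U" for x \<beta>s
    using ann[OF that, of \<beta>s] that U(2) alt_multilinear_to_front[OF alt[OF c], of x \<beta>s "\<theta> x" "[]"]
      apply_ham[of n "\<Lambda> c" x "\<theta> x" \<beta>s] alt[OF c, of x]
    by (auto simp: subset_iff)
  have "\<Lambda> c' x (covector_of \<alpha> c' x # \<beta>s) = 0" if c': "c' \<in> A" and x: "x \<in> chart_image c'" for c' x \<beta>s
  proof -
    define q where "q = chart_inv c' x"
    have q: "q \<in> fst c'" "x = snd c' q" using x by (simp_all add: q_def chart_inv_in chart_chart_inv)
    note lin = alt_multilinear_linear_Cons[OF alt[OF c' x], of \<beta>s]
    note cov = covector_of_apply[OF \<alpha>(1) c' x]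
    from \<alpha>_at[OF c' q(1)] show ?thesis
    proof
      assume "\<forall>v. \<alpha> c' (snd c' q) [v] = 0"
      then have "covector_of \<alpha> c' x = 0" by (intro blinfun_eqI) (simp add: cov flip: q(2))
      then show ?thesis using linear_0[OF lin] by simp
    next
      let ?\<theta> = "\<theta> (snd c q)" and ?T = "transition_deriv c' c q"
      assume "q \<in> fst c \<and> snd c q \<in> U \<and> (\<exists>s. \<forall>v. \<alpha> c' (snd c' q) [v] = s * blinfun_apply ?\<theta> (blinfun_apply ?T v))"
      then obtain s where s: "q \<in> fst c" "snd c q \<in> U"
        "\<And>v. \<alpha> c' (snd c' q) [v] = s * blinfun_apply ?\<theta> (blinfun_apply ?T v)" by blast
      have "covector_of \<alpha> c' x = s *\<^sub>R (?\<theta> o\<^sub>L ?T)"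
        by (intro blinfun_eqI) (simp add: cov s(3)[folded q(2)] blinfun.scaleR_left)
      then have "\<Lambda> c' x (covector_of \<alpha> c' x # \<beta>s) = s * \<Lambda> c' x ((?\<theta> o\<^sub>L ?T) # \<beta>s)"
        using linear_scale[OF lin] by simp
      also have "\<Lambda> c' x ((?\<theta> o\<^sub>L ?T) # \<beta>s) = 0"
        using mvfields_change[OF \<Lambda> c c' s(1) q(1), of "(?\<theta> o\<^sub>L ?T) # \<beta>s"] \<theta>0[OF s(2)]
          transition_deriv_inverse[OF c c' s(1) q(1)]
        by (simp add: q(2) blinfun_compose_assoc blinfun_compose_id_right)
      finally show ?thesis by simp
    qed
  qed
  then have "sharp1 \<Lambda> \<alpha> = (\<lambda>c x \<beta>s. 0)"
    using local_field_outside[OF mvfields_local[OF \<Lambda>]] by (force simp: sharp1_def contract1_def fun_eq_iff)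
  moreover have "covector_of \<alpha> c p = \<theta> p"
    using covector_of_apply[OF \<alpha>(1) c, of p] \<alpha>(2) p U(2) by (intro blinfun_eqI) auto
  ultimately show thesis using \<alpha>(1) by (intro that[of \<alpha>]) (simp_all add: ker_sharp1_def)
qed

lemma delta_field_contract:
  assumes NP: "nambu_poisson_tensor A (Suc n) \<Lambda>"
    and P: "P \<in> mvfields A (Suc (Suc k))" "\<And>\<alpha>. \<alpha> \<in> ker_sharp1 A \<Lambda> \<Longrightarrow> contract1 \<alpha> P = (\<lambda>c x \<beta>s. 0)"
    and \<alpha>: "\<alpha> \<in> ker_sharp1 A \<Lambda>"
  shows "contract1 \<alpha> (delta_field J \<nu> (Suc k) P) = (\<lambda>c x \<beta>s. 0)"
proof (intro ext)
  fix c x \<beta>s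
  have \<Lambda>: "\<Lambda> \<in> mvfields A (Suc n)" using NP by (simp add: nambu_poisson_tensor_def)
  have \<alpha>1: "\<alpha> \<in> forms A 1" and "contract1 \<alpha> \<Lambda> = (\<lambda>c x \<beta>s. 0)"
    using \<alpha> by (simp_all add: ker_sharp1_def sharp1_def)
  note \<Lambda>0 = contract1_eq_0_D[OF this(2)]
  note P0 = contract1_eq_0_D[OF P(2)]
  show "contract1 \<alpha> (delta_field J \<nu> (Suc k) P) c x \<beta>s = 0"
  proof (cases "c \<in> A \<and> x \<in> chart_image c")
    case True
    then have c: "c \<in> A" and x: "x \<in> chart_image c" by auto
    note famP = smooth_family_local_field[OF mvfields_local[OF P(1)] c]
      and fam\<Lambda> = smooth_family_local_field[OF mvfields_local[OF \<Lambda>] c]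
    note S = open_chart_image[OF c]
    let ?a = "covector_of \<alpha> c"
    have a: "smooth_on (\<lambda>y. blinfun_apply (?a y) (axis l 1)) (chart_image c)" for l
      by (rule smooth_on_cong[OF smooth_family_D(3)[OF smooth_family_local_field[OF forms_local[OF \<alpha>1] c]] S])
        (simp add: covector_of_apply[OF \<alpha>1 c])
    define E where "E y = (\<Sum>i\<in>UNIV. \<Sum>l\<in>UNIV. fd (\<lambda>z. blinfun_apply (?a z) (axis l 1)) y (axis i 1) *
        P c y (dcoord i # dcoord l # \<beta>s))" for y
    have "smooth_on E (chart_image c)"
      unfolding E_def by (intro smooth_intros S smooth_on_fd a smooth_family_D(3)[OF famP])
    then have cont: "continuous_on (chart_image c) E" by (rule smooth_on_continuous_on)
    \<comment> \<open>Taking the set where \<open>E\<close> is nonzero as the open set turns density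
      and continuity into a contradiction: a point of maximal rank inside it has
      \<open>E p = 0\<close>.\<close>
    define U where "U = {y \<in> chart_image c. E y \<noteq> 0}"
    have U: "open U" "U \<subseteq> chart_image c"
      using continuous_open_preimage[OF cont S, of "- {0}"] by (auto simp: U_def vimage_def Int_def open_Compl)
    have "U = {}"
    proof (rule ccontr)
      assume "U \<noteq> {}"
      then obtain p where p: "p \<in> U" and ext: "\<And>\<beta> :: 'm covector. (\<And>\<gamma>s. blinfun_apply \<beta> (ham (\<Lambda> c) \<gamma>s p) = 0) \<Longrightarrow>
          \<exists>\<theta> s. (\<forall>l. smooth_on (\<lambda>x. blinfun_apply (\<theta> x) (axis l 1)) U) \<and>
            (\<forall>x\<in>U. \<forall>\<gamma>s. blinfun_apply (\<theta> x) (ham (\<Lambda> c) \<gamma>s x) = 0) \<and> s \<noteq> 0 \<and> \<theta> p = s *\<^sub>R \<beta>"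
        using extend_annihilator[OF U(1), of "ham (\<Lambda> c)"] smooth_on_subset[OF smooth_on_ham[OF fam\<Lambda>] U(2)]
        by blast
      then have pc: "p \<in> chart_image c" using U(2) by blast
      note altP = smooth_family_D(2)[OF famP pc]
      have "E p = 0"
        unfolding E_def
      proof (rule d_kernel_contract_eq_0[OF _ pc a altP])
        show "fd_field ?a p (ham (\<Lambda> c) \<beta>s p) (ham (\<Lambda> c) \<gamma>s p) = fd_field ?a p (ham (\<Lambda> c) \<gamma>s p) (ham (\<Lambda> c) \<beta>s p)"
          for \<beta>s \<gamma>s
          by (rule d_kernel_vanishes_on_ham[OF fam\<Lambda> pc fundamental_identity_chart[OF NP c pc] a \<Lambda>0])
        fix \<beta> :: "'m covector" and \<gamma>s assume "\<And>\<gamma>s. blinfun_apply \<beta> (ham (\<Lambda> c) \<gamma>s p) = 0"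
        then obtain \<theta> s where \<theta>: "\<And>l. smooth_on (\<lambda>x. blinfun_apply (\<theta> x) (axis l 1)) U"
          "\<And>x \<gamma>s. x \<in> U \<Longrightarrow> blinfun_apply (\<theta> x) (ham (\<Lambda> c) \<gamma>s x) = 0" and s: "s \<noteq> 0" "\<theta> p = s *\<^sub>R \<beta>"
          using ext by meson
        from kernel_extension[OF \<Lambda> c U p \<theta>] obtain \<alpha>' where "\<alpha>' \<in> ker_sharp1 A \<Lambda>" "covector_of \<alpha>' c p = \<theta> p"
          by blast
        \<comment> \<open>The extension passes through a multiple of \<beta>, the factor being a
          minor; as it is nonzero, linearity removes it.\<close>
        then have "P c p ((s *\<^sub>R \<beta>) # \<gamma>s) = 0" using P0 s(2) by metis
        then show "P c p (\<beta> # \<gamma>s) = 0"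
          using linear_scale[OF alt_multilinear_linear_Cons[OF altP]] s(1) by simp
      qed
      then show False using p by (simp add: U_def)
    qed
    then have "E x = 0" using x by (auto simp: U_def)
    then show ?thesis
      using divergence_contract[OF famP x a P0[OF \<alpha>], of J "\<nu> c" \<beta>s] c x
      by (simp add: contract1_def delta_field_def E_def)
  qed (auto simp: contract1_def delta_field_def)
qed

end

theorem proposition5p5:
  fixes X :: "'a topology" and A :: "('a, 'm::finite) chart set"
    and \<Lambda> :: "('a, 'm) mvfield" and \<nu> :: "('a, 'm) form" and n :: nat
  assumes "oriented_nambu_poisson_manifold X A n \<Lambda>"
    and "n \<ge> 3"
    and "volume_form A \<nu>"
  shows "\<forall>k\<in>{1..n}. delta A \<nu> k ` tangential_mvfields A \<Lambda> k \<subseteq> tangential_mvfields A \<Lambda> (k - 1)"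
proof (intro ballI subsetI, elim imageE)
  interpret manifold X A
    using assms(1) by unfold_locales (simp add: oriented_nambu_poisson_manifold_def oriented_manifold_def)
  have n: "n \<le> CARD('m)" and NP: "nambu_poisson_tensor A n \<Lambda>"
    using assms(1) by (simp_all add: oriented_nambu_poisson_manifold_def)
  \<comment> \<open>An ordering of the coordinates, which turns a volume form into a density in each
    chart. Another ordering could only change the sign of the density, not its logarithmic
    derivative.\<close>
  obtain J :: "'m list" where J: "distinct J" "set J = UNIV"
    using finite_distinct_list[of "UNIV :: 'm set"] by auto
  fix k Q P assume k: "k \<in> {1..n}" and P: "P \<in> tangential_mvfields A \<Lambda> k" and Q: "Q = delta A \<nu> k P"
  from k obtain j where j: "k = Suc j" by (cases k) auto
  have Pmv: "P \<in> mvfields A (Suc j)" and P0: "\<And>\<alpha>. \<alpha> \<in> ker_sharp1 A \<Lambda> \<Longrightarrow> contract1 \<alpha> P = (\<lambda>c x \<beta>s. 0)"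
    using P by (auto simp: tangential_mvfields_def j)
  have "Suc j \<le> CARD('m)" using k n j by simp
  note delta_field_mvfields[OF assms(3) J Pmv this] delta_eq_delta_field[OF assms(3) J Pmv this]
  then have Q': "Q = delta_field J \<nu> j P" "Q \<in> mvfields A j" by (simp_all add: Q j)
  show "Q \<in> tangential_mvfields A \<Lambda> (k - 1)"
  proof (cases j)
    case 0
    then show ?thesis using mvfields_0_scalar Q' by (simp add: tangential_mvfields_def j)
  next
    case (Suc i)
    from k obtain n' where n': "n = Suc n'" by (cases n) auto
    show ?thesis
      using delta_field_contract[OF NP[unfolded n'] Pmv[unfolded Suc] P0] Q'
      by (simp add: tangential_mvfields_def j Suc)
  qed
qed

end
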